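(* Let $c\in\{1,-1\}$, with $L^m(1)=S^m$ and $L^m(-1)=H^m$. Any totally umbilical biharmonic hypersurface $M^m$ in $L^m(c)\times\mathbb{R}$ is minimal.
   Context: $S^m$ and $H^m$ are the space forms of constant curvature $1$ and $-1$, and $L^m(c)\times\mathbb{R}$ carries the product metric. A hypersurface is an isometric immersion of codimension one, assumed two-sided (with a globally defined unit normal field $\xi$); with shape operator $A$ and mean curvature $H=\frac1m\operatorname{trace}A$, it is totally umbilical if $A=H\,\mathrm{Id}$ and minimal if $H\equiv0$. It is biharmonic if its defining isometric immersion is a biharmonic map (critical point of the bienergy $\frac12\int|\tau|^2$, $\tau$ the tension field). *)

theory Defs
  imports "HOL-Analysis.Analysis"
begin

section \<open>Smooth functions between normed spaces\<close>

primrec Ck_on ::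
  "nat \<Rightarrow> ('a::real_normed_vector \<Rightarrow> 'b::real_normed_vector) \<Rightarrow> 'a set \<Rightarrow> bool" where
  "Ck_on 0 h S \<longleftrightarrow> continuous_on S h"
| "Ck_on (Suc k) h S \<longleftrightarrow>
     (\<forall>x\<in>S. h differentiable (at x)) \<and> (\<forall>v. Ck_on k (\<lambda>x. frechet_derivative h (at x) v) S)"

text \<open>Only meant for open \<open>S\<close>.\<close>

definition smooth_on ::
  "'a set \<Rightarrow> ('a::real_normed_vector \<Rightarrow> 'b::real_normed_vector) \<Rightarrow> bool" where
  "smooth_on S h \<longleftrightarrow> (\<forall>k. Ck_on k h S)"

definition pd :: "'n \<Rightarrow> (real^'n \<Rightarrow> 'b::real_normed_vector) \<Rightarrow> real^'n \<Rightarrow> 'b" where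
  "pd i h x = frechet_derivative h (at x) (axis i 1)"


section \<open>Smooth manifolds\<close>

text \<open>
  The points of a manifold of dimension \<open>CARD('n)\<close> are all the elements of a Hausdorff, second
  countable type \<open>'a\<close>. A chart \<open>(U, \<phi>)\<close> consists of its domain and its coordinate map.
\<close>

type_synonym ('a, 'n) chart = "'a set \<times> ('a \<Rightarrow> real^'n)"

abbreviation dom :: "('a, 'n) chart \<Rightarrow> 'a set" where
  "dom \<kappa> \<equiv> fst \<kappa>"

abbreviation coord :: "('a, 'n) chart \<Rightarrow> 'a \<Rightarrow> real^'n" where
  "coord \<kappa> \<equiv> snd \<kappa>"

definition cod :: "('a, 'n) chart \<Rightarrow> (real^'n) set" where
  "cod \<kappa> = coord \<kappa> ` dom \<kappa>"

definition param :: "('a, 'n) chart \<Rightarrow> real^'n \<Rightarrow> 'a" where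
  "param \<kappa> = inv_into (dom \<kappa>) (coord \<kappa>)"

definition smooth_atlas ::
  "('a::{t2_space, second_countable_topology}, 'n::finite) chart set \<Rightarrow> bool" where
  "smooth_atlas \<A> \<longleftrightarrow>
     (\<forall>\<kappa>\<in>\<A>. open (dom \<kappa>) \<and> open (cod \<kappa>) \<and>
        homeomorphism (dom \<kappa>) (cod \<kappa>) (coord \<kappa>) (param \<kappa>)) \<and>
     (\<Union>\<kappa>\<in>\<A>. dom \<kappa>) = UNIV \<and>
     (\<forall>\<kappa>\<in>\<A>. \<forall>\<kappa>'\<in>\<A>. smooth_on (coord \<kappa> ` (dom \<kappa> \<inter> dom \<kappa>')) (coord \<kappa>' \<circ> param \<kappa>))"

definition chart_at :: "('a, 'n) chart set \<Rightarrow> 'a \<Rightarrow> ('a, 'n) chart" where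
  "chart_at \<A> p = (SOME \<kappa>. \<kappa> \<in> \<A> \<and> p \<in> dom \<kappa>)"

definition smooth_map ::
  "('a, 'n::finite) chart set \<Rightarrow> ('a \<Rightarrow> 'b::real_normed_vector) \<Rightarrow> bool" where
  "smooth_map \<A> u \<longleftrightarrow> (\<forall>\<kappa>\<in>\<A>. smooth_on (cod \<kappa>) (u \<circ> param \<kappa>))"


section \<open>Riemannian metrics\<close>

text \<open>
  A metric is given by its component matrix \<open>g \<kappa> x\<close> in each chart \<open>\<kappa>\<close>, as a function of the
  coordinates \<open>x \<in> cod \<kappa>\<close>; the components in different charts are related by the tensor law.
\<close>

type_synonym ('a, 'n) metric = "('a, 'n) chart \<Rightarrow> real^'n \<Rightarrow> real^'n^'n"

definition riemannian_metric ::
  "('a, 'n::finite) chart set \<Rightarrow> ('a, 'n) metric \<Rightarrow> bool" where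
  "riemannian_metric \<A> g \<longleftrightarrow>
     (\<forall>\<kappa>\<in>\<A>. smooth_on (cod \<kappa>) (g \<kappa>) \<and>
        (\<forall>x\<in>cod \<kappa>. transpose (g \<kappa> x) = g \<kappa> x \<and> (\<forall>v. v \<noteq> 0 \<longrightarrow> v \<bullet> (g \<kappa> x *v v) > 0))) \<and>
     (\<forall>\<kappa>\<in>\<A>. \<forall>\<kappa>'\<in>\<A>. \<forall>p\<in>dom \<kappa> \<inter> dom \<kappa>'.
        (let J = jacobian (coord \<kappa>' \<circ> param \<kappa>) (at (coord \<kappa> p))
         in g \<kappa> (coord \<kappa> p) = transpose J ** g \<kappa>' (coord \<kappa>' p) ** J))"

text \<open>
  The Riemannian volume measure exists and is unique; it is characterised here by its
  density \<open>sqrt (det g)\<close> in every chart.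
\<close>

definition riemannian_volume ::
  "('a::topological_space, 'n::finite) chart set \<Rightarrow> ('a, 'n) metric \<Rightarrow> 'a measure \<Rightarrow> bool" where
  "riemannian_volume \<A> g vol \<longleftrightarrow>
     sets vol = sets borel \<and>
     (\<forall>\<kappa>\<in>\<A>. \<forall>B\<in>sets borel. B \<subseteq> dom \<kappa> \<longrightarrow>
        emeasure vol B = (\<integral>\<^sup>+x\<in>coord \<kappa> ` B. ennreal (sqrt (det (g \<kappa> x))) \<partial>lborel))"

definition christoffel ::
  "(real^'n \<Rightarrow> real^'n^'n) \<Rightarrow> real^'n \<Rightarrow> 'n \<Rightarrow> 'n \<Rightarrow> 'n::finite \<Rightarrow> real" where
  "christoffel G x k i j =
     (\<Sum>l\<in>UNIV. matrix_inv (G x) $ k $ l *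
        (pd i (\<lambda>y. G y $ j $ l) x + pd j (\<lambda>y. G y $ i $ l) x - pd l (\<lambda>y. G y $ i $ j) x)) / 2"


section \<open>The ambient space \<open>L\<^sup>m(c) \<times> \<real>\<close>\<close>

text \<open>
  \<open>S\<^sup>m\<close> is the unit sphere of \<open>\<real>\<^sup>m\<^sup>+\<^sup>1 = \<real>\<^sup>m \<times> \<real>\<close>, and \<open>H\<^sup>m\<close> is the upper sheet of the hyperboloid
  \<open>\<bar>x\<bar>\<^sup>2 - s\<^sup>2 = -1\<close> in Minkowski space. In both cases the metric of \<open>L\<^sup>m(c) \<times> \<real>\<close> is the restriction
  to tangent vectors of the bilinear form \<open>ip c\<close>, which is positive definite there.
\<close>

type_synonym 'n amb = "((real^'n) \<times> real) \<times> real"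

definition space_form :: "real \<Rightarrow> ((real^'n::finite) \<times> real) set" where
  "space_form c = (if c = 1 then sphere 0 1 else {(x, s). x \<bullet> x - s\<^sup>2 = -1 \<and> s > 0})"

definition ambient :: "real \<Rightarrow> 'n::finite amb set" where
  "ambient c = space_form c \<times> UNIV"

definition ip :: "real \<Rightarrow> 'n::finite amb \<Rightarrow> 'n amb \<Rightarrow> real" where
  "ip c v w = fst (fst v) \<bullet> fst (fst w) + c * snd (fst v) * snd (fst w) + snd v * snd w"

text \<open>
  The \<open>ip c\<close>-normal space of \<open>L\<^sup>m(c) \<times> \<real>\<close> at \<open>p\<close> is spanned by the position vector of the
  \<open>L\<^sup>m(c)\<close>-component, and \<open>ip c (radial p) (radial p) = c = 1 / c\<close>.
\<close>

definition radial :: "'n::finite amb \<Rightarrow> 'n amb" where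
  "radial p = (fst p, 0)"

definition ambient_tangent :: "real \<Rightarrow> 'n::finite amb \<Rightarrow> 'n amb set" where
  "ambient_tangent c p = {v. ip c v (radial p) = 0}"

definition tan_proj :: "real \<Rightarrow> 'n::finite amb \<Rightarrow> 'n amb \<Rightarrow> 'n amb" where
  "tan_proj c p v = v - (c * ip c v (radial p)) *\<^sub>R radial p"

text \<open>
  The Levi-Civita connection of \<open>L\<^sup>m(c) \<times> \<real>\<close> is the tangential part of the flat connection of
  the surrounding vector space. So the covariant derivative along \<open>u\<close>, in the \<open>i\<close>-th coordinate
  direction, of a field \<open>V\<close> with \<open>V x\<close> tangent to the ambient space at \<open>u x\<close> is as follows.
\<close>

definition cov_deriv ::
  "real \<Rightarrow> (real^'n \<Rightarrow> 'n::finite amb) \<Rightarrow> 'n \<Rightarrow> (real^'n \<Rightarrow> 'n amb) \<Rightarrow> real^'n \<Rightarrow> 'n amb" where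
  "cov_deriv c u i V x = tan_proj c (u x) (pd i V x)"


section \<open>Biharmonic maps\<close>

text \<open>
  The tension field is the trace of the second fundamental form \<open>\<nabla>du\<close> of the map, in coordinates
  \<open>g\<^sup>i\<^sup>j (\<nabla>\<^sub>i \<partial>\<^sub>j u - \<Gamma>\<^sup>k\<^sub>i\<^sub>j \<partial>\<^sub>k u)\<close>; the value does not depend on the chart.
\<close>

definition tension_coord ::
  "real \<Rightarrow> (real^'n \<Rightarrow> real^'n^'n) \<Rightarrow> (real^'n \<Rightarrow> 'n::finite amb) \<Rightarrow> real^'n \<Rightarrow> 'n amb" where
  "tension_coord c G u x =
     (\<Sum>i\<in>UNIV. \<Sum>j\<in>UNIV. matrix_inv (G x) $ i $ j *\<^sub>R
        (cov_deriv c u i (pd j u) x - (\<Sum>k\<in>UNIV. christoffel G x k i j *\<^sub>R pd k u x)))"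

definition tension ::
  "('a, 'n::finite) chart set \<Rightarrow> ('a, 'n) metric \<Rightarrow> real \<Rightarrow> ('a \<Rightarrow> 'n amb) \<Rightarrow> 'a \<Rightarrow> 'n amb" where
  "tension \<A> g c u p =
     (let \<kappa> = chart_at \<A> p in tension_coord c (g \<kappa>) (u \<circ> param \<kappa>) (coord \<kappa> p))"

definition bienergy ::
  "('a, 'n::finite) chart set \<Rightarrow> ('a, 'n) metric \<Rightarrow> 'a measure \<Rightarrow> real \<Rightarrow> 'a set \<Rightarrow>
     ('a \<Rightarrow> 'n amb) \<Rightarrow> real" where
  "bienergy \<A> g vol c K u =
     1/2 * (LINT p:K|vol. ip c (tension \<A> g c u p) (tension \<A> g c u p))"

definition smooth_variation ::
  "('a, 'n::finite) chart set \<Rightarrow> real \<Rightarrow> ('a \<Rightarrow> 'n amb) \<Rightarrow> 'a set \<Rightarrow> real \<Rightarrow>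
     (real \<Rightarrow> 'a \<Rightarrow> 'n amb) \<Rightarrow> bool" where
  "smooth_variation \<A> c u K \<epsilon> F \<longleftrightarrow>
     \<epsilon> > 0 \<and> F 0 = u \<and>
     (\<forall>t\<in>{-\<epsilon><..<\<epsilon>}. (\<forall>p. F t p \<in> ambient c) \<and> (\<forall>p. p \<notin> K \<longrightarrow> F t p = u p)) \<and>
     (\<forall>\<kappa>\<in>\<A>. smooth_on ({-\<epsilon><..<\<epsilon>} \<times> cod \<kappa>) (\<lambda>(t, x). F t (param \<kappa> x)))"

text \<open>
  As \<open>M\<close> need not be compact, critical points are taken with respect to compactly supported
  variations, with the bienergy integrated over a compact set containing the support.
\<close>

definition biharmonic ::
  "('a::topological_space, 'n::finite) chart set \<Rightarrow> ('a, 'n) metric \<Rightarrow> 'a measure \<Rightarrow> real \<Rightarrow>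
     ('a \<Rightarrow> 'n amb) \<Rightarrow> bool" where
  "biharmonic \<A> g vol c u \<longleftrightarrow>
     smooth_map \<A> u \<and> range u \<subseteq> ambient c \<and>
     (\<forall>K \<epsilon> F. compact K \<longrightarrow> smooth_variation \<A> c u K \<epsilon> F \<longrightarrow>
        ((\<lambda>t. bienergy \<A> g vol c K (F t)) has_real_derivative 0) (at 0))"


section \<open>Hypersurfaces\<close>

definition isometric_immersion ::
  "('a, 'n::finite) chart set \<Rightarrow> ('a, 'n) metric \<Rightarrow> real \<Rightarrow> ('a \<Rightarrow> 'n amb) \<Rightarrow> bool" where
  "isometric_immersion \<A> g c f \<longleftrightarrow>
     smooth_map \<A> f \<and> range f \<subseteq> ambient c \<and>
     (\<forall>\<kappa>\<in>\<A>. \<forall>x\<in>cod \<kappa>.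
        inj (frechet_derivative (f \<circ> param \<kappa>) (at x)) \<and>
        (\<forall>i j. g \<kappa> x $ i $ j = ip c (pd i (f \<circ> param \<kappa>) x) (pd j (f \<circ> param \<kappa>) x)))"

definition unit_normal_field ::
  "('a, 'n::finite) chart set \<Rightarrow> real \<Rightarrow> ('a \<Rightarrow> 'n amb) \<Rightarrow> ('a \<Rightarrow> 'n amb) \<Rightarrow> bool" where
  "unit_normal_field \<A> c f \<xi> \<longleftrightarrow>
     smooth_map \<A> \<xi> \<and>
     (\<forall>p. \<xi> p \<in> ambient_tangent c (f p) \<and> ip c (\<xi> p) (\<xi> p) = 1) \<and>
     (\<forall>\<kappa>\<in>\<A>. \<forall>x\<in>cod \<kappa>. \<forall>i. ip c (\<xi> (param \<kappa> x)) (pd i (f \<circ> param \<kappa>) x) = 0)"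

text \<open>
  The matrix, with respect to the coordinate basis, of the shape operator \<open>A X = - \<nabla>\<^sub>X \<xi>\<close>, i.e.
  \<open>A\<^sup>k\<^sub>i = - g\<^sup>k\<^sup>l \<langle>\<nabla>\<^sub>i \<xi>, \<partial>\<^sub>l f\<rangle>\<close> (\<open>\<nabla>\<^sub>X \<xi>\<close> is tangent to \<open>M\<close> because \<open>\<xi>\<close> is a unit field).
\<close>

definition shape_op ::
  "('a, 'n) metric \<Rightarrow> real \<Rightarrow> ('a \<Rightarrow> 'n::finite amb) \<Rightarrow> ('a \<Rightarrow> 'n amb) \<Rightarrow>
     ('a, 'n) chart \<Rightarrow> real^'n \<Rightarrow> real^'n^'n" where
  "shape_op g c f \<xi> \<kappa> x =
     - (matrix_inv (g \<kappa> x) **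
        (\<chi> l i. ip c (cov_deriv c (f \<circ> param \<kappa>) i (\<xi> \<circ> param \<kappa>) x) (pd l (f \<circ> param \<kappa>) x)))"

definition mean_curvature ::
  "('a, 'n) metric \<Rightarrow> real \<Rightarrow> ('a \<Rightarrow> 'n::finite amb) \<Rightarrow> ('a \<Rightarrow> 'n amb) \<Rightarrow>
     ('a, 'n) chart \<Rightarrow> real^'n \<Rightarrow> real" where
  "mean_curvature g c f \<xi> \<kappa> x = trace (shape_op g c f \<xi> \<kappa> x) / real CARD('n)"

definition totally_umbilical ::
  "('a, 'n::finite) chart set \<Rightarrow> ('a, 'n) metric \<Rightarrow> real \<Rightarrow> ('a \<Rightarrow> 'n amb) \<Rightarrow> ('a \<Rightarrow> 'n amb) \<Rightarrow>
     bool" where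
  "totally_umbilical \<A> g c f \<xi> \<longleftrightarrow>
     (\<forall>\<kappa>\<in>\<A>. \<forall>x\<in>cod \<kappa>. shape_op g c f \<xi> \<kappa> x = mat (mean_curvature g c f \<xi> \<kappa> x))"

definition minimal_hypersurface ::
  "('a, 'n::finite) chart set \<Rightarrow> ('a, 'n) metric \<Rightarrow> real \<Rightarrow> ('a \<Rightarrow> 'n amb) \<Rightarrow> ('a \<Rightarrow> 'n amb) \<Rightarrow>
     bool" where
  "minimal_hypersurface \<A> g c f \<xi> \<longleftrightarrow>
     (\<forall>\<kappa>\<in>\<A>. \<forall>x\<in>cod \<kappa>. mean_curvature g c f \<xi> \<kappa> x = 0)"

end

theory Submission
  imports Defs
begin

text \<open>
  The factor \<open>\<real>\<close> of the ambient space splits off in the tension field: if the map \<open>f\<close> is moved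
  vertically by \<open>t \<phi>\<close>, the tension field changes by exactly \<open>t \<Delta>\<phi>\<close> times the vertical unit vector.
  The bienergy is then a quadratic polynomial in \<open>t\<close> whose linear coefficient is the integral of
  \<open>\<Delta>h \<Delta>\<phi>\<close>, where \<open>h\<close> is the height function of the hypersurface. By Green's identity the height of a
  biharmonic hypersurface satisfies \<open>\<Delta>\<Delta>h = 0\<close> (\<open>height_biharmonic\<close>). For \<open>m \<ge> 2\<close> this single
  component of the biharmonic equation suffices.

  Let \<open>\<nu>\<close> be the vertical component of the unit normal. Umbilicity gives \<open>\<nabla>\<nu> = - H \<nabla>h\<close>,
  \<open>Hess h = H \<nu> g\<close> and \<open>\<bar>\<nabla>h\<bar>\<^sup>2 = 1 - \<nu>\<^sup>2\<close>, and for \<open>m \<ge> 2\<close> the Codazzi equation gives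
  \<open>\<nabla>H = - c \<nu> \<nabla>h\<close>. So every derivative of \<open>\<Delta>h = m H \<nu>\<close> is an expression in \<open>H\<close>, \<open>\<nu>\<close> and \<open>\<nabla>h\<close>, and
  \<open>\<Delta>\<Delta>h = 0\<close> becomes
    \<open>H \<nu> (4 c (1 - \<nu>\<^sup>2) - m (c \<nu>\<^sup>2 + H\<^sup>2)) = 0\<close>.
  On the open set \<open>H \<nu> \<noteq> 0\<close> the bracket vanishes, and its gradient is \<open>(8 + 4 m) c H \<nu> \<nabla>h\<close>; hence
  \<open>\<nabla>h = 0\<close> there, so \<open>H \<nu> g = Hess h = 0\<close>, and the set is empty. If now \<open>H \<noteq> 0\<close> at a point, then
  \<open>\<nu> = 0\<close> nearby, so \<open>\<nabla>h = 0\<close> by \<open>\<nabla>\<nu> = - H \<nabla>h\<close>, which contradicts \<open>\<bar>\<nabla>h\<bar>\<^sup>2 = 1 - \<nu>\<^sup>2 = 1\<close>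
  (\<open>umbilical_height_biharmonic_imp_minimal\<close>).

  For \<open>m = 1\<close> the Codazzi equation is void, but \<open>L\<^sup>1(c)\<close> has a unit Killing field too, and moving the
  curve along it makes the bienergy quadratic in the same way (\<open>angular_acceleration_harmonic\<close>). In
  terms of arc length, both velocity components of the curve are then quadratic polynomials whose
  squares add up to \<open>1\<close>, so both are constant (\<open>one_dimensional_biharmonic\<close>).

  The tension field at a point is computed in an unspecified chart. The chart independence of the
  Laplacian that this requires is obtained from the immersion itself, as the tangential part of its
  Hessian vanishes in every chart (\<open>lap_chart_independent\<close>).
\<close>

section \<open>Smooth functions\<close>

lemma differentiable_cong_open:
  assumes "open S" "x \<in> S" "\<And>y. y \<in> S \<Longrightarrow> h y = k y"
  shows "h differentiable (at x) \<longleftrightarrow> k differentiable (at x)"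
  by (metis assms differentiable_def has_derivative_transform_within_open)

lemma frechet_derivative_cong_open:
  assumes "open S" "x \<in> S" "\<And>y. y \<in> S \<Longrightarrow> h y = k y"
  shows "frechet_derivative h (at x) = frechet_derivative k (at x)"
proof -
  have "(h has_derivative D) (at x) \<longleftrightarrow> (k has_derivative D) (at x)" for D
    by (metis assms has_derivative_transform_within_open)
  then show ?thesis by (simp add: frechet_derivative_def)
qed

lemma frechet_derivativeD:
  "h differentiable (at x) \<Longrightarrow> (h has_derivative frechet_derivative h (at x)) (at x)"
  by (simp add: frechet_derivative_works)

lemma frechet_derivativeI:
  "(h has_derivative D) (at x) \<Longrightarrow> frechet_derivative h (at x) = D"
  by (metis frechet_derivative_at)

lemma Ck_on_cong:
  assumes "open S" "\<And>x. x \<in> S \<Longrightarrow> h x = k x"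
  shows "Ck_on n h S \<longleftrightarrow> Ck_on n k S"
  using assms(2)
proof (induction n arbitrary: h k)
  case 0
  then show ?case by (simp cong: continuous_on_cong)
next
  case (Suc n)
  have "Ck_on n (\<lambda>x. frechet_derivative h (at x) v) S \<longleftrightarrow>
        Ck_on n (\<lambda>x. frechet_derivative k (at x) v) S" for v
    by (rule Suc.IH) (metis Suc.prems assms(1) frechet_derivative_cong_open)
  moreover have "h differentiable (at x) \<longleftrightarrow> k differentiable (at x)" if "x \<in> S" for x
    using differentiable_cong_open[OF assms(1) that] Suc.prems by blast
  ultimately show ?case by simp
qed

lemma Ck_on_imp_continuous_on: "Ck_on n h S \<Longrightarrow> continuous_on S h"
proof (cases n)
  case (Suc m)
  assume "Ck_on n h S"
  then have "\<forall>x\<in>S. isCont h x"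
    using Suc by (auto intro: differentiable_imp_continuous_within)
  then show ?thesis by (simp add: continuous_at_imp_continuous_on)
qed auto

lemma Ck_on_SucD: "Ck_on (Suc n) h S \<Longrightarrow> Ck_on n h S"
proof (induction n arbitrary: h)
  case 0
  then show ?case using Ck_on_imp_continuous_on[OF 0] by simp
next
  case (Suc n)
  from Suc.prems have "\<forall>x\<in>S. h differentiable (at x)"
      "\<And>v. Ck_on (Suc n) (\<lambda>x. frechet_derivative h (at x) v) S"
    unfolding Ck_on.simps(2)[of "Suc n"] by blast+
  then show ?case
    using Suc.IH by (metis Ck_on.simps(2))
qed

lemma Ck_on_subset: "Ck_on n h S \<Longrightarrow> T \<subseteq> S \<Longrightarrow> Ck_on n h T"
  by (induction n arbitrary: h) (auto intro: continuous_on_subset)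

text \<open>
  A derivative is taken in the whole space, so it depends on the germ of the function only.
\<close>

lemma Ck_on_local:
  assumes "open S" "\<And>x. x \<in> S \<Longrightarrow> \<exists>U. open U \<and> x \<in> U \<and> Ck_on n h (S \<inter> U)"
  shows "Ck_on n h S"
  using assms(2)
proof (induction n arbitrary: h)
  case 0
  have "isCont h x" if x: "x \<in> S" for x
  proof -
    obtain U where "open U" "x \<in> U" "Ck_on 0 h (S \<inter> U)"
      using 0 x by blast
    then show ?thesis
      using assms(1) x by (simp add: continuous_on_eq_continuous_at open_Int)
  qed
  then show ?case by (simp add: continuous_at_imp_continuous_on)
next
  case (Suc n)
  have "h differentiable (at x)" if "x \<in> S" for x
    using Suc.prems[OF that] that by auto
  moreover have "Ck_on n (\<lambda>x. frechet_derivative h (at x) v) S" for v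
  proof (rule Suc.IH)
    fix x assume "x \<in> S"
    then show "\<exists>U. open U \<and> x \<in> U \<and> Ck_on n (\<lambda>x. frechet_derivative h (at x) v) (S \<inter> U)"
      using Suc.prems[of x] by auto
  qed
  ultimately show ?case by simp
qed

lemma Ck_on_const: "Ck_on n (\<lambda>x. a) S"
  by (induction n arbitrary: a) auto

lemma Ck_on_linear:
  assumes "bounded_linear L" "open S"
  shows "Ck_on n h S \<Longrightarrow> Ck_on n (\<lambda>x. L (h x)) S"
proof (induction n arbitrary: h)
  case 0
  then show ?case
    using assms(1) by (auto intro: bounded_linear.continuous_on)
next
  case (Suc n)
  have D: "((\<lambda>x. L (h x)) has_derivative (\<lambda>v. L (frechet_derivative h (at x) v))) (at x)"
    if "x \<in> S" for x
    using Suc.prems that by (auto intro!: bounded_linear.has_derivative[OF assms(1)] frechet_derivativeD)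
  have "Ck_on n (\<lambda>x. frechet_derivative (\<lambda>x. L (h x)) (at x) v) S" for v
    by (subst Ck_on_cong[OF assms(2), where k = "\<lambda>x. L (frechet_derivative h (at x) v)"])
      (use Suc in \<open>auto simp: frechet_derivativeI[OF D]\<close>)
  then show ?case using D by (auto simp: differentiable_def)
qed

lemma Ck_on_bounded_linear:
  assumes "bounded_linear L" shows "Ck_on n L S"
proof (cases n)
  case 0
  then show ?thesis using assms by (auto intro: bounded_linear.continuous_on)
next
  case (Suc k)
  have D: "(L has_derivative L) (at x)" for x
    using assms by (rule bounded_linear_imp_has_derivative)
  then show ?thesis using Suc by (auto simp: frechet_derivativeI[OF D] Ck_on_const differentiable_def)
qed

lemma Ck_on_add:
  assumes "open S"
  shows "Ck_on n h S \<Longrightarrow> Ck_on n k S \<Longrightarrow> Ck_on n (\<lambda>x. h x + k x) S"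
proof (induction n arbitrary: h k)
  case 0
  then show ?case by (auto intro: continuous_on_add)
next
  case (Suc n)
  have D: "((\<lambda>x. h x + k x) has_derivative
      (\<lambda>v. frechet_derivative h (at x) v + frechet_derivative k (at x) v)) (at x)" if "x \<in> S" for x
    using Suc.prems that by (auto intro!: has_derivative_add frechet_derivativeD)
  have "Ck_on n (\<lambda>x. frechet_derivative (\<lambda>x. h x + k x) (at x) v) S" for v
    by (subst Ck_on_cong[OF assms,
          where k = "\<lambda>x. frechet_derivative h (at x) v + frechet_derivative k (at x) v"])
      (use Suc in \<open>auto simp: frechet_derivativeI[OF D]\<close>)
  then show ?case using D by (auto simp: differentiable_def)
qed

lemma Ck_on_bilinear:
  assumes "bounded_bilinear B" "open S"
  shows "Ck_on n h S \<Longrightarrow> Ck_on n k S \<Longrightarrow> Ck_on n (\<lambda>x. B (h x) (k x)) S"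
proof (induction n arbitrary: h k)
  case 0
  then show ?case using assms(1) by (auto intro: bounded_bilinear.continuous_on)
next
  case (Suc n)
  have D: "((\<lambda>x. B (h x) (k x)) has_derivative
      (\<lambda>v. B (h x) (frechet_derivative k (at x) v) + B (frechet_derivative h (at x) v) (k x))) (at x)"
    if "x \<in> S" for x
    using Suc.prems that
    by (auto intro!: bounded_bilinear.FDERIV[OF assms(1)] frechet_derivativeD)
  have "Ck_on n (\<lambda>x. frechet_derivative (\<lambda>x. B (h x) (k x)) (at x) v) S" for v
    apply (subst Ck_on_cong[OF assms(2), where k = "\<lambda>x. B (h x) (frechet_derivative k (at x) v)
        + B (frechet_derivative h (at x) v) (k x)"])
     apply (simp add: frechet_derivativeI[OF D])
    using Suc.prems by (intro Ck_on_add[OF assms(2)] Suc.IH) (auto intro: Ck_on_SucD)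
  then show ?case using D by (auto simp: differentiable_def)
qed

lemma Ck_on_sum:
  assumes "open S" "\<And>a. a \<in> A \<Longrightarrow> Ck_on n (h a) S"
  shows "Ck_on n (\<lambda>x. \<Sum>a\<in>A. h a x) S"
  using assms(2)
  by (induction A rule: infinite_finite_induct) (auto intro: Ck_on_const Ck_on_add[OF assms(1)])

text \<open>
  By the chain rule, a directional derivative of the composition is a sum, over a basis of the middle
  space, of products of a component of a derivative of \<open>\<psi>\<close> with a composition to which the induction
  hypothesis applies. This is why the middle space is Euclidean and \<open>\<phi>\<close> is arbitrary in the induction.
\<close>

lemma Ck_on_compose:
  fixes \<psi> :: "'c::real_normed_vector \<Rightarrow> 'a::euclidean_space"
    and \<phi> :: "'a \<Rightarrow> 'b::real_normed_vector"
  assumes "open S" "\<psi> ` S \<subseteq> T"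
  shows "Ck_on n \<psi> S \<Longrightarrow> Ck_on n \<phi> T \<Longrightarrow> Ck_on n (\<lambda>x. \<phi> (\<psi> x)) S"
proof (induction n arbitrary: \<phi>)
  case 0
  then show ?case using assms(2) continuous_on_compose2[of T \<phi> S \<psi>] by simp
next
  case (Suc n)
  have D: "((\<lambda>x. \<phi> (\<psi> x)) has_derivative
      (\<lambda>v. frechet_derivative \<phi> (at (\<psi> x)) (frechet_derivative \<psi> (at x) v))) (at x)"
    if "x \<in> S" for x
    using Suc.prems that assms(2)
    by (intro has_derivative_compose[OF frechet_derivativeD frechet_derivativeD]) auto
  have L: "frechet_derivative \<phi> (at y) w = (\<Sum>b\<in>Basis. (w \<bullet> b) *\<^sub>R frechet_derivative \<phi> (at y) b)"
    if "y \<in> T" for y w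
  proof -
    have "linear (frechet_derivative \<phi> (at y))"
      using Suc.prems that by (auto intro: linear_frechet_derivative)
    then have "frechet_derivative \<phi> (at y) (\<Sum>b\<in>Basis. (w \<bullet> b) *\<^sub>R b)
        = (\<Sum>b\<in>Basis. (w \<bullet> b) *\<^sub>R frechet_derivative \<phi> (at y) b)"
      by (simp add: linear_sum linear_cmul)
    then show ?thesis by (simp add: euclidean_representation)
  qed
  have "Ck_on n (\<lambda>x. frechet_derivative (\<lambda>x. \<phi> (\<psi> x)) (at x) v) S" for v
  proof (subst Ck_on_cong[OF assms(1), where k = "\<lambda>x. \<Sum>b\<in>Basis. (frechet_derivative \<psi> (at x) v \<bullet> b)
        *\<^sub>R frechet_derivative \<phi> (at (\<psi> x)) b"])
    show "frechet_derivative (\<lambda>x. \<phi> (\<psi> x)) (at x) v =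
        (\<Sum>b\<in>Basis. (frechet_derivative \<psi> (at x) v \<bullet> b) *\<^sub>R frechet_derivative \<phi> (at (\<psi> x)) b)"
      if "x \<in> S" for x
      using L[of "\<psi> x"] assms(2) that by (auto simp: frechet_derivativeI[OF D[OF that]])
    show "Ck_on n (\<lambda>x. \<Sum>b\<in>Basis. (frechet_derivative \<psi> (at x) v \<bullet> b)
        *\<^sub>R frechet_derivative \<phi> (at (\<psi> x)) b) S"
      using Suc.prems Ck_on_SucD[OF Suc.prems(1)]
      by (intro Ck_on_sum[OF assms(1)] Ck_on_bilinear[OF bounded_bilinear_scaleR assms(1)] Suc.IH
          Ck_on_linear[OF bounded_linear_inner_left assms(1)]) auto
  qed
  then show ?case using D by (auto simp: differentiable_def)
qed

text \<open>
  The derivative of \<open>1 / q\<close> is a polynomial in \<open>1 / q\<close> and the derivative of \<open>q\<close>, so the induction reproduces itself.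
\<close>

lemma Ck_on_inverse:
  fixes q :: "'c::real_normed_vector \<Rightarrow> real"
  assumes "open S" "\<And>x. x \<in> S \<Longrightarrow> q x \<noteq> 0"
  shows "Ck_on n q S \<Longrightarrow> Ck_on n (\<lambda>x. inverse (q x)) S"
proof (induction n)
  case 0
  then show ?case using assms by (auto intro!: continuous_intros)
next
  case (Suc n)
  have IH: "Ck_on n (\<lambda>x. inverse (q x)) S" using Suc Ck_on_SucD by blast
  have D: "((\<lambda>x. inverse (q x)) has_derivative
      (\<lambda>v. - (inverse (q x) * frechet_derivative q (at x) v * inverse (q x)))) (at x)" if "x \<in> S" for x
    using Suc.prems that assms(2) by (intro Deriv.has_derivative_inverse frechet_derivativeD) auto
  have "Ck_on n (\<lambda>x. frechet_derivative (\<lambda>x. inverse (q x)) (at x) v) S" for v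
    apply (subst Ck_on_cong[OF assms(1), where
          k = "\<lambda>x. - (inverse (q x) * frechet_derivative q (at x) v * inverse (q x))"])
     apply (simp add: frechet_derivativeI[OF D])
    using Suc.prems by (intro Ck_on_linear[OF bounded_linear_minus[OF bounded_linear_ident] assms(1)]
        Ck_on_bilinear[OF bounded_bilinear_mult assms(1)] IH) auto
  then show ?case using D by (auto simp: differentiable_def)
qed

lemma Ck_on_sqrt:
  fixes q :: "'c::real_normed_vector \<Rightarrow> real"
  assumes "open S" "\<And>x. x \<in> S \<Longrightarrow> q x > 0"
  shows "Ck_on n q S \<Longrightarrow> Ck_on n (\<lambda>x. sqrt (q x)) S"
proof (induction n)
  case 0
  then show ?case by (auto intro!: continuous_intros)
next
  case (Suc n)
  have IH: "Ck_on n (\<lambda>x. sqrt (q x)) S" using Suc Ck_on_SucD by blast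
  have D: "((\<lambda>x. sqrt (q x)) has_derivative
      (\<lambda>v. (1/2) * (inverse (sqrt (q x)) * frechet_derivative q (at x) v))) (at x)" if "x \<in> S" for x
  proof -
    have "((\<lambda>x. sqrt (q x)) has_derivative
      (\<lambda>v. inverse (sqrt (q x)) / 2 * frechet_derivative q (at x) v)) (at x)"
      using has_derivative_compose[of q "frechet_derivative q (at x)" x UNIV,
          OF _ DERIV_real_sqrt[OF assms(2)[OF that], unfolded has_field_derivative_def]]
        frechet_derivativeD[of q x] Suc.prems that
      by simp
    then show ?thesis by (simp add: mult.assoc)
  qed
  have "Ck_on n (\<lambda>x. frechet_derivative (\<lambda>x. sqrt (q x)) (at x) v) S" for v
    apply (subst Ck_on_cong[OF assms(1), where
          k = "\<lambda>x. (1/2) * (inverse (sqrt (q x)) * frechet_derivative q (at x) v)"])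
     apply (simp add: frechet_derivativeI[OF D])
    using Suc.prems assms(2) by (intro Ck_on_linear[OF bounded_linear_mult_right assms(1)]
        Ck_on_bilinear[OF bounded_bilinear_mult assms(1)] Ck_on_inverse[OF assms(1)] IH)
      (auto simp: less_imp_neq[symmetric])
  then show ?case using D by (auto simp: differentiable_def)
qed

lemma smooth_on_cong:
  "open S \<Longrightarrow> (\<And>x. x \<in> S \<Longrightarrow> h x = k x) \<Longrightarrow> smooth_on S h \<longleftrightarrow> smooth_on S k"
  unfolding smooth_on_def using Ck_on_cong by blast

lemma smooth_on_subset: "smooth_on S h \<Longrightarrow> T \<subseteq> S \<Longrightarrow> smooth_on T h"
  unfolding smooth_on_def using Ck_on_subset by blast

lemma smooth_on_local:
  assumes "open S" "\<And>x. x \<in> S \<Longrightarrow> \<exists>U. open U \<and> x \<in> U \<and> smooth_on (S \<inter> U) h"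
  shows "smooth_on S h"
  unfolding smooth_on_def
  using assms(2) by (intro allI Ck_on_local[OF assms(1)]) (unfold smooth_on_def, blast)

lemma smooth_on_imp_differentiable: "smooth_on S h \<Longrightarrow> x \<in> S \<Longrightarrow> h differentiable (at x)"
  unfolding smooth_on_def by (drule spec[of _ "Suc 0"]) (simp only: Ck_on.simps(2))

lemma smooth_on_imp_continuous_on: "smooth_on S h \<Longrightarrow> continuous_on S h"
  unfolding smooth_on_def using Ck_on_imp_continuous_on by blast

lemma smooth_on_frechet_derivative:
  "smooth_on S h \<Longrightarrow> smooth_on S (\<lambda>x. frechet_derivative h (at x) v)"
  unfolding smooth_on_def
proof
  fix k assume "\<forall>k. Ck_on k h S"
  then have "Ck_on (Suc k) h S" by blast
  then show "Ck_on k (\<lambda>x. frechet_derivative h (at x) v) S" by simp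
qed

lemma smooth_on_pd: "smooth_on S h \<Longrightarrow> smooth_on S (pd i h)"
  unfolding pd_def[abs_def] by (rule smooth_on_frechet_derivative)

lemma smooth_on_const: "smooth_on S (\<lambda>x. a)"
  by (simp add: smooth_on_def Ck_on_const)

lemma smooth_on_bounded_linear: "bounded_linear L \<Longrightarrow> smooth_on S L"
  by (simp add: smooth_on_def Ck_on_bounded_linear)

lemma smooth_on_linear: "bounded_linear L \<Longrightarrow> open S \<Longrightarrow> smooth_on S h \<Longrightarrow> smooth_on S (\<lambda>x. L (h x))"
  by (simp add: smooth_on_def Ck_on_linear)

lemma smooth_on_bilinear:
  "bounded_bilinear B \<Longrightarrow> open S \<Longrightarrow> smooth_on S h \<Longrightarrow> smooth_on S k \<Longrightarrow> smooth_on S (\<lambda>x. B (h x) (k x))"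
  by (simp add: smooth_on_def Ck_on_bilinear)

lemma smooth_on_add: "open S \<Longrightarrow> smooth_on S h \<Longrightarrow> smooth_on S k \<Longrightarrow> smooth_on S (\<lambda>x. h x + k x)"
  by (simp add: smooth_on_def Ck_on_add)

lemma smooth_on_minus: "open S \<Longrightarrow> smooth_on S h \<Longrightarrow> smooth_on S (\<lambda>x. - h x)"
  by (rule smooth_on_linear[OF bounded_linear_minus[OF bounded_linear_ident]])

lemma smooth_on_diff:
  "open S \<Longrightarrow> smooth_on S h \<Longrightarrow> smooth_on S k \<Longrightarrow> smooth_on S (\<lambda>x. h x - k x)"
  using smooth_on_add[of S h "\<lambda>x. - k x"] smooth_on_minus[of S k] by simp

lemma smooth_on_scaleR:
  "open S \<Longrightarrow> smooth_on S h \<Longrightarrow> smooth_on S k \<Longrightarrow> smooth_on S (\<lambda>x. h x *\<^sub>R k x)"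
  by (rule smooth_on_bilinear[OF bounded_bilinear_scaleR])

lemma smooth_on_mult:
  fixes h k :: "_ \<Rightarrow> real"
  shows "open S \<Longrightarrow> smooth_on S h \<Longrightarrow> smooth_on S k \<Longrightarrow> smooth_on S (\<lambda>x. h x * k x)"
  by (rule smooth_on_bilinear[OF bounded_bilinear_mult])

lemma smooth_on_sum:
  "open S \<Longrightarrow> (\<And>a. a \<in> A \<Longrightarrow> smooth_on S (h a)) \<Longrightarrow> smooth_on S (\<lambda>x. \<Sum>a\<in>A. h a x)"
  by (simp add: smooth_on_def Ck_on_sum)

lemma smooth_on_prod:
  fixes h :: "_ \<Rightarrow> _ \<Rightarrow> real"
  assumes "open S" "\<And>a. a \<in> A \<Longrightarrow> smooth_on S (h a)"
  shows "smooth_on S (\<lambda>x. \<Prod>a\<in>A. h a x)"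
  using assms(2)
  by (induction A rule: infinite_finite_induct) (auto intro: smooth_on_const smooth_on_mult[OF assms(1)])

lemma smooth_on_inverse:
  fixes q :: "_ \<Rightarrow> real"
  shows "open S \<Longrightarrow> (\<And>x. x \<in> S \<Longrightarrow> q x \<noteq> 0) \<Longrightarrow> smooth_on S q \<Longrightarrow> smooth_on S (\<lambda>x. inverse (q x))"
  by (simp add: smooth_on_def Ck_on_inverse)

lemma smooth_on_divide:
  fixes p q :: "_ \<Rightarrow> real"
  shows "open S \<Longrightarrow> (\<And>x. x \<in> S \<Longrightarrow> q x \<noteq> 0) \<Longrightarrow> smooth_on S p \<Longrightarrow> smooth_on S q
    \<Longrightarrow> smooth_on S (\<lambda>x. p x / q x)"
  unfolding divide_inverse by (intro smooth_on_mult smooth_on_inverse)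

lemma smooth_on_sqrt:
  fixes q :: "_ \<Rightarrow> real"
  shows "open S \<Longrightarrow> (\<And>x. x \<in> S \<Longrightarrow> q x > 0) \<Longrightarrow> smooth_on S q \<Longrightarrow> smooth_on S (\<lambda>x. sqrt (q x))"
  by (simp add: smooth_on_def Ck_on_sqrt)

lemma smooth_on_compose:
  fixes \<psi> :: "'c::real_normed_vector \<Rightarrow> 'a::euclidean_space"
  shows "open S \<Longrightarrow> \<psi> ` S \<subseteq> T \<Longrightarrow> smooth_on S \<psi> \<Longrightarrow> smooth_on T \<phi> \<Longrightarrow> smooth_on S (\<lambda>x. \<phi> (\<psi> x))"
  by (simp add: smooth_on_def Ck_on_compose)

lemma smooth_on_Pair:
  fixes h :: "_ \<Rightarrow> 'a::real_normed_vector" and k :: "_ \<Rightarrow> 'b::real_normed_vector"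
  assumes "open S" "smooth_on S h" "smooth_on S k"
  shows "smooth_on S (\<lambda>x. (h x, k x))"
proof -
  have *: "bounded_linear (\<lambda>u::'a. (u, 0::'b))" "bounded_linear (\<lambda>v::'b. (0::'a, v))"
    by (rule bounded_linear_Pair[OF bounded_linear_ident bounded_linear_zero],
        rule bounded_linear_Pair[OF bounded_linear_zero bounded_linear_ident])
  show ?thesis
    using smooth_on_add[OF assms(1) smooth_on_linear[OF *(1) assms(1,2)]
        smooth_on_linear[OF *(2) assms(1,3)]] by simp
qed

lemmas smooth_on_snd = smooth_on_linear[OF bounded_linear_snd]
lemmas smooth_on_vec_nth = smooth_on_linear[OF bounded_linear_vec_nth]

lemma smooth_on_det:
  fixes G :: "'c::real_normed_vector \<Rightarrow> real^'n^'n"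
  assumes "open S" "\<And>i j. smooth_on S (\<lambda>x. G x $ i $ j)"
  shows "smooth_on S (\<lambda>x. det (G x))"
  unfolding det_def by (intro smooth_on_sum smooth_on_mult smooth_on_prod smooth_on_const assms)

lemma matrix_inv_inverse:
  fixes A :: "real^'n^'n"
  assumes "det A \<noteq> 0"
  shows matrix_inv_right: "A ** matrix_inv A = mat 1" and matrix_inv_left: "matrix_inv A ** A = mat 1"
proof -
  have "\<exists>B. A ** B = mat 1 \<and> B ** A = mat 1"
    using assms by (simp add: invertible_det_nz[symmetric] invertible_def)
  from someI_ex[OF this] show "A ** matrix_inv A = mat 1" "matrix_inv A ** A = mat 1"
    by (simp_all add: matrix_inv_def)
qed

text \<open>
  Cramer's rule shows that the entries of the inverse are rational functions of the entries.
\<close>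

lemma matrix_inv_cramer:
  fixes A :: "real^'n^'n"
  assumes "det A \<noteq> 0"
  shows "matrix_inv A $ k $ j = det (\<chi> i l. if l = k then axis j 1 $ i else A $ i $ l) / det A"
proof -
  have "A ** matrix_inv A = mat 1"
    using assms by (rule matrix_inv_right)
  then have "A *v (matrix_inv A *v axis j 1) = axis j 1"
    by (simp add: matrix_vector_mul_assoc)
  then have "matrix_inv A *v axis j 1
      = (\<chi> k. det (\<chi> i l. if l = k then axis j 1 $ i else A $ i $ l) / det A)"
    using cramer[OF assms] by blast
  moreover have "matrix_inv A $ k $ j = (matrix_inv A *v axis j 1) $ k"
    by (simp add: matrix_vector_mul_component inner_axis)
  ultimately show ?thesis by simp
qed

lemma smooth_on_matrix_inv:
  fixes G :: "'c::real_normed_vector \<Rightarrow> real^'n^'n"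
  assumes "open S" "smooth_on S G" "\<And>x. x \<in> S \<Longrightarrow> det (G x) \<noteq> 0"
  shows "smooth_on S (\<lambda>x. matrix_inv (G x) $ k $ j)"
proof -
  have G: "smooth_on S (\<lambda>x. G x $ i $ l)" for i l
    by (intro smooth_on_vec_nth assms)
  have *: "smooth_on S (\<lambda>x. if l = k then axis j 1 $ i else G x $ i $ l)" for i l
    by (cases "l = k") (simp_all add: G smooth_on_const)
  have "smooth_on S (\<lambda>x. det (\<chi> i l. if l = k then axis j 1 $ i else G x $ i $ l) / det (G x))"
    using * by (intro smooth_on_divide smooth_on_det assms G) simp_all
  then show ?thesis
    using smooth_on_cong[OF assms(1), where h = "\<lambda>x. matrix_inv (G x) $ k $ j"]
      matrix_inv_cramer[of "G _" k j] assms(3) by simp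
qed

section \<open>Partial derivatives\<close>

lemma has_derivative_pd: "(h has_derivative D) (at x) \<Longrightarrow> pd i h x = D (axis i 1)"
  by (simp add: pd_def frechet_derivativeI)

lemma pd_cong:
  assumes "open S" "x \<in> S" "\<And>y. y \<in> S \<Longrightarrow> h y = k y"
  shows "pd i h x = pd i k x"
  unfolding pd_def using frechet_derivative_cong_open[OF assms] by simp

lemma pd_const [simp]: "pd i (\<lambda>x. a) x = 0"
  by (simp add: pd_def)

lemma pd_linear:
  assumes "bounded_linear L" "h differentiable (at x)"
  shows "pd i (\<lambda>y. L (h y)) x = L (pd i h x)"
  using has_derivative_pd[OF bounded_linear.has_derivative[OF assms(1) frechet_derivativeD[OF assms(2)]]]
  by (simp add: pd_def)

lemma pd_bilinear:
  assumes "bounded_bilinear B" "h differentiable (at x)" "k differentiable (at x)"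
  shows "pd i (\<lambda>y. B (h y) (k y)) x = B (pd i h x) (k x) + B (h x) (pd i k x)"
  using has_derivative_pd[OF bounded_bilinear.FDERIV[OF assms(1) frechet_derivativeD[OF assms(2)]
        frechet_derivativeD[OF assms(3)]]]
  by (simp add: pd_def)

lemma pd_add:
  assumes "h differentiable (at x)" "k differentiable (at x)"
  shows "pd i (\<lambda>y. h y + k y) x = pd i h x + pd i k x"
  using has_derivative_pd[OF has_derivative_add[OF assms[THEN frechet_derivativeD]]]
  by (simp add: pd_def)

lemma pd_diff:
  assumes "h differentiable (at x)" "k differentiable (at x)"
  shows "pd i (\<lambda>y. h y - k y) x = pd i h x - pd i k x"
  using has_derivative_pd[OF has_derivative_diff[OF assms[THEN frechet_derivativeD]]]
  by (simp add: pd_def)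

lemma pd_sum:
  assumes "\<And>a. a \<in> A \<Longrightarrow> h a differentiable (at x)"
  shows "pd i (\<lambda>y. \<Sum>a\<in>A. h a y) x = (\<Sum>a\<in>A. pd i (h a) x)"
  using has_derivative_pd[OF has_derivative_sum[of A h "\<lambda>a. frechet_derivative (h a) (at x)"]]
    frechet_derivativeD[OF assms]
  by (simp add: pd_def)

lemmas pd_minus = pd_linear[OF bounded_linear_minus[OF bounded_linear_ident]]
lemmas pd_mult = pd_bilinear[OF bounded_bilinear_mult]
lemmas pd_scaleR = pd_bilinear[OF bounded_bilinear_scaleR]
lemmas pd_snd = pd_linear[OF bounded_linear_snd]
lemmas pd_cmult = pd_linear[OF bounded_linear_mult_right]
lemmas pd_inner_left = pd_linear[OF bounded_linear_inner_left]

lemma pd_square: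
  fixes h :: "real^'n \<Rightarrow> real"
  assumes "h differentiable (at x)"
  shows "pd i (\<lambda>y. (h y)\<^sup>2) x = 2 * h x * pd i h x"
  using pd_mult[OF assms assms] by (simp add: power2_eq_square)

lemma frechet_derivative_pd:
  fixes h :: "real^'n \<Rightarrow> 'b::real_normed_vector"
  assumes "h differentiable (at x)"
  shows "frechet_derivative h (at x) v = (\<Sum>i\<in>UNIV. v $ i *\<^sub>R pd i h x)"
proof -
  have l: "linear (frechet_derivative h (at x))"
    using assms by (rule linear_frechet_derivative)
  have "v = (\<Sum>i\<in>UNIV. v $ i *\<^sub>R axis i 1)"
    by (simp add: vec_eq_iff axis_def if_distrib sum.delta cong: if_cong)
  then have "frechet_derivative h (at x) v = frechet_derivative h (at x) (\<Sum>i\<in>UNIV. v $ i *\<^sub>R axis i 1)"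
    by simp
  also have "\<dots> = (\<Sum>i\<in>UNIV. v $ i *\<^sub>R pd i h x)"
    by (simp add: linear_sum[OF l] linear_cmul[OF l] pd_def)
  finally show ?thesis .
qed

lemma pd_chain:
  fixes \<phi> :: "real^'n \<Rightarrow> 'b::real_normed_vector" and \<psi> :: "real^'m \<Rightarrow> real^'n"
  assumes "\<psi> differentiable (at x)" "\<phi> differentiable (at (\<psi> x))"
  shows "pd i (\<lambda>y. \<phi> (\<psi> y)) x = (\<Sum>a\<in>UNIV. pd i \<psi> x $ a *\<^sub>R pd a \<phi> (\<psi> x))"
proof -
  have "pd i (\<lambda>y. \<phi> (\<psi> y)) x = frechet_derivative \<phi> (at (\<psi> x)) (pd i \<psi> x)"
    using has_derivative_pd[OF has_derivative_compose[OF frechet_derivativeD[OF assms(1)]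
          frechet_derivativeD[OF assms(2)]]] by (simp add: pd_def)
  then show ?thesis using frechet_derivative_pd[OF assms(2)] by simp
qed

lemma pd_line:
  fixes h :: "real^'n \<Rightarrow> real"
  assumes "h differentiable (at (y + t *\<^sub>R axis i 1))"
  shows "((\<lambda>s. h (y + s *\<^sub>R axis i 1)) has_real_derivative pd i h (y + t *\<^sub>R axis i 1)) (at t)"
proof -
  have l: "linear (frechet_derivative h (at (y + t *\<^sub>R axis i 1)))"
    using assms by (rule linear_frechet_derivative)
  have "((\<lambda>s. y + s *\<^sub>R axis i 1) has_derivative (\<lambda>s. s *\<^sub>R axis i 1)) (at t)"
    by (auto intro!: derivative_eq_intros)
  from has_derivative_compose[OF this frechet_derivativeD[OF assms]]
  have "((\<lambda>s. h (y + s *\<^sub>R axis i 1)) has_derivative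
     (\<lambda>s. frechet_derivative h (at (y + t *\<^sub>R axis i 1)) (s *\<^sub>R axis i 1))) (at t)" .
  then show ?thesis
    by (simp add: has_field_derivative_def linear_cmul[OF l] pd_def mult.commute[of _ "frechet_derivative _ _ _"])
qed

text \<open>
  The mean value theorem, used first in the \<open>i\<close>-th and then in the \<open>j\<close>-th direction.
\<close>

lemma second_difference:
  fixes h :: "real^'n \<Rightarrow> real"
  assumes "smooth_on U h" "s > 0"
    and U: "\<And>\<sigma> \<tau>. 0 \<le> \<sigma> \<Longrightarrow> \<sigma> \<le> s \<Longrightarrow> 0 \<le> \<tau> \<Longrightarrow> \<tau> \<le> s \<Longrightarrow> x + \<sigma> *\<^sub>R axis i 1 + \<tau> *\<^sub>R axis j 1 \<in> U"
  shows "\<exists>\<sigma> \<tau>. 0 < \<sigma> \<and> \<sigma> < s \<and> 0 < \<tau> \<and> \<tau> < s \<and>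
    h (x + s *\<^sub>R axis i 1 + s *\<^sub>R axis j 1) - h (x + s *\<^sub>R axis i 1) - h (x + s *\<^sub>R axis j 1) + h x
      = s * (s * pd j (pd i h) (x + \<sigma> *\<^sub>R axis i 1 + \<tau> *\<^sub>R axis j 1))"
proof -
  let ?e = "axis i 1 :: real^'n" and ?f = "axis j 1 :: real^'n"
  define q where "q = (\<lambda>\<sigma>. h ((x + s *\<^sub>R ?f) + \<sigma> *\<^sub>R ?e) - h (x + \<sigma> *\<^sub>R ?e))"
  have d: "h differentiable (at (x + \<sigma> *\<^sub>R ?e + \<tau> *\<^sub>R ?f))" "pd i h differentiable (at (x + \<sigma> *\<^sub>R ?e + \<tau> *\<^sub>R ?f))"
    if "0 \<le> \<sigma>" "\<sigma> \<le> s" "0 \<le> \<tau>" "\<tau> \<le> s" for \<sigma> \<tau>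
    using U[OF that] assms(1) by (auto intro: smooth_on_imp_differentiable smooth_on_pd)
  have "(q has_real_derivative (pd i h ((x + s *\<^sub>R ?f) + \<sigma> *\<^sub>R ?e) - pd i h (x + \<sigma> *\<^sub>R ?e))) (at \<sigma>)"
    if "0 \<le> \<sigma>" "\<sigma> \<le> s" for \<sigma>
    unfolding q_def
    using d(1)[of \<sigma> 0] d(1)[of \<sigma> s] that assms(2)
    by (intro DERIV_diff pd_line) (simp_all add: add_ac)
  from MVT2[OF assms(2) this] obtain \<sigma> where \<sigma>: "0 < \<sigma>" "\<sigma> < s"
    and 1: "q s - q 0 = s * (pd i h ((x + s *\<^sub>R ?f) + \<sigma> *\<^sub>R ?e) - pd i h (x + \<sigma> *\<^sub>R ?e))"
    by auto
  have "((\<lambda>\<tau>. pd i h ((x + \<sigma> *\<^sub>R ?e) + \<tau> *\<^sub>R ?f)) has_real_derivative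
      pd j (pd i h) ((x + \<sigma> *\<^sub>R ?e) + \<tau> *\<^sub>R ?f)) (at \<tau>)" if "0 \<le> \<tau>" "\<tau> \<le> s" for \<tau>
    using d(2)[of \<sigma> \<tau>] that \<sigma> by (intro pd_line) simp
  from MVT2[OF assms(2) this] obtain \<tau> where \<tau>: "0 < \<tau>" "\<tau> < s"
    and 2: "pd i h ((x + \<sigma> *\<^sub>R ?e) + s *\<^sub>R ?f) - pd i h ((x + \<sigma> *\<^sub>R ?e) + 0 *\<^sub>R ?f)
       = s * pd j (pd i h) ((x + \<sigma> *\<^sub>R ?e) + \<tau> *\<^sub>R ?f)"
    by auto
  have "(x + s *\<^sub>R ?f) + \<sigma> *\<^sub>R ?e = (x + \<sigma> *\<^sub>R ?e) + s *\<^sub>R ?f" for \<sigma>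
    by (simp add: add_ac)
  with 1 2 have "q s - q 0 = s * (s * pd j (pd i h) (x + \<sigma> *\<^sub>R ?e + \<tau> *\<^sub>R ?f))"
    by simp
  then have "h (x + s *\<^sub>R ?e + s *\<^sub>R ?f) - h (x + s *\<^sub>R ?e) - h (x + s *\<^sub>R ?f) + h x
      = s * (s * pd j (pd i h) (x + \<sigma> *\<^sub>R ?e + \<tau> *\<^sub>R ?f))"
    by (simp add: q_def algebra_simps)
  then show ?thesis
    using \<sigma> \<tau> by blast
qed

text \<open>
  The second difference is symmetric in \<open>i\<close> and \<open>j\<close>, so both mixed derivatives take a common value
  at points arbitrarily close to \<open>x\<close>, and they are continuous.
\<close>

lemma pd_commute_real:
  fixes h :: "real^'n \<Rightarrow> real"
  assumes "smooth_on U h" "open U" "x \<in> U"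
  shows "pd i (pd j h) x = pd j (pd i h) x"
proof (rule ccontr)
  let ?e = "axis i 1 :: real^'n" and ?f = "axis j 1 :: real^'n"
  define a where "a = pd j (pd i h)"
  define b where "b = pd i (pd j h)"
  assume "pd i (pd j h) x \<noteq> pd j (pd i h) x"
  then have pos: "\<bar>a x - b x\<bar> / 2 > 0" by (simp add: a_def b_def)
  have "isCont a x" "isCont b x"
    unfolding a_def b_def
    using smooth_on_imp_continuous_on[OF smooth_on_pd[OF smooth_on_pd[OF assms(1)]]] assms(2,3)
    by (simp_all add: continuous_on_eq_continuous_at)
  then have "\<exists>d>0. \<forall>y. dist y x < d \<longrightarrow> dist (a y) (a x) < \<bar>a x - b x\<bar> / 2"
    "\<exists>d>0. \<forall>y. dist y x < d \<longrightarrow> dist (b y) (b x) < \<bar>a x - b x\<bar> / 2"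
    unfolding continuous_at_eps_delta using pos by blast+
  then obtain d1 d2 where d: "d1 > 0" "d2 > 0"
    "\<And>y. dist y x < d1 \<Longrightarrow> dist (a y) (a x) < \<bar>a x - b x\<bar> / 2"
    "\<And>y. dist y x < d2 \<Longrightarrow> dist (b y) (b x) < \<bar>a x - b x\<bar> / 2"
    by blast
  obtain d3 where d3: "d3 > 0" "ball x d3 \<subseteq> U"
    using assms(2,3) openE by blast
  \<comment> \<open>every point of the second difference has distance at most \<open>2 s\<close> from \<open>x\<close>\<close>
  define s where "s = min d1 (min d2 d3) / 3"
  have s: "s > 0" "3 * s \<le> d1" "3 * s \<le> d2" "3 * s \<le> d3"
    using d d3 by (auto simp: s_def)
  have near: "dist (x + \<sigma> *\<^sub>R axis i' 1 + \<tau> *\<^sub>R axis j' 1) x < 3 * s"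
    if "0 \<le> \<sigma>" "\<sigma> \<le> s" "0 \<le> \<tau>" "\<tau> \<le> s" for \<sigma> \<tau> and i' j' :: 'n
  proof -
    have "dist (x + \<sigma> *\<^sub>R axis i' 1 + \<tau> *\<^sub>R axis j' 1) x = norm (\<sigma> *\<^sub>R axis i' 1 + \<tau> *\<^sub>R (axis j' 1 :: real^'n))"
      by (simp add: dist_norm add.assoc)
    also have "\<dots> \<le> \<sigma> + \<tau>"
      by (rule norm_triangle_le) (use that in simp)
    finally show ?thesis using that s(1) by linarith
  qed
  have inU: "x + \<sigma> *\<^sub>R axis i' 1 + \<tau> *\<^sub>R axis j' 1 \<in> U"
    if "0 \<le> \<sigma>" "\<sigma> \<le> s" "0 \<le> \<tau>" "\<tau> \<le> s" for \<sigma> \<tau> and i' j' :: 'n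
    using near[OF that, of i' j'] s(4) d3(2) by (auto simp: dist_commute subset_iff)
  obtain \<sigma> \<tau> where 1: "0 < \<sigma>" "\<sigma> < s" "0 < \<tau>" "\<tau> < s"
    "h (x + s *\<^sub>R ?e + s *\<^sub>R ?f) - h (x + s *\<^sub>R ?e) - h (x + s *\<^sub>R ?f) + h x
      = s * (s * a (x + \<sigma> *\<^sub>R ?e + \<tau> *\<^sub>R ?f))"
    using second_difference[OF assms(1) s(1) inU[of _ _ i j]] unfolding a_def by auto
  obtain \<sigma>' \<tau>' where 2: "0 < \<sigma>'" "\<sigma>' < s" "0 < \<tau>'" "\<tau>' < s"
    "h (x + s *\<^sub>R ?f + s *\<^sub>R ?e) - h (x + s *\<^sub>R ?f) - h (x + s *\<^sub>R ?e) + h x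
      = s * (s * b (x + \<sigma>' *\<^sub>R ?f + \<tau>' *\<^sub>R ?e))"
    using second_difference[OF assms(1) s(1) inU[of _ _ j i]] unfolding b_def by auto
  have eq: "x + s *\<^sub>R ?f + s *\<^sub>R ?e = x + s *\<^sub>R ?e + s *\<^sub>R ?f" by (simp add: add_ac)
  have "s * (s * a (x + \<sigma> *\<^sub>R ?e + \<tau> *\<^sub>R ?f)) = s * (s * b (x + \<sigma>' *\<^sub>R ?f + \<tau>' *\<^sub>R ?e))"
    using 1(5) 2(5)[unfolded eq] by linarith
  then have "a (x + \<sigma> *\<^sub>R ?e + \<tau> *\<^sub>R ?f) = b (x + \<sigma>' *\<^sub>R ?f + \<tau>' *\<^sub>R ?e)"
    using s(1) by simp
  moreover have "dist (a (x + \<sigma> *\<^sub>R ?e + \<tau> *\<^sub>R ?f)) (a x) < \<bar>a x - b x\<bar> / 2"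
    using near[of \<sigma> \<tau> i j] 1 s by (intro d) simp
  moreover have "dist (b (x + \<sigma>' *\<^sub>R ?f + \<tau>' *\<^sub>R ?e)) (b x) < \<bar>a x - b x\<bar> / 2"
    using near[of \<sigma>' \<tau>' j i] 2 s by (intro d) simp
  ultimately show False unfolding dist_real_def by argo
qed

lemma pd_commute:
  fixes h :: "real^'n \<Rightarrow> 'b::real_inner"
  assumes "smooth_on U h" "open U" "x \<in> U"
  shows "pd i (pd j h) x = pd j (pd i h) x"
proof -
  have "pd i (pd j h) x \<bullet> b = pd j (pd i h) x \<bullet> b" for b
  proof -
    have D: "pd k (\<lambda>y. h y \<bullet> b) y = pd k h y \<bullet> b" if "y \<in> U" for k y
      using smooth_on_imp_differentiable[OF assms(1) that] by (rule pd_inner_left)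
    have "pd k (pd l (\<lambda>y. h y \<bullet> b)) x = pd k (pd l h) x \<bullet> b" for k l
    proof -
      have "pd k (pd l (\<lambda>y. h y \<bullet> b)) x = pd k (\<lambda>y. pd l h y \<bullet> b) x"
        by (rule pd_cong[OF assms(2,3) D])
      then show ?thesis
        using pd_inner_left[OF smooth_on_imp_differentiable[OF smooth_on_pd[OF assms(1)] assms(3)]] by metis
    qed
    moreover have "smooth_on U (\<lambda>y. h y \<bullet> b)"
      by (rule smooth_on_linear[OF bounded_linear_inner_left assms(2,1)])
    ultimately show ?thesis
      using pd_commute_real[OF _ assms(2,3), of "\<lambda>y. h y \<bullet> b" i j] by simp
  qed
  then show ?thesis by (metis inner_commute vector_eq_rdot)
qed

section \<open>Smooth bump functions\<close>

text \<open>
  The functions \<open>p(1/x) exp(-1/x)\<close>, extended by zero to \<open>x \<le> 0\<close>. They form a family closed under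
  differentiation, which makes each of them smooth.
\<close>

definition flat_exp :: "real poly \<Rightarrow> real \<Rightarrow> real" where
  "flat_exp p x = (if x > 0 then poly p (1 / x) * exp (- (1 / x)) else 0)"

lemma tendsto_poly_times_exp_minus: "((\<lambda>y. poly p y * exp (- y)) \<longlongrightarrow> (0::real)) at_top"
proof -
  have "((\<lambda>y. (\<Sum>i\<le>degree p. coeff p i * (y ^ i / exp y))) \<longlongrightarrow> (\<Sum>i\<le>degree p. coeff p i * 0)) at_top"
    by (intro tendsto_intros tendsto_power_div_exp_0)
  then show ?thesis
    by (simp add: poly_altdef sum_distrib_right exp_minus divide_inverse mult.assoc)
qed

lemma flat_exp_has_derivative:
  "(flat_exp p has_real_derivative flat_exp ([:0, 0, 1:] * (p - pderiv p)) x) (at x)"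
proof -
  consider "x > 0" | "x < 0" | "x = 0" by linarith
  then show ?thesis
  proof cases
    case 1
    have "((\<lambda>x. poly p (1 / x) * exp (- (1 / x))) has_real_derivative
        flat_exp ([:0, 0, 1:] * (p - pderiv p)) x) (at x)"
      using 1 by (auto intro!: derivative_eq_intros poly_DERIV[THEN DERIV_chain2]
          simp: flat_exp_def field_simps power2_eq_square)
    then show ?thesis
      by (rule has_field_derivative_transform_within_open[where S = "{0<..}"])
        (use 1 in \<open>auto simp: flat_exp_def\<close>)
  next
    case 2
    have "((\<lambda>x. 0) has_real_derivative flat_exp ([:0, 0, 1:] * (p - pderiv p)) x) (at x)"
      using 2 by (auto simp: flat_exp_def)
    then show ?thesis
      by (rule has_field_derivative_transform_within_open[where S = "{..<0}"])
        (use 2 in \<open>auto simp: flat_exp_def\<close>)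
  next
    case 3
    \<comment> \<open>for \<open>h > 0\<close> the quotient is again of the form \<open>q(1/h) exp(-1/h)\<close>, with \<open>q = X p\<close>\<close>
    have "((\<lambda>h. flat_exp p h / h) \<longlongrightarrow> 0) (at_right 0)"
    proof -
      have "((\<lambda>h. poly (pCons 0 p) (inverse h) * exp (- (inverse h))) \<longlongrightarrow> 0) (at_right (0::real))"
        using filterlim_compose[OF tendsto_poly_times_exp_minus filterlim_inverse_at_top_right] .
      moreover have "\<forall>\<^sub>F h in at_right (0::real). poly (pCons 0 p) (inverse h) * exp (- (inverse h)) = flat_exp p h / h"
        unfolding eventually_at_right_field
        by (intro exI[of _ 1]) (auto simp: flat_exp_def field_simps)
      ultimately show ?thesis by (rule Lim_transform_eventually)
    qed
    moreover have "((\<lambda>h. flat_exp p h / h) \<longlongrightarrow> 0) (at_left 0)"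
    proof (rule Lim_transform_eventually[OF tendsto_const])
      show "\<forall>\<^sub>F h in at_left (0::real). 0 = flat_exp p h / h"
        unfolding eventually_at_left_field
        by (intro exI[of _ "-1"]) (auto simp: flat_exp_def)
    qed
    ultimately have "((\<lambda>h. flat_exp p h / h) \<longlongrightarrow> 0) (at 0)"
      by (intro filterlim_split_at)
    then show ?thesis using 3 by (simp add: DERIV_def flat_exp_def)
  qed
qed

lemma smooth_on_real_family:
  fixes F :: "(real \<Rightarrow> real) set"
  assumes "\<And>q. q \<in> F \<Longrightarrow> \<exists>q'\<in>F. \<forall>x. (q has_real_derivative q' x) (at x)" "q \<in> F"
  shows "smooth_on UNIV q"
proof -
  have "Ck_on n (\<lambda>x. q x *\<^sub>R a) UNIV" if "q \<in> F" for n q and a :: real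
    using that
  proof (induction n arbitrary: q a)
    case 0
    then obtain q' where "\<And>x. (q has_real_derivative q' x) (at x)" using assms(1) by blast
    then have "isCont q x" for x by (rule DERIV_isCont)
    then show ?case by (auto intro!: continuous_intros simp: continuous_on_eq_continuous_at)
  next
    case (Suc n)
    then obtain q' where q': "q' \<in> F" "\<And>x. (q has_real_derivative q' x) (at x)" using assms(1) by blast
    have D: "((\<lambda>x. q x *\<^sub>R a) has_derivative (\<lambda>v. q' x *\<^sub>R (v * a))) (at x)" for x
      using q'(2)[of x] by (auto simp: has_field_derivative_def intro!: derivative_eq_intros)
    have "Ck_on n (\<lambda>x. q' x *\<^sub>R (v * a)) UNIV" for v
      by (rule Suc.IH[OF q'(1)])
    then show ?case using D unfolding Ck_on.simps frechet_derivativeI[OF D] differentiable_def by blast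
  qed
  from this[OF assms(2), of _ 1] show ?thesis by (simp add: smooth_on_def)
qed

lemma smooth_flat_exp: "smooth_on UNIV (flat_exp p)"
  by (rule smooth_on_real_family[of "range flat_exp"]) (use flat_exp_has_derivative in blast)+

definition bump :: "'a::euclidean_space \<Rightarrow> real \<Rightarrow> 'a \<Rightarrow> real" where
  "bump x0 r x = flat_exp [:1:] (r\<^sup>2 - (x - x0) \<bullet> (x - x0))"

lemma smooth_bump: "smooth_on UNIV (bump x0 r)"
proof -
  have "smooth_on UNIV (\<lambda>x. r\<^sup>2 - (x - x0) \<bullet> (x - x0))"
    by (intro smooth_on_diff smooth_on_const smooth_on_bilinear[OF bounded_bilinear_inner]
        smooth_on_bounded_linear bounded_linear_ident) auto
  from smooth_on_compose[OF _ _ this smooth_flat_exp] show ?thesis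
    by (simp add: bump_def[abs_def])
qed

lemma bump_nonneg: "bump x0 r x \<ge> 0"
  by (simp add: bump_def flat_exp_def)

lemma bump_pos_iff: "r > 0 \<Longrightarrow> bump x0 r x > 0 \<longleftrightarrow> x \<in> ball x0 r"
proof -
  assume "r > 0"
  then have "r\<^sup>2 - (x - x0) \<bullet> (x - x0) > 0 \<longleftrightarrow> norm (x - x0) < r"
    using norm_lt_square[of "x - x0" r] by (simp add: power2_eq_square)
  then show ?thesis by (auto simp: bump_def flat_exp_def dist_norm norm_minus_commute)
qed

lemma bump_eq_0: "r > 0 \<Longrightarrow> x \<notin> ball x0 r \<Longrightarrow> bump x0 r x = 0"
  using bump_pos_iff[of r x0 x] bump_nonneg[of x0 r x] by linarith

section \<open>Integration by parts\<close>

text \<open>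
  The integral of a difference quotient of \<open>Z\<close> vanishes by translation invariance of Lebesgue
  measure. The difference quotients converge to the partial derivative; they vanish outside a fixed
  ball and are bounded by the maximum of the partial derivative.
\<close>

lemma integral_pd_eq_0:
  fixes Z :: "real^'n \<Rightarrow> real"
  assumes sm: "smooth_on UNIV Z" and supp: "\<And>x. x \<notin> cball x0 R \<Longrightarrow> Z x = 0"
  shows "integrable lborel (pd i Z)" and "integral\<^sup>L lborel (pd i Z) = 0"
proof -
  let ?e = "axis i 1 :: real^'n"
  have dZ: "Z differentiable (at x)" for x
    using smooth_on_imp_differentiable[OF sm] by simp
  have cZ: "continuous_on UNIV Z" "continuous_on UNIV (pd i Z)"
    using smooth_on_imp_continuous_on sm smooth_on_pd by blast+
  have supp': "pd i Z x = 0" if "x \<notin> cball x0 R" for x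
    using pd_cong[of "- cball x0 R" x Z "\<lambda>_. 0" i] supp that by auto
  have "compact (pd i Z ` cball x0 R)"
    by (intro compact_continuous_image continuous_on_subset[OF cZ(2)]) auto
  then obtain L where L: "\<And>y. y \<in> cball x0 R \<Longrightarrow> \<bar>pd i Z y\<bar> \<le> L"
    using compact_imp_bounded bounded_iff by (metis imageI real_norm_def)
  have L': "\<bar>pd i Z y\<bar> \<le> max L 0" for y
    using L[of y] supp'[of y] by (cases "y \<in> cball x0 R") auto
  have ind: "g = (\<lambda>x. indicator (cball x0 R) x *\<^sub>R g x)"
    if "\<And>x. x \<notin> cball x0 R \<Longrightarrow> g x = 0" for g :: "real^'n \<Rightarrow> real"
    using that by (auto simp: indicator_def fun_eq_iff)
  have int: "integrable lborel g" if "continuous_on UNIV g" "\<And>x. x \<notin> cball x0 R \<Longrightarrow> g x = 0"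
    for g :: "real^'n \<Rightarrow> real"
    by (subst ind[OF that(2)], assumption,
        rule borel_integrable_compact[OF compact_cball continuous_on_subset[OF that(1)]]) simp
  show "integrable lborel (pd i Z)" by (rule int[OF cZ(2) supp'])
  have intZ: "integrable lborel Z" by (rule int[OF cZ(1) supp])
  have meas: "Z \<in> borel_measurable borel" "pd i Z \<in> borel_measurable borel"
    using cZ by (auto intro: borel_measurable_continuous_onI)
  define q where "q = (\<lambda>n x. (Z (x + (1 / Suc n) *\<^sub>R ?e) - Z x) / (1 / Suc n))"
  have "integral\<^sup>L lborel (q n) = 0" for n
  proof -
    let ?a = "(1 / Suc n) *\<^sub>R ?e"
    have d: "distr lborel borel ((+) ?a) = lborel" by (rule lborel_distr_plus)
    have 1: "integral\<^sup>L lborel Z = (\<integral>x. Z (?a + x) \<partial>lborel)"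
      by (subst d[symmetric], rule integral_distr) (use meas in auto)
    have 2: "integrable lborel (\<lambda>x. Z (?a + x))"
      by (rule integrable_distr[where M' = borel]) (use intZ d in simp_all)
    show ?thesis
      unfolding q_def using 1 2 intZ by (simp add: add.commute)
  qed
  moreover have "(\<lambda>n. integral\<^sup>L lborel (q n)) \<longlonglongrightarrow> integral\<^sup>L lborel (pd i Z)"
  proof (rule integral_dominated_convergence[where w = "\<lambda>x. indicator (cball x0 (R + 1)) x *\<^sub>R max L 0"])
    show "pd i Z \<in> borel_measurable lborel" using meas by simp
    show "q n \<in> borel_measurable lborel" for n
      unfolding q_def using meas by measurable
    show "integrable lborel (\<lambda>x. indicator (cball x0 (R + 1)) x *\<^sub>R max L 0)"
      by (rule borel_integrable_compact) auto
    show "AE x in lborel. (\<lambda>n. q n x) \<longlonglongrightarrow> pd i Z x"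
    proof (rule AE_I2)
      fix x
      have "((\<lambda>h. (Z (x + (0 + h) *\<^sub>R ?e) - Z (x + 0 *\<^sub>R ?e)) / h) \<longlongrightarrow> pd i Z x) (at 0)"
        using pd_line[OF dZ, where y = x and t = 0 and i = i] by (simp add: DERIV_def)
      moreover have "filterlim (\<lambda>n. 1 / real (Suc n)) (at 0) sequentially"
        unfolding filterlim_at using LIMSEQ_inverse_real_of_nat
        by (simp add: inverse_eq_divide)
      ultimately have "(\<lambda>n. (Z (x + (0 + 1 / real (Suc n)) *\<^sub>R ?e) - Z (x + 0 *\<^sub>R ?e)) / (1 / real (Suc n)))
          \<longlonglongrightarrow> pd i Z x"
        by (rule filterlim_compose)
      then show "(\<lambda>n. q n x) \<longlonglongrightarrow> pd i Z x"
        by (simp only: q_def add_0_left scaleR_zero_left add_0_right)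
    qed
    show "AE x in lborel. norm (q n x) \<le> indicator (cball x0 (R + 1)) x *\<^sub>R max L 0" for n
    proof (rule AE_I2)
      fix x
      have pos: "1 / real (Suc n) > 0" "1 / real (Suc n) \<le> 1" by auto
      show "norm (q n x) \<le> indicator (cball x0 (R + 1)) x *\<^sub>R max L 0"
      proof (cases "x \<in> cball x0 (R + 1)")
        case True
        have "\<exists>z>0. z < 1 / real (Suc n) \<and> Z (x + (1 / real (Suc n)) *\<^sub>R ?e) - Z (x + 0 *\<^sub>R ?e)
            = (1 / real (Suc n) - 0) * pd i Z (x + z *\<^sub>R ?e)"
          by (rule MVT2[OF pos(1)]) (rule pd_line[OF dZ])
        then obtain z where "Z (x + (1 / real (Suc n)) *\<^sub>R ?e) - Z x
            = (1 / real (Suc n)) * pd i Z (x + z *\<^sub>R ?e)" by auto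
        then have "q n x = pd i Z (x + z *\<^sub>R ?e)"
          unfolding q_def by (simp add: field_simps)
        then show ?thesis using L' True by simp
      next
        case False
        have "dist (x + (1 / Suc n) *\<^sub>R ?e) x \<le> 1"
          using pos by (simp add: dist_norm)
        then have "x + (1 / Suc n) *\<^sub>R ?e \<notin> cball x0 R"
          using False dist_triangle[of x0 x "x + (1 / Suc n) *\<^sub>R ?e"] by (auto simp: dist_commute)
        moreover have "x \<notin> cball x0 R" using False by auto
        ultimately show ?thesis unfolding q_def using supp by simp
      qed
    qed
  qed
  ultimately have "(\<lambda>n. 0) \<longlonglongrightarrow> integral\<^sup>L lborel (pd i Z)" by simp
  then show "integral\<^sup>L lborel (pd i Z) = 0"
    by (simp add: LIMSEQ_const_iff)
qed

section \<open>The Jacobi formula\<close>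

text \<open>
  The new row is a combination of the rows of \<open>A\<close>, with coefficient vector \<open>B\<^sub>i A\<^sup>-\<^sup>1\<close>; only the
  multiple of the \<open>i\<close>-th row contributes to the determinant.
\<close>

lemma det_replace_row:
  fixes A B :: "real^'n^'n"
  assumes "det A \<noteq> 0"
  shows "det (\<chi> j k. if j = i then B $ i $ k else A $ j $ k)
    = det A * (\<Sum>k\<in>UNIV. B $ i $ k * matrix_inv A $ k $ i)"
proof -
  define c where "c = row i B v* matrix_inv A"
  have "c v* A = row i B"
    using matrix_inv_left[OF assms] by (simp add: c_def vector_matrix_mul_assoc)
  then have B: "B $ i $ k = (\<Sum>j\<in>UNIV. c $ j * A $ j $ k)" for k
    by (simp add: vec_eq_iff row_def vector_matrix_mult_def mult.commute)
  have "(\<chi> j k. if j = i then B $ i $ k else A $ j $ k)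
      = (\<chi> j. if j = i then (\<Sum>l\<in>UNIV. c $ l *s row l A) else row j A)"
    by (simp add: vec_eq_iff B row_def)
  then have "det (\<chi> j k. if j = i then B $ i $ k else A $ j $ k) = c $ i * det A"
    using cramer_lemma_transpose[of i c A] by simp
  moreover have "c $ i = (\<Sum>k\<in>UNIV. B $ i $ k * matrix_inv A $ k $ i)"
    by (simp add: c_def vector_matrix_mult_def row_def mult.commute)
  ultimately show ?thesis by simp
qed

text \<open>
  The determinant is differentiated one row at a time; \<open>det_replace_row\<close> evaluates the result.
\<close>

lemma pd_det:
  fixes G :: "real^'m \<Rightarrow> real^'n^'n"
  assumes d: "\<And>i j. (\<lambda>y. G y $ i $ j) differentiable (at x)" and "det (G x) \<noteq> 0"
  shows "pd l (\<lambda>y. det (G y)) x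
    = det (G x) * (\<Sum>i\<in>UNIV. \<Sum>k\<in>UNIV. pd l (\<lambda>y. G y $ i $ k) x * matrix_inv (G x) $ k $ i)"
proof -
  let ?D = "\<lambda>i j. frechet_derivative (\<lambda>y. G y $ i $ j) (at x)"
  have "((\<lambda>y. det (G y)) has_derivative
      (\<lambda>v. \<Sum>p\<in>{p. p permutes UNIV}. of_int (sign p) *
        (\<Sum>i\<in>UNIV. ?D i (p i) v * (\<Prod>j\<in>UNIV - {i}. G x $ j $ p j)))) (at x)"
    unfolding det_def
    by (intro has_derivative_sum has_derivative_mult_right has_derivative_prod frechet_derivativeD d)
  then have "pd l (\<lambda>y. det (G y)) x = (\<Sum>p\<in>{p. p permutes UNIV}. of_int (sign p) *
        (\<Sum>i\<in>UNIV. pd l (\<lambda>y. G y $ i $ p i) x * (\<Prod>j\<in>UNIV - {i}. G x $ j $ p j)))"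
    using has_derivative_pd unfolding pd_def by fastforce
  also have "\<dots> = (\<Sum>i\<in>UNIV. \<Sum>p\<in>{p. p permutes UNIV}. of_int (sign p) *
        (pd l (\<lambda>y. G y $ i $ p i) x * (\<Prod>j\<in>UNIV - {i}. G x $ j $ p j)))"
    by (subst sum.swap) (simp add: sum_distrib_left)
  also have "\<dots> = (\<Sum>i\<in>UNIV. det (\<chi> j k. if j = i then (\<chi> i k. pd l (\<lambda>y. G y $ i $ k) x) $ i $ k
      else G x $ j $ k))"
  proof (rule sum.cong[OF refl])
    fix i :: 'n
    show "(\<Sum>p\<in>{p. p permutes UNIV}. of_int (sign p) *
        (pd l (\<lambda>y. G y $ i $ p i) x * (\<Prod>j\<in>UNIV - {i}. G x $ j $ p j)))
      = det (\<chi> j k. if j = i then (\<chi> i k. pd l (\<lambda>y. G y $ i $ k) x) $ i $ k else G x $ j $ k)"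
      unfolding det_def
      by (intro sum.cong refl) (simp add: prod.remove[of UNIV i])
  qed
  also have "\<dots> = (\<Sum>i\<in>UNIV. det (G x) * (\<Sum>k\<in>UNIV. pd l (\<lambda>y. G y $ i $ k) x * matrix_inv (G x) $ k $ i))"
    by (subst det_replace_row[OF assms(2)]) simp
  finally show ?thesis by (simp add: sum_distrib_left)
qed

text \<open>
  The determinant has no zero on the segment from the identity to \<open>A\<close>, which consists of positive
  definite matrices.
\<close>

lemma posdef_matrix:
  fixes A :: "real^'n^'n"
  assumes "\<And>v. v \<noteq> 0 \<Longrightarrow> v \<bullet> (A *v v) > 0"
  shows "det A > 0"
proof (rule ccontr)
  assume neg: "\<not> det A > 0"
  have nz: "det (t *\<^sub>R A + (1 - t) *\<^sub>R mat 1) \<noteq> 0" if "0 \<le> t" "t \<le> 1" for t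
  proof
    assume "det (t *\<^sub>R A + (1 - t) *\<^sub>R mat 1) = 0"
    then obtain v where v: "v \<noteq> 0" "(t *\<^sub>R A + (1 - t) *\<^sub>R mat 1) *v v = 0"
      using invertible_det_nz[of "t *\<^sub>R A + (1 - t) *\<^sub>R mat 1"]
      by (auto simp: invertible_left_inverse matrix_left_invertible_ker)
    have "(t *\<^sub>R A + (1 - t) *\<^sub>R mat 1) *v v = t *\<^sub>R (A *v v) + (1 - t) *\<^sub>R v"
      by (simp add: matrix_vector_mult_add_rdistrib scaleR_matrix_vector_assoc[symmetric])
    then have "t * (v \<bullet> (A *v v)) + (1 - t) * (v \<bullet> v) = 0"
      using v(2) by (metis inner_add_right inner_scaleR_right inner_zero_right)
    moreover have "v \<bullet> (A *v v) > 0" "v \<bullet> v > 0" using v(1) assms by auto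
    ultimately show False using that
      by (metis add_nonneg_eq_0_iff diff_ge_0_iff_ge diff_zero less_numeral_extra(3) less_eq_real_def
          mult_eq_0_iff mult_nonneg_nonneg order_less_irrefl zero_neq_one)
  qed
  have "continuous_on {0..1} (\<lambda>t. det (t *\<^sub>R A + (1 - t) *\<^sub>R mat 1))"
    unfolding det_def by (intro continuous_intros)
  moreover have "det (1 *\<^sub>R A + (1 - 1) *\<^sub>R mat 1) \<le> 0" using neg by simp
  moreover have "0 \<le> det (0 *\<^sub>R A + (1 - 0) *\<^sub>R mat 1)" by simp
  ultimately obtain t where "0 \<le> t" "t \<le> 1" "det (t *\<^sub>R A + (1 - t) *\<^sub>R mat 1) = 0"
    using IVT2'[of "\<lambda>t. det (t *\<^sub>R A + (1 - t) *\<^sub>R mat 1)" 1 0 0] by auto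
  then show False using nz by blast
qed

section \<open>The Laplacian of a Riemannian metric in coordinates\<close>

definition hess :: "(real^'n \<Rightarrow> real^'n^'n::finite) \<Rightarrow> (real^'n \<Rightarrow> 'b::real_normed_vector) \<Rightarrow>
    real^'n \<Rightarrow> 'n \<Rightarrow> 'n \<Rightarrow> 'b" where
  "hess G u x i j = pd i (pd j u) x - (\<Sum>k\<in>UNIV. christoffel G x k i j *\<^sub>R pd k u x)"

definition lap :: "(real^'n \<Rightarrow> real^'n^'n::finite) \<Rightarrow> (real^'n \<Rightarrow> 'b::real_normed_vector) \<Rightarrow>
    real^'n \<Rightarrow> 'b" where
  "lap G u x = (\<Sum>i\<in>UNIV. \<Sum>j\<in>UNIV. matrix_inv (G x) $ i $ j *\<^sub>R hess G u x i j)"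

locale local_metric =
  fixes U :: "(real^'n) set" and G :: "real^'n \<Rightarrow> real^'n^'n::finite"
  assumes open_U: "open U" and smooth_G: "smooth_on U G"
    and transpose_G: "\<And>x. x \<in> U \<Longrightarrow> transpose (G x) = G x"
    and posdef_G: "\<And>x v. x \<in> U \<Longrightarrow> v \<noteq> 0 \<Longrightarrow> v \<bullet> (G x *v v) > 0"
begin

abbreviation gi :: "real^'n \<Rightarrow> 'n \<Rightarrow> 'n \<Rightarrow> real" where
  "gi x i j \<equiv> matrix_inv (G x) $ i $ j"

definition dens :: "real^'n \<Rightarrow> real" where
  "dens x = sqrt (det (G x))"

lemma det_G_pos: "x \<in> U \<Longrightarrow> det (G x) > 0"
  using posdef_matrix posdef_G by blast

lemma det_G_nz: "x \<in> U \<Longrightarrow> det (G x) \<noteq> 0"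
  using det_G_pos by force

lemma dens_pos: "x \<in> U \<Longrightarrow> dens x > 0"
  by (simp add: dens_def det_G_pos)

lemma G_sym: "x \<in> U \<Longrightarrow> G x $ i $ j = G x $ j $ i"
  using arg_cong[OF transpose_G[of x], of "\<lambda>M. M $ j $ i"] by (simp add: transpose_def)

lemma G_diag_pos: "x \<in> U \<Longrightarrow> G x $ i $ i > 0"
  using posdef_G[of x "axis i 1"]
  by (simp add: inner_axis' matrix_vector_mul_component inner_axis)

lemma gi_G: "x \<in> U \<Longrightarrow> (\<Sum>k\<in>UNIV. gi x i k * G x $ k $ j) = (if i = j then 1 else 0)"
  using matrix_inv_left[OF det_G_nz]
  by (auto simp: vec_eq_iff matrix_matrix_mult_def mat_def)

lemma G_gi: "x \<in> U \<Longrightarrow> (\<Sum>k\<in>UNIV. G x $ i $ k * gi x k j) = (if i = j then 1 else 0)"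
  using matrix_inv_right[OF det_G_nz]
  by (auto simp: vec_eq_iff matrix_matrix_mult_def mat_def)

lemma gi_sym:
  assumes "x \<in> U" shows "gi x i j = gi x j i"
proof -
  have "transpose (matrix_inv (G x)) ** G x = mat 1"
    using matrix_inv_right[OF det_G_nz[OF assms]]
    by (metis transpose_G[OF assms] matrix_transpose_mul transpose_mat)
  then have "transpose (matrix_inv (G x)) = matrix_inv (G x)"
    by (metis assms det_G_nz matrix_inv_right matrix_mul_assoc matrix_mul_lid matrix_mul_rid)
  from arg_cong[OF this, of "\<lambda>M. M $ j $ i"] show ?thesis by (simp add: transpose_def)
qed

lemma smooth_G_entry: "smooth_on U (\<lambda>y. G y $ i $ j)"
  by (intro smooth_on_vec_nth open_U smooth_G)

lemma smooth_gi: "smooth_on U (\<lambda>y. gi y i j)"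
  by (rule smooth_on_matrix_inv[OF open_U smooth_G det_G_nz])

lemma smooth_dens: "smooth_on U dens"
  unfolding dens_def[abs_def]
  by (intro smooth_on_sqrt smooth_on_det open_U smooth_G_entry det_G_pos)

lemma smooth_christoffel: "smooth_on U (\<lambda>y. christoffel G y k i j)"
  unfolding christoffel_def
  by (intro smooth_on_divide smooth_on_sum smooth_on_mult smooth_on_add smooth_on_diff smooth_on_const
      smooth_gi smooth_on_pd smooth_G_entry open_U) auto

lemma smooth_hess: "smooth_on U u \<Longrightarrow> smooth_on U (\<lambda>y. hess G u y i j)"
  unfolding hess_def
  by (intro smooth_on_diff smooth_on_sum smooth_on_scaleR smooth_christoffel smooth_on_pd open_U)

lemma smooth_lap: "smooth_on U u \<Longrightarrow> smooth_on U (lap G u)"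
  unfolding lap_def[abs_def]
  by (intro smooth_on_sum smooth_on_scaleR smooth_hess smooth_gi open_U)

lemmas diff_gi = smooth_on_imp_differentiable[OF smooth_gi]
  and diff_G = smooth_on_imp_differentiable[OF smooth_G_entry]
  and diff_dens = smooth_on_imp_differentiable[OF smooth_dens]

lemma pd_G_sym: "x \<in> U \<Longrightarrow> pd l (\<lambda>y. G y $ i $ j) x = pd l (\<lambda>y. G y $ j $ i) x"
  by (rule pd_cong[OF open_U]) (auto intro: G_sym)

lemma pd_gi:
  assumes x: "x \<in> U"
  shows "pd l (\<lambda>y. gi y i j) x
    = - (\<Sum>p\<in>UNIV. \<Sum>q\<in>UNIV. gi x i p * pd l (\<lambda>y. G y $ p $ q) x * gi x q j)"
proof -
  have *: "(\<Sum>p\<in>UNIV. pd l (\<lambda>y. gi y i p) x * G x $ p $ q)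
      = - (\<Sum>p\<in>UNIV. gi x i p * pd l (\<lambda>y. G y $ p $ q) x)" for q
  proof -
    have "pd l (\<lambda>y. \<Sum>p\<in>UNIV. gi y i p * G y $ p $ q) x = pd l (\<lambda>y. if i = q then 1 else 0) x"
      by (rule pd_cong[OF open_U x gi_G])
    then have "(\<Sum>p\<in>UNIV. pd l (\<lambda>y. gi y i p) x * G x $ p $ q + gi x i p * pd l (\<lambda>y. G y $ p $ q) x) = 0"
      using x by (simp add: pd_sum pd_mult diff_gi diff_G differentiable_mult)
    then show ?thesis by (simp add: sum.distrib add_eq_0_iff2)
  qed
  have "(\<Sum>q\<in>UNIV. (\<Sum>p\<in>UNIV. pd l (\<lambda>y. gi y i p) x * G x $ p $ q) * gi x q j)
     = (\<Sum>p\<in>UNIV. pd l (\<lambda>y. gi y i p) x * (\<Sum>q\<in>UNIV. G x $ p $ q * gi x q j))"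
    by (simp add: sum_distrib_left sum_distrib_right mult.assoc) (rule sum.swap)
  also have "\<dots> = pd l (\<lambda>y. gi y i j) x"
    by (simp add: G_gi[OF x] if_distrib cong: if_cong)
  finally have "pd l (\<lambda>y. gi y i j) x = (\<Sum>q\<in>UNIV. - (\<Sum>p\<in>UNIV. gi x i p * pd l (\<lambda>y. G y $ p $ q) x) * gi x q j)"
    by (simp add: *)
  also have "\<dots> = - (\<Sum>q\<in>UNIV. \<Sum>p\<in>UNIV. gi x i p * pd l (\<lambda>y. G y $ p $ q) x * gi x q j)"
    by (simp add: sum_negf sum_distrib_right)
  also have "\<dots> = - (\<Sum>p\<in>UNIV. \<Sum>q\<in>UNIV. gi x i p * pd l (\<lambda>y. G y $ p $ q) x * gi x q j)"
    by (subst sum.swap) simp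
  finally show ?thesis .
qed

lemma pd_dens:
  assumes x: "x \<in> U"
  shows "pd l dens x = dens x / 2 * (\<Sum>p\<in>UNIV. \<Sum>q\<in>UNIV. pd l (\<lambda>y. G y $ p $ q) x * gi x q p)"
proof -
  have dd: "(\<lambda>y. det (G y)) differentiable (at x)"
    using smooth_on_imp_differentiable[OF smooth_on_det[OF open_U smooth_G_entry] x] .
  have "pd l (\<lambda>y. (dens y)\<^sup>2) x = pd l (\<lambda>y. det (G y)) x"
    by (rule pd_cong[OF open_U x]) (simp add: dens_def less_imp_le[OF det_G_pos])
  then have "2 * dens x * pd l dens x
      = (dens x)\<^sup>2 * (\<Sum>p\<in>UNIV. \<Sum>q\<in>UNIV. pd l (\<lambda>y. G y $ p $ q) x * gi x q p)"
    using pd_det[of G x l, OF diff_G[OF x] det_G_nz[OF x]] pd_square[OF diff_dens[OF x], of l]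
    by (simp add: dens_def less_imp_le[OF det_G_pos[OF x]])
  then show ?thesis using dens_pos[OF x] by (simp add: power2_eq_square field_simps)
qed

text \<open>
  This identity says that the Laplacian is a divergence with respect to the Riemannian density. It
  combines the Jacobi formula for the density with the derivative of the inverse matrix.
\<close>

lemma divergence_inverse_metric:
  assumes x: "x \<in> U"
  shows "(\<Sum>i\<in>UNIV. pd i (\<lambda>y. dens y * gi y i j) x)
    = - dens x * (\<Sum>k\<in>UNIV. \<Sum>l\<in>UNIV. gi x k l * christoffel G x j k l)"
proof -
  define a where "a = gi x"
  define d where "d l p q = pd l (\<lambda>y. G y $ p $ q) x" for l p q
  define S where "S = (\<Sum>k\<in>UNIV. \<Sum>l\<in>UNIV. \<Sum>m\<in>UNIV. a k l * d k l m * a m j)"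
  define T where "T = (\<Sum>m\<in>UNIV. \<Sum>k\<in>UNIV. \<Sum>l\<in>UNIV. a m j * d m k l * a l k)"
  have ga: "gi x p q = a p q" for p q by (simp add: a_def)
  have as: "a p q = a q p" for p q unfolding a_def by (rule gi_sym[OF x])
  have ds: "d l p q = d l q p" for l p q unfolding d_def by (rule pd_G_sym[OF x])
  have "pd i (\<lambda>y. dens y * gi y i j) x
      = dens x * ((\<Sum>k\<in>UNIV. \<Sum>l\<in>UNIV. a i j * d i k l * a l k) / 2
          - (\<Sum>l\<in>UNIV. \<Sum>m\<in>UNIV. a i l * d i l m * a m j))" for i
    using pd_mult[OF diff_dens[OF x] diff_gi[OF x], of i i j] pd_dens[OF x, of i] pd_gi[OF x, of i i j]
    by (simp add: a_def d_def sum_distrib_left sum_distrib_right algebra_simps)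
  then have L: "(\<Sum>i\<in>UNIV. pd i (\<lambda>y. dens y * gi y i j) x) = dens x * (T / 2 - S)"
    by (simp add: S_def T_def sum_distrib_left[symmetric] sum_subtractf sum_divide_distrib[symmetric])
  have "(\<Sum>k\<in>UNIV. \<Sum>l\<in>UNIV. gi x k l * christoffel G x j k l)
      = (\<Sum>k\<in>UNIV. \<Sum>l\<in>UNIV. \<Sum>m\<in>UNIV. a k l * d k l m * a m j + a k l * d l k m * a m j
          - a m j * d m k l * a l k) / 2"
    unfolding christoffel_def ga d_def[symmetric] sum_divide_distrib sum_distrib_left
  proof (intro sum.cong refl)
    fix k l m :: 'n
    show "a k l * (a j m * (d k l m + d l k m - d m k l) / 2)
        = (a k l * d k l m * a m j + a k l * d l k m * a m j - a m j * d m k l * a l k) / 2"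
      unfolding as[of j m] as[of l k] by (simp add: algebra_simps)
  qed
  also have "(\<Sum>k\<in>UNIV. \<Sum>l\<in>UNIV. \<Sum>m\<in>UNIV. a k l * d k l m * a m j + a k l * d l k m * a m j
          - a m j * d m k l * a l k)
      = S + (\<Sum>k\<in>UNIV. \<Sum>l\<in>UNIV. \<Sum>m\<in>UNIV. a k l * d l k m * a m j)
        - (\<Sum>k\<in>UNIV. \<Sum>l\<in>UNIV. \<Sum>m\<in>UNIV. a m j * d m k l * a l k)"
    by (simp add: S_def sum.distrib sum_subtractf)
  also have "(\<Sum>k\<in>UNIV. \<Sum>l\<in>UNIV. \<Sum>m\<in>UNIV. a k l * d l k m * a m j) = S"
    unfolding S_def by (subst sum.swap) (simp add: as)
  also have "(\<Sum>k\<in>UNIV. \<Sum>l\<in>UNIV. \<Sum>m\<in>UNIV. a m j * d m k l * a l k)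
      = (\<Sum>k\<in>UNIV. \<Sum>m\<in>UNIV. \<Sum>l\<in>UNIV. a m j * d m k l * a l k)"
    by (rule sum.cong[OF refl], rule sum.swap)
  also have "\<dots> = T"
    unfolding T_def by (rule sum.swap)
  finally have R: "(\<Sum>k\<in>UNIV. \<Sum>l\<in>UNIV. gi x k l * christoffel G x j k l) = (S + S - T) / 2" .
  show ?thesis unfolding L R by (simp add: field_simps)
qed

lemma lap_expand:
  fixes u :: "real^'n \<Rightarrow> real"
  shows "lap G u x = (\<Sum>i\<in>UNIV. \<Sum>j\<in>UNIV. gi x i j * pd i (pd j u) x)
    - (\<Sum>k\<in>UNIV. (\<Sum>i\<in>UNIV. \<Sum>j\<in>UNIV. gi x i j * christoffel G x k i j) * pd k u x)"
proof -
  have "(\<Sum>k\<in>UNIV. (\<Sum>i\<in>UNIV. \<Sum>j\<in>UNIV. gi x i j * christoffel G x k i j) * pd k u x)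
      = (\<Sum>i\<in>UNIV. \<Sum>k\<in>UNIV. \<Sum>j\<in>UNIV. gi x i j * christoffel G x k i j * pd k u x)"
    by (simp add: sum_distrib_right) (rule sum.swap)
  also have "\<dots> = (\<Sum>i\<in>UNIV. \<Sum>j\<in>UNIV. \<Sum>k\<in>UNIV. gi x i j * christoffel G x k i j * pd k u x)"
    by (rule sum.cong[OF refl], rule sum.swap)
  finally show ?thesis
    by (simp add: lap_def hess_def algebra_simps sum_subtractf sum_distrib_left)
qed

text \<open>
  By \<open>divergence_inverse_metric\<close>, \<open>b \<Delta>\<phi> - \<phi> \<Delta>b\<close> is the divergence of \<open>b \<nabla>\<phi> - \<phi> \<nabla>b\<close>: the terms
  with first derivatives only cancel by symmetry of the inverse metric.
\<close>

lemma green_pointwise: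
  fixes b \<phi> :: "real^'n \<Rightarrow> real"
  assumes x: "x \<in> U" and b: "smooth_on U b" and \<phi>: "smooth_on U \<phi>"
  shows "(\<Sum>i\<in>UNIV. pd i (\<lambda>y. \<Sum>j\<in>UNIV. dens y * gi y i j * (b y * pd j \<phi> y - \<phi> y * pd j b y)) x)
    = dens x * (b x * lap G \<phi> x - \<phi> x * lap G b x)"
proof -
  note d = smooth_on_imp_differentiable[OF b x] smooth_on_imp_differentiable[OF \<phi> x]
    smooth_on_imp_differentiable[OF smooth_on_pd[OF b] x]
    smooth_on_imp_differentiable[OF smooth_on_pd[OF \<phi>] x]
  define V where "V j = b x * pd j \<phi> x - \<phi> x * pd j b x" for j
  define C where "C j = (\<Sum>k\<in>UNIV. \<Sum>l\<in>UNIV. gi x k l * christoffel G x j k l)" for j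
  have V: "pd i (\<lambda>y. b y * pd j \<phi> y - \<phi> y * pd j b y) x
      = pd i b x * pd j \<phi> x - pd i \<phi> x * pd j b x + (b x * pd i (pd j \<phi>) x - \<phi> x * pd i (pd j b) x)" for i j
    using d by (simp add: pd_diff pd_mult differentiable_mult)
  have "pd i (\<lambda>y. \<Sum>j\<in>UNIV. dens y * gi y i j * (b y * pd j \<phi> y - \<phi> y * pd j b y)) x
      = (\<Sum>j\<in>UNIV. pd i (\<lambda>y. dens y * gi y i j) x * V j + dens x * (gi x i j *
          (pd i b x * pd j \<phi> x - pd i \<phi> x * pd j b x))
          + dens x * (gi x i j * (b x * pd i (pd j \<phi>) x - \<phi> x * pd i (pd j b) x)))" for i
  proof -
    have dd: "(\<lambda>y. dens y * gi y i j) differentiable (at x)"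
      "(\<lambda>y. b y * pd j \<phi> y - \<phi> y * pd j b y) differentiable (at x)" for j
      using d diff_gi[OF x] diff_dens[OF x] by (simp_all add: differentiable_mult differentiable_diff)
    show ?thesis
      unfolding pd_sum[OF differentiable_mult[OF dd]] pd_mult[OF dd] V V_def
      by (intro sum.cong refl) (simp add: algebra_simps)
  qed
  then have "(\<Sum>i\<in>UNIV. pd i (\<lambda>y. \<Sum>j\<in>UNIV. dens y * gi y i j * (b y * pd j \<phi> y - \<phi> y * pd j b y)) x)
     = (\<Sum>i\<in>UNIV. \<Sum>j\<in>UNIV. pd i (\<lambda>y. dens y * gi y i j) x * V j)
      + dens x * (\<Sum>i\<in>UNIV. \<Sum>j\<in>UNIV. gi x i j * (pd i b x * pd j \<phi> x - pd i \<phi> x * pd j b x))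
      + dens x * (\<Sum>i\<in>UNIV. \<Sum>j\<in>UNIV. gi x i j * (b x * pd i (pd j \<phi>) x - \<phi> x * pd i (pd j b) x))"
    by (simp add: sum.distrib sum_distrib_left)
  also have "(\<Sum>i\<in>UNIV. \<Sum>j\<in>UNIV. pd i (\<lambda>y. dens y * gi y i j) x * V j)
      = (\<Sum>j\<in>UNIV. (\<Sum>i\<in>UNIV. pd i (\<lambda>y. dens y * gi y i j) x) * V j)"
    by (subst sum.swap) (simp add: sum_distrib_right)
  also have "\<dots> = - dens x * (\<Sum>j\<in>UNIV. (\<Sum>k\<in>UNIV. \<Sum>l\<in>UNIV. gi x k l * christoffel G x j k l) * V j)"
    by (simp only: divergence_inverse_metric[OF x] mult.assoc sum_distrib_left[symmetric])
  also have "(\<Sum>i\<in>UNIV. \<Sum>j\<in>UNIV. gi x i j * (pd i b x * pd j \<phi> x - pd i \<phi> x * pd j b x)) = 0"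
  proof -
    have "(\<Sum>i\<in>UNIV. \<Sum>j\<in>UNIV. gi x i j * (pd i \<phi> x * pd j b x))
        = (\<Sum>i\<in>UNIV. \<Sum>j\<in>UNIV. gi x i j * (pd i b x * pd j \<phi> x))"
      by (subst sum.swap) (simp add: gi_sym[OF x] mult.commute)
    then show ?thesis by (simp add: right_diff_distrib sum_subtractf)
  qed
  finally have L: "(\<Sum>i\<in>UNIV. pd i (\<lambda>y. \<Sum>j\<in>UNIV. dens y * gi y i j * (b y * pd j \<phi> y - \<phi> y * pd j b y)) x)
      = - dens x * (\<Sum>j\<in>UNIV. C j * V j)
        + dens x * (\<Sum>i\<in>UNIV. \<Sum>j\<in>UNIV. gi x i j * (b x * pd i (pd j \<phi>) x - \<phi> x * pd i (pd j b) x))"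
    by (simp add: C_def)
  have "(\<Sum>j\<in>UNIV. C j * V j) = b x * (\<Sum>j\<in>UNIV. C j * pd j \<phi> x) - \<phi> x * (\<Sum>j\<in>UNIV. C j * pd j b x)"
    by (simp add: V_def right_diff_distrib sum_subtractf sum_distrib_left mult_ac)
  moreover have "(\<Sum>i\<in>UNIV. \<Sum>j\<in>UNIV. gi x i j * (b x * pd i (pd j \<phi>) x - \<phi> x * pd i (pd j b) x))
      = b x * (\<Sum>i\<in>UNIV. \<Sum>j\<in>UNIV. gi x i j * pd i (pd j \<phi>) x)
        - \<phi> x * (\<Sum>i\<in>UNIV. \<Sum>j\<in>UNIV. gi x i j * pd i (pd j b) x)"
    by (simp add: right_diff_distrib sum_subtractf sum_distrib_left mult_ac)
  ultimately show ?thesis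
    unfolding L lap_expand C_def[symmetric] by (simp only:) (simp add: algebra_simps)
qed

lemma green_identity:
  fixes b \<phi> :: "real^'n \<Rightarrow> real"
  assumes b: "smooth_on U b" and \<phi>: "smooth_on U \<phi>"
    and K: "cball x0 r \<subseteq> U" "\<And>x. x \<notin> cball x0 r \<Longrightarrow> \<phi> x = 0"
  shows "(LINT x:cball x0 r|lborel. dens x * (b x * lap G \<phi> x))
    = (LINT x:cball x0 r|lborel. dens x * (\<phi> x * lap G b x))"
proof -
  define Z where "Z i x = (if x \<in> cball x0 r then
     (\<Sum>j\<in>UNIV. dens x * gi x i j * (b x * pd j \<phi> x - \<phi> x * pd j b x)) else 0)" for i x
  have pd0: "pd j \<phi> x = 0" if "x \<notin> cball x0 r" for j x
    using pd_cong[of "- cball x0 r" x \<phi> "\<lambda>_. 0" j] K(2) that by auto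
  have Z: "Z i x = (\<Sum>j\<in>UNIV. dens x * gi x i j * (b x * pd j \<phi> x - \<phi> x * pd j b x))" for i x
    using pd0[of x] K(2)[of x] by (cases "x \<in> cball x0 r") (auto simp: Z_def)
  have smU: "smooth_on U (\<lambda>x. \<Sum>j\<in>UNIV. dens x * gi x i j * (b x * pd j \<phi> x - \<phi> x * pd j b x))" for i
    by (intro smooth_on_sum smooth_on_mult smooth_on_diff smooth_dens smooth_gi smooth_on_pd b \<phi> open_U)
  have sm: "smooth_on UNIV (Z i)" for i
  proof (rule smooth_on_local[OF open_UNIV])
    fix x :: "real^'n"
    show "\<exists>V. open V \<and> x \<in> V \<and> smooth_on (UNIV \<inter> V) (Z i)"
    proof (cases "x \<in> U")
      case True
      then show ?thesis using smU[of i] open_U by (auto simp: Z[abs_def])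
    next
      case False
      have "smooth_on (- cball x0 r) (Z i)"
        by (subst smooth_on_cong[where k = "\<lambda>_. 0"]) (auto simp: Z_def smooth_on_const)
      then show ?thesis using False K(1) by (intro exI[of _ "- cball x0 r"]) auto
    qed
  qed
  have pZ: "pd i (Z i) x = pd i (\<lambda>y. \<Sum>j\<in>UNIV. dens y * gi y i j * (b y * pd j \<phi> y - \<phi> y * pd j b y)) x" for i x
    by (simp add: Z[abs_def])
  have div: "(\<Sum>i\<in>UNIV. pd i (Z i) x)
      = indicator (cball x0 r) x * (dens x * (b x * lap G \<phi> x) - dens x * (\<phi> x * lap G b x))" for x
  proof (cases "x \<in> cball x0 r")
    case True
    then show ?thesis using green_pointwise[OF _ b \<phi>, of x] K(1)
      by (auto simp: pZ right_diff_distrib)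
  next
    case False
    then have "pd i (Z i) x = 0" for i
      using pd_cong[of "- cball x0 r" x "Z i" "\<lambda>_. 0" i] by (auto simp: Z_def)
    with False show ?thesis by simp
  qed
  have int: "set_integrable lborel (cball x0 r) f" if "smooth_on U f" for f :: "real^'n \<Rightarrow> real"
    unfolding set_integrable_def
    using continuous_on_subset[OF smooth_on_imp_continuous_on[OF that] K(1)]
    by (rule borel_integrable_compact[OF compact_cball])
  have i1: "set_integrable lborel (cball x0 r) (\<lambda>x. dens x * (b x * lap G \<phi> x))"
    and i2: "set_integrable lborel (cball x0 r) (\<lambda>x. dens x * (\<phi> x * lap G b x))"
    by (intro int smooth_on_mult smooth_dens smooth_lap b \<phi> open_U)+
  have "(\<integral>x. (\<Sum>i\<in>UNIV. pd i (Z i) x) \<partial>lborel) = (\<Sum>i\<in>UNIV. \<integral>x. pd i (Z i) x \<partial>lborel)"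
    by (rule Bochner_Integration.integral_sum)
      (rule integral_pd_eq_0(1)[OF sm, of x0 r], simp add: Z_def)
  also have "\<dots> = 0"
    by (intro sum.neutral ballI integral_pd_eq_0(2)[OF sm, of x0 r]) (simp add: Z_def)
  finally have "(LINT x:cball x0 r|lborel. dens x * (b x * lap G \<phi> x) - dens x * (\<phi> x * lap G b x)) = 0"
    by (simp add: div set_lebesgue_integral_def)
  then show ?thesis using set_integral_diff(2)[OF i1 i2] by simp
qed

end

lemma set_integral_pos_on_ball:
  fixes h :: "'a::euclidean_space \<Rightarrow> real"
  assumes "r > 0" "continuous_on (cball x0 r) h" "\<And>x. x \<in> cball x0 r \<Longrightarrow> h x \<ge> 0"
    and "\<And>x. x \<in> ball x0 r \<Longrightarrow> h x > 0"
  shows "(LINT x:cball x0 r|lborel. h x) \<noteq> 0"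
proof
  assume 0: "(LINT x:cball x0 r|lborel. h x) = 0"
  have int: "integrable lborel (\<lambda>x. indicator (cball x0 r) x *\<^sub>R h x)"
    by (rule borel_integrable_compact[OF compact_cball assms(2)])
  have "AE x in lborel. indicator (cball x0 r) x *\<^sub>R h x = 0"
    using 0 assms(3) by (subst integral_nonneg_eq_0_iff_AE[OF int, symmetric])
      (auto simp: set_lebesgue_integral_def indicator_def)
  then have "AE x in lborel. x \<notin> ball x0 r"
  proof (rule AE_mp, intro AE_I2 impI)
    fix x assume 1: "indicator (cball x0 r) x *\<^sub>R h x = 0"
    show "x \<notin> ball x0 r"
      using 1 assms(4)[of x] by (auto simp: indicator_def split: if_splits)
  qed
  then have "ball x0 r \<in> null_sets lborel"
    by (subst AE_iff_null_sets) auto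
  then have "negligible (ball x0 r)"
    by (simp add: negligible_iff_null_sets null_sets_completionI)
  then show False using open_not_negligible[of "ball x0 r"] assms(1) by auto
qed

context local_metric
begin

text \<open>
  Green's identity moves the Laplacian to \<open>b\<close>. If \<open>\<Delta>b\<close> had a sign near \<open>x0\<close>, a bump function
  supported there would give a nonzero integral.
\<close>

lemma weakly_harmonic_imp_harmonic:
  fixes b :: "real^'n \<Rightarrow> real"
  assumes b: "smooth_on U b" and x: "x0 \<in> U"
    and weak: "\<And>r \<phi>. r > 0 \<Longrightarrow> cball x0 r \<subseteq> U \<Longrightarrow> smooth_on UNIV \<phi> \<Longrightarrow>
      (\<And>x. x \<notin> cball x0 r \<Longrightarrow> \<phi> x = 0) \<Longrightarrow>
      (LINT x:cball x0 r|lborel. dens x * (b x * lap G \<phi> x)) = 0"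
  shows "lap G b x0 = 0"
proof (rule ccontr)
  assume nz: "lap G b x0 \<noteq> 0"
  \<comment> \<open>multiplying by the sign treats both signs at once\<close>
  define s where "s = sgn (lap G b x0)"
  have cl: "continuous_on U (\<lambda>x. s * lap G b x)"
    by (intro continuous_intros smooth_on_imp_continuous_on[OF smooth_lap[OF b]])
  have "open ((\<lambda>x. s * lap G b x) -` {0<..} \<inter> U)"
    by (rule continuous_on_open_vimage[THEN iffD1, rule_format, OF open_U cl]) simp
  moreover have "x0 \<in> (\<lambda>x. s * lap G b x) -` {0<..} \<inter> U"
    using x nz by (simp add: s_def sgn_if)
  ultimately obtain r where r: "r > 0" "cball x0 r \<subseteq> (\<lambda>x. s * lap G b x) -` {0<..} \<inter> U"
    by (meson open_contains_cball)
  then have rU: "cball x0 r \<subseteq> U" by auto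
  have sm: "smooth_on U (bump x0 r)" by (rule smooth_on_subset[OF smooth_bump]) simp
  have out: "bump x0 r x = 0" if "x \<notin> cball x0 r" for x
    using bump_eq_0[OF r(1), of x x0] that ball_subset_cball by blast
  have "(LINT x:cball x0 r|lborel. dens x * (bump x0 r x * lap G b x)) = 0"
    using green_identity[OF b sm rU out] weak[OF r(1) rU smooth_bump out] by simp
  then have "(LINT x:cball x0 r|lborel. s * (dens x * (bump x0 r x * lap G b x))) = 0"
    by simp
  moreover have "(LINT x:cball x0 r|lborel. s * (dens x * (bump x0 r x * lap G b x))) \<noteq> 0"
  proof (rule set_integral_pos_on_ball[OF r(1)])
    show "continuous_on (cball x0 r) (\<lambda>x. s * (dens x * (bump x0 r x * lap G b x)))"
      by (intro continuous_on_subset[OF _ rU] smooth_on_imp_continuous_on smooth_on_mult smooth_on_const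
          smooth_dens sm smooth_lap b open_U)
    have eq: "s * (dens x * (bump x0 r x * lap G b x)) = dens x * bump x0 r x * (s * lap G b x)" for x
      by simp
    show "0 \<le> s * (dens x * (bump x0 r x * lap G b x))" if "x \<in> cball x0 r" for x
    proof -
      have "0 < s * lap G b x" "0 < dens x" using that r rU dens_pos[of x] by auto
      then show ?thesis
        unfolding eq using mult_nonneg_nonneg[of "dens x * bump x0 r x" "s * lap G b x"]
          bump_nonneg[of x0 r x] by simp
    qed
    show "0 < s * (dens x * (bump x0 r x * lap G b x))" if "x \<in> ball x0 r" for x
    proof -
      have "0 < s * lap G b x" "0 < dens x"
        using that r(2) rU dens_pos[of x] ball_subset_cball[of x0 r] by blast+
      then show ?thesis
        unfolding eq using mult_pos_pos[of "dens x * bump x0 r x" "s * lap G b x"]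
          bump_pos_iff[OF r(1), of x0 x] that by simp
    qed
  qed
  ultimately show False by simp
qed

end

section \<open>Riemannian manifolds\<close>

locale riemannian_manifold =
  fixes \<A> :: "('a::{t2_space, second_countable_topology}, 'n::finite) chart set"
    and g :: "('a, 'n) metric" and vol :: "'a measure"
  assumes atlas: "smooth_atlas \<A>"
    and metric: "riemannian_metric \<A> g"
    and volume: "riemannian_volume \<A> g vol"
begin

lemma open_dom: "\<kappa> \<in> \<A> \<Longrightarrow> open (dom \<kappa>)"
  and open_cod: "\<kappa> \<in> \<A> \<Longrightarrow> open (cod \<kappa>)"
  and homeo: "\<kappa> \<in> \<A> \<Longrightarrow> homeomorphism (dom \<kappa>) (cod \<kappa>) (coord \<kappa>) (param \<kappa>)"
  using atlas unfolding smooth_atlas_def by auto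

lemma continuous_coord: "\<kappa> \<in> \<A> \<Longrightarrow> continuous_on (dom \<kappa>) (coord \<kappa>)"
  and continuous_param: "\<kappa> \<in> \<A> \<Longrightarrow> continuous_on (cod \<kappa>) (param \<kappa>)"
  and param_coord: "\<kappa> \<in> \<A> \<Longrightarrow> p \<in> dom \<kappa> \<Longrightarrow> param \<kappa> (coord \<kappa> p) = p"
  and coord_param: "\<kappa> \<in> \<A> \<Longrightarrow> x \<in> cod \<kappa> \<Longrightarrow> coord \<kappa> (param \<kappa> x) = x"
  and coord_in_cod: "\<kappa> \<in> \<A> \<Longrightarrow> p \<in> dom \<kappa> \<Longrightarrow> coord \<kappa> p \<in> cod \<kappa>"
  and param_in_dom: "\<kappa> \<in> \<A> \<Longrightarrow> x \<in> cod \<kappa> \<Longrightarrow> param \<kappa> x \<in> dom \<kappa>"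
  using homeo unfolding homeomorphism_def by blast+

lemma chart_at: "chart_at \<A> p \<in> \<A>" "p \<in> dom (chart_at \<A> p)"
proof -
  have "\<exists>\<kappa>. \<kappa> \<in> \<A> \<and> p \<in> dom \<kappa>" using atlas unfolding smooth_atlas_def by blast
  from someI_ex[OF this] show "chart_at \<A> p \<in> \<A>" "p \<in> dom (chart_at \<A> p)"
    by (simp_all add: chart_at_def)
qed

lemma chart_metric: "\<kappa> \<in> \<A> \<Longrightarrow> local_metric (cod \<kappa>) (g \<kappa>)"
  using metric open_cod unfolding riemannian_metric_def by unfold_locales auto

lemma open_overlap:
  assumes "\<kappa> \<in> \<A>" "\<kappa>' \<in> \<A>"
  shows "open (coord \<kappa> ` (dom \<kappa> \<inter> dom \<kappa>'))"
proof -
  have "coord \<kappa> ` (dom \<kappa> \<inter> dom \<kappa>') = param \<kappa> -` (dom \<kappa> \<inter> dom \<kappa>') \<inter> cod \<kappa>"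
    using assms(1) by (force simp: coord_param param_coord coord_in_cod)
  moreover have "open (param \<kappa> -` (dom \<kappa> \<inter> dom \<kappa>') \<inter> cod \<kappa>)"
    by (rule continuous_on_open_vimage[THEN iffD1, rule_format, OF open_cod continuous_param])
      (use assms in \<open>auto intro: open_dom\<close>)
  ultimately show ?thesis by simp
qed

lemma smooth_transition:
  "\<kappa> \<in> \<A> \<Longrightarrow> \<kappa>' \<in> \<A> \<Longrightarrow> smooth_on (coord \<kappa> ` (dom \<kappa> \<inter> dom \<kappa>')) (coord \<kappa>' \<circ> param \<kappa>)"
  using atlas unfolding smooth_atlas_def by blast

text \<open>
  On the compact set, the volume measure is the image under the parametrisation of the measure with
  density \<open>sqrt (det g)\<close>.
\<close>

lemma set_integral_in_chart:
  fixes F :: "'a \<Rightarrow> real"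
  assumes \<kappa>: "\<kappa> \<in> \<A>" and C: "compact C" "C \<subseteq> cod \<kappa>"
    and F: "continuous_on C (\<lambda>x. F (param \<kappa> x))"
  shows "(LINT p:param \<kappa> ` C|vol. F p)
    = (LINT x:C|lborel. local_metric.dens (g \<kappa>) x * F (param \<kappa> x))"
proof -
  interpret local_metric "cod \<kappa>" "g \<kappa>" by (rule chart_metric[OF \<kappa>])
  define K where "K = param \<kappa> ` C"
  have cC: "coord \<kappa> (param \<kappa> x) = x" "param \<kappa> x \<in> K" if "x \<in> C" for x
    using that C(2) coord_param[OF \<kappa>] by (auto simp: K_def)
  have cK: "coord \<kappa> p \<in> C" "param \<kappa> (coord \<kappa> p) = p" if "p \<in> K" for p
    using that C(2) by (auto simp: K_def coord_param[OF \<kappa>] subset_iff)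
  have Kdom: "K \<subseteq> dom \<kappa>" using C(2) param_in_dom[OF \<kappa>] by (auto simp: K_def)
  have contC: "continuous_on C (param \<kappa>)" by (rule continuous_on_subset[OF continuous_param[OF \<kappa>] C(2)])
  have "compact K" unfolding K_def by (rule compact_continuous_image[OF contC C(1)])
  then have Kb: "K \<in> sets borel" by (simp add: compact_imp_closed)
  have Cb: "C \<in> sets borel" using C(1) by (simp add: compact_imp_closed)
  have sv: "sets vol = sets borel" using volume by (simp add: riemannian_volume_def)
  have emv: "emeasure vol B = (\<integral>\<^sup>+x\<in>coord \<kappa> ` B. ennreal (dens x) \<partial>lborel)"
    if "B \<in> sets borel" "B \<subseteq> dom \<kappa>" for B
    using volume \<kappa> that by (auto simp: riemannian_volume_def dens_def)
  \<comment> \<open>The maps \<open>T\<close>, \<open>D\<close> and \<open>F'\<close> are globally measurable versions of \<open>param \<kappa>\<close>, the density and \<open>F\<close>.\<close>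
  define T where "T x = (if x \<in> C then param \<kappa> x else undefined)" for x
  define D where "D x = indicator C x *\<^sub>R dens x" for x
  define F' where "F' p = indicator K p *\<^sub>R F p" for p
  have T[measurable]: "T \<in> measurable borel borel"
    unfolding T_def[abs_def]
    by (rule borel_measurable_continuous_on_if[OF Cb contC continuous_on_const])
  have D[measurable]: "D \<in> borel_measurable borel"
    unfolding D_def[abs_def]
    by (rule borel_measurable_continuous_on_indicator[OF Cb])
      (rule continuous_on_subset[OF smooth_on_imp_continuous_on[OF smooth_dens] C(2)])
  have Dn: "D x \<ge> 0" for x
    using dens_pos[of x] C(2) by (auto simp: D_def indicator_def less_imp_le)
  have "continuous_on K (\<lambda>p. F (param \<kappa> (coord \<kappa> p)))"
    by (rule continuous_on_compose2[OF F continuous_on_subset[OF continuous_coord[OF \<kappa>] Kdom]])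
      (use cK in auto)
  then have "continuous_on K F"
    by (rule continuous_on_eq) (use cK in auto)
  then have F': "F' \<in> borel_measurable borel"
    unfolding F'_def[abs_def] by (rule borel_measurable_continuous_on_indicator[OF Kb])
  have eq: "density vol (indicator K) = distr (density lborel D) borel T"
  proof (rule measure_eqI)
    show "sets (density vol (indicator K)) = sets (distr (density lborel D) borel T)"
      using sv by simp
    fix B assume "B \<in> sets (density vol (indicator K))"
    then have B: "B \<in> sets borel" "B \<in> sets vol" using sv by auto
    have "emeasure (density vol (indicator K)) B = emeasure vol (B \<inter> K)"
      using B Kb sv by (simp add: emeasure_density Int_commute flip: indicator_inter_arith)
    also have "\<dots> = (\<integral>\<^sup>+x\<in>coord \<kappa> ` (B \<inter> K). ennreal (dens x) \<partial>lborel)"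
      using B Kb Kdom by (intro emv) auto
    also have "\<dots> = (\<integral>\<^sup>+x. ennreal (D x) * indicator (T -` B) x \<partial>lborel)"
    proof (rule nn_integral_cong)
      fix x
      have "x \<in> coord \<kappa> ` (B \<inter> K) \<longleftrightarrow> x \<in> C \<and> T x \<in> B"
        using cC[of x] cK by (force simp: T_def)
      then show "ennreal (dens x) * indicator (coord \<kappa> ` (B \<inter> K)) x = ennreal (D x) * indicator (T -` B) x"
        by (auto simp: D_def indicator_def)
    qed
    also have "\<dots> = emeasure (distr (density lborel D) borel T) B"
      using B by (subst emeasure_distr) (auto simp: emeasure_density measurable_sets_borel[OF T])
    finally show "emeasure (density vol (indicator K)) B = emeasure (distr (density lborel D) borel T) B" .
  qed
  have "(LINT p:K|vol. F p) = (\<integral>p. indicator K p *\<^sub>R F' p \<partial>vol)"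
    unfolding set_lebesgue_integral_def
    by (rule Bochner_Integration.integral_cong) (auto simp: F'_def indicator_def)
  also have "\<dots> = (\<integral>p. F' p \<partial>density vol (indicator K))"
  proof -
    have "(indicator K :: 'a \<Rightarrow> ennreal) = (\<lambda>p. ennreal (indicat_real K p))"
      by (simp add: fun_eq_iff ennreal_indicator)
    then show ?thesis
      using integral_density[of F' vol "indicator K"] F' Kb sv measurable_cong_sets[OF sv refl, of borel]
      by simp
  qed
  also have "\<dots> = (\<integral>x. F' (T x) \<partial>density lborel D)"
    unfolding eq by (rule integral_distr) (use T F' in auto)
  also have "\<dots> = (\<integral>x. D x *\<^sub>R F' (T x) \<partial>lborel)"
    by (rule integral_density) (use Dn D F' T in auto)
  also have "\<dots> = (LINT x:C|lborel. dens x * F (param \<kappa> x))"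
    unfolding set_lebesgue_integral_def
    by (rule Bochner_Integration.integral_cong) (auto simp: D_def F'_def T_def indicator_def cC)
  finally show ?thesis by (simp add: K_def)
qed

definition push :: "('a, 'n) chart \<Rightarrow> (real^'n \<Rightarrow> real) \<Rightarrow> 'a \<Rightarrow> real" where
  "push \<kappa> \<phi> p = (if p \<in> dom \<kappa> then \<phi> (coord \<kappa> p) else 0)"

lemma push_param: "\<kappa> \<in> \<A> \<Longrightarrow> x \<in> cod \<kappa> \<Longrightarrow> push \<kappa> \<phi> (param \<kappa> x) = \<phi> x"
  by (simp add: push_def param_in_dom coord_param)

lemma push_outside:
  assumes "\<kappa> \<in> \<A>" "\<And>x. x \<notin> C \<Longrightarrow> \<phi> x = 0" "p \<notin> param \<kappa> ` C"
  shows "push \<kappa> \<phi> p = 0"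
  using assms by (metis image_eqI param_coord push_def)

text \<open>
  Near a point outside the chart domain the function vanishes, because the image of the compact
  support is closed in a Hausdorff space.
\<close>

lemma smooth_push:
  assumes \<kappa>: "\<kappa> \<in> \<A>" and \<phi>: "smooth_on UNIV \<phi>" and C: "compact C" "C \<subseteq> cod \<kappa>" "\<And>x. x \<notin> C \<Longrightarrow> \<phi> x = 0"
  shows "smooth_map \<A> (push \<kappa> \<phi>)"
  unfolding smooth_map_def
proof
  fix \<kappa>' assume \<kappa>': "\<kappa>' \<in> \<A>"
  have "compact (param \<kappa> ` C)"
    by (rule compact_continuous_image[OF continuous_on_subset[OF continuous_param[OF \<kappa>] C(2)] C(1)])
  then have closed: "closed (param \<kappa> ` C)" by (rule compact_imp_closed)
  show "smooth_on (cod \<kappa>') (push \<kappa> \<phi> \<circ> param \<kappa>')"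
  proof (rule smooth_on_local[OF open_cod[OF \<kappa>']])
    fix x assume x: "x \<in> cod \<kappa>'"
    show "\<exists>V. open V \<and> x \<in> V \<and> smooth_on (cod \<kappa>' \<inter> V) (push \<kappa> \<phi> \<circ> param \<kappa>')"
    proof (cases "param \<kappa>' x \<in> dom \<kappa>")
      case True
      let ?V = "coord \<kappa>' ` (dom \<kappa>' \<inter> dom \<kappa>)"
      have V: "open ?V" by (rule open_overlap[OF \<kappa>' \<kappa>])
      have "smooth_on ?V (\<lambda>y. \<phi> ((coord \<kappa> \<circ> param \<kappa>') y))"
        by (rule smooth_on_compose[OF V _ smooth_transition[OF \<kappa>' \<kappa>] \<phi>]) simp
      then have "smooth_on ?V (push \<kappa> \<phi> \<circ> param \<kappa>')"
        by (subst smooth_on_cong[OF V, where k = "\<lambda>y. \<phi> ((coord \<kappa> \<circ> param \<kappa>') y)"])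
          (auto simp: push_def param_coord[OF \<kappa>'])
      moreover have "x \<in> ?V"
        using True x by (metis IntI \<kappa>' coord_param image_eqI param_in_dom)
      ultimately show ?thesis using V smooth_on_subset by (metis Int_lower2)
    next
      case False
      let ?V = "param \<kappa>' -` (- param \<kappa> ` C) \<inter> cod \<kappa>'"
      have V: "open ?V"
        using continuous_on_open_vimage[OF open_cod[OF \<kappa>'], of "param \<kappa>'"] continuous_param[OF \<kappa>'] closed
        by (simp add: open_Compl)
      have "smooth_on ?V (push \<kappa> \<phi> \<circ> param \<kappa>')"
        by (subst smooth_on_cong[OF V, where k = "\<lambda>y. 0"])
          (use push_outside[OF \<kappa> C(3)] in \<open>auto simp: smooth_on_const\<close>)
      moreover have "x \<in> ?V" using False x C(2) param_in_dom[OF \<kappa>] by auto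
      ultimately show ?thesis using V smooth_on_subset by (metis Int_lower2)
    qed
  qed
qed

end

section \<open>The ambient space\<close>

lemma ip_commute: "ip c v w = ip c w v"
  by (simp add: ip_def inner_commute mult_ac)

lemma bounded_bilinear_ip: "bounded_bilinear (ip c)"
  unfolding bilinear_conv_bounded_bilinear[symmetric] bilinear_def
  by (auto intro!: linearI simp: ip_def inner_add_left inner_add_right algebra_simps)

lemmas ip_simps = bounded_bilinear.add_left[OF bounded_bilinear_ip] bounded_bilinear.add_right[OF bounded_bilinear_ip]
  bounded_bilinear.diff_left[OF bounded_bilinear_ip] bounded_bilinear.diff_right[OF bounded_bilinear_ip]
  bounded_bilinear.scaleR_left[OF bounded_bilinear_ip] bounded_bilinear.scaleR_right[OF bounded_bilinear_ip]
  bounded_bilinear.minus_left[OF bounded_bilinear_ip] bounded_bilinear.minus_right[OF bounded_bilinear_ip]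
  bounded_bilinear.zero_left[OF bounded_bilinear_ip] bounded_bilinear.zero_right[OF bounded_bilinear_ip]
  bounded_bilinear.sum_left[OF bounded_bilinear_ip] bounded_bilinear.sum_right[OF bounded_bilinear_ip]

lemmas pd_ip = pd_bilinear[OF bounded_bilinear_ip]
lemmas smooth_on_ip = smooth_on_bilinear[OF bounded_bilinear_ip]

definition vert :: "'n::finite amb" where "vert = (0, 1)"

lemma radial_eq: "radial p = p - snd p *\<^sub>R vert"
  by (cases p) (simp add: radial_def vert_def)

lemma bounded_linear_radial: "bounded_linear (radial :: 'n::finite amb \<Rightarrow> 'n amb)"
proof -
  have "bounded_linear (\<lambda>p::'n amb. p - snd p *\<^sub>R vert)"
    by (intro bounded_linear_sub bounded_linear_ident bounded_linear_scaleR_const bounded_linear_snd)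
  then show ?thesis by (simp add: radial_eq[abs_def])
qed

lemmas pd_radial = pd_linear[OF bounded_linear_radial]
lemmas smooth_on_radial = smooth_on_linear[OF bounded_linear_radial]

lemma ip_vert: "ip c v vert = snd v" "ip c vert v = snd v"
  by (simp_all add: ip_def vert_def)

lemma snd_vert [simp]: "snd vert = 1"
  and snd_radial [simp]: "snd (radial p) = 0"
  by (simp_all add: vert_def radial_def)

lemma ip_radial_right: "ip c v (radial w) = ip c v w - snd v * snd w"
  by (simp add: radial_eq ip_simps ip_vert)

lemma ip_radial_left: "ip c (radial v) w = ip c v w - snd v * snd w"
  by (simp add: radial_eq ip_simps ip_vert)

lemma ip_radial_radial: "ip c (radial v) (radial w) = ip c v (radial w)"
  by (simp add: ip_radial_left)

lemma ip_radial_self: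
  assumes "c \<in> {1, -1}" "p \<in> ambient c"
  shows "ip c (radial p) (radial p) = c"
proof -
  obtain a s t where p: "p = ((a, s), t)" by (metis surj_pair)
  show ?thesis
  proof (cases "c = 1")
    case True
    then have "norm (a, s) = 1" using assms(2) by (simp add: p ambient_def space_form_def)
    then have "(a, s) \<bullet> (a, s) = 1" by (simp add: norm_eq_1)
    then show ?thesis using True by (simp add: p ip_def radial_def)
  next
    case False
    then have "c = -1" using assms(1) by auto
    then show ?thesis using assms(2) by (auto simp: p ip_def radial_def ambient_def space_form_def power2_eq_square)
  qed
qed

text \<open>
  The linear map with the \<open>b i\<close>, \<open>\<xi>\<close> and \<open>\<rho>\<close> as columns is injective since their Gram matrix is
  invertible. Its domain has the dimension of the whole space, so these vectors span.
\<close>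

lemma adapted_frame_nondegenerate:
  fixes b :: "'n::finite \<Rightarrow> 'n amb" and M :: "real^'n^'n"
  assumes M: "\<And>i j. ip c (b i) (b j) = M $ i $ j" "det M \<noteq> 0"
    and n: "ip c \<xi> \<xi> \<noteq> 0" "ip c \<rho> \<rho> \<noteq> 0"
    and orth: "\<And>i. ip c (b i) \<xi> = 0" "\<And>i. ip c (b i) \<rho> = 0" "ip c \<xi> \<rho> = 0"
    and v: "\<And>i. ip c v (b i) = 0" "ip c v \<xi> = 0" "ip c v \<rho> = 0"
  shows "v = 0"
proof -
  define \<Phi> :: "'n amb \<Rightarrow> 'n amb" where
    "\<Phi> y = (\<Sum>i\<in>UNIV. fst (fst y) $ i *\<^sub>R b i) + snd (fst y) *\<^sub>R \<xi> + snd y *\<^sub>R \<rho>" for y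
  have lin: "linear \<Phi>"
    by (rule linearI) (simp_all add: \<Phi>_def sum.distrib scaleR_add_left scaleR_sum_right algebra_simps)
  have orth': "ip c \<xi> (b i) = 0" "ip c \<rho> (b i) = 0" "ip c \<rho> \<xi> = 0" for i
    using orth by (simp_all add: ip_commute)
  have \<Phi>b: "ip c (\<Phi> y) (b j) = (transpose M *v fst (fst y)) $ j" for y j
    by (simp add: \<Phi>_def ip_simps M orth' matrix_vector_mult_def transpose_def mult.commute)
  have \<Phi>\<xi>: "ip c (\<Phi> y) \<xi> = snd (fst y) * ip c \<xi> \<xi>" for y
    by (simp add: \<Phi>_def ip_simps orth orth')
  have \<Phi>\<rho>: "ip c (\<Phi> y) \<rho> = snd y * ip c \<rho> \<rho>" for y
    by (simp add: \<Phi>_def ip_simps orth orth')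
  have zero: "y = 0" if "\<And>i. ip c (\<Phi> y) (b i) = 0" "ip c (\<Phi> y) \<xi> = 0" "ip c (\<Phi> y) \<rho> = 0" for y
  proof -
    have "transpose M *v fst (fst y) = 0" using that(1) \<Phi>b by (simp add: vec_eq_iff)
    moreover have "det (transpose M) \<noteq> 0" using M(2) by (simp add: det_transpose)
    ultimately have "fst (fst y) = 0"
      using invertible_det_nz[of "transpose M"]
      by (metis invertible_left_inverse matrix_left_invertible_ker)
    moreover have "snd (fst y) = 0" "snd y = 0" using that(2,3) \<Phi>\<xi> \<Phi>\<rho> n by auto
    ultimately show "y = 0" by (simp add: prod_eq_iff)
  qed
  have "inj \<Phi>"
    using zero by (subst linear_injective_0[OF lin]) (simp add: ip_simps)
  then have "surj \<Phi>" using lin linear_injective_imp_surjective by blast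
  then obtain y where y: "v = \<Phi> y" by (metis surjD)
  then have "y = 0" using zero v by simp
  then show ?thesis using y linear_0[OF lin] by simp
qed

section \<open>Hessian, Laplacian and tension field\<close>

lemma hess_linear:
  assumes "bounded_linear L" "smooth_on U u" "open U" "x \<in> U"
  shows "hess G (\<lambda>y. L (u y)) x i j = L (hess G u x i j)"
proof -
  have d: "pd k (\<lambda>y. L (u y)) y = L (pd k u y)" if "y \<in> U" for k y
    using smooth_on_imp_differentiable[OF assms(2) that] by (rule pd_linear[OF assms(1)])
  have "pd i (pd j (\<lambda>y. L (u y))) x = pd i (\<lambda>y. L (pd j u y)) x"
    by (rule pd_cong[OF assms(3,4) d])
  also have "\<dots> = L (pd i (pd j u) x)"
    by (rule pd_linear[OF assms(1)]) (rule smooth_on_imp_differentiable[OF smooth_on_pd[OF assms(2)] assms(4)])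
  finally show ?thesis
    using assms(1) by (simp add: hess_def d[OF assms(4)] bounded_linear.linear linear_diff linear_sum linear_cmul)
qed

lemma lap_linear:
  assumes "bounded_linear L" "smooth_on U u" "open U" "x \<in> U"
  shows "lap G (\<lambda>y. L (u y)) x = L (lap G u x)"
  using assms(1)
  by (simp add: lap_def hess_linear[OF assms] bounded_linear.linear linear_sum linear_cmul)

lemma hess_cong:
  assumes "open S" "x \<in> S" "\<And>y. y \<in> S \<Longrightarrow> u y = v y"
  shows "hess G u x i j = hess G v x i j"
proof -
  have "pd k u y = pd k v y" if "y \<in> S" for y k by (rule pd_cong[OF assms(1) that assms(3)])
  then show ?thesis
    unfolding hess_def using pd_cong[OF assms(1,2), of "pd j u" "pd j v"] assms(2) by simp
qed

lemma lap_cong: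
  assumes "open S" "x \<in> S" "\<And>y. y \<in> S \<Longrightarrow> u y = v y"
  shows "lap G u x = lap G v x"
  unfolding lap_def by (simp add: hess_cong[OF assms])

lemma bounded_linear_tan_proj: "bounded_linear (tan_proj c p)"
proof -
  have "bounded_linear (\<lambda>v. v - (c * ip c v (radial p)) *\<^sub>R radial p)"
    by (intro bounded_linear_sub bounded_linear_ident bounded_linear_scaleR_const
        bounded_linear_const_mult bounded_bilinear.bounded_linear_left[OF bounded_bilinear_ip])
  then show ?thesis by (simp add: tan_proj_def[abs_def])
qed

text \<open>
  The derivative of \<open>\<langle>radial u, radial u\<rangle> = c\<close>.
\<close>

lemma ip_pd_radial:
  assumes c: "c \<in> {1, -1}" and "open U" "smooth_on U u" "\<And>x. x \<in> U \<Longrightarrow> u x \<in> ambient c" and x: "x \<in> U"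
  shows "ip c (pd i u x) (radial (u x)) = 0"
proof -
  have d: "u differentiable (at x)" by (rule smooth_on_imp_differentiable[OF assms(3) x])
  have dr: "(\<lambda>y. radial (u y)) differentiable (at x)"
    by (rule smooth_on_imp_differentiable[OF smooth_on_radial[OF assms(2,3)] x])
  have "pd i (\<lambda>y. ip c (u y) (radial (u y))) x = pd i (\<lambda>y. c) x"
    by (rule pd_cong[OF assms(2) x]) (metis assms(4) c ip_radial_radial ip_radial_self)
  then have "ip c (pd i u x) (radial (u x)) + ip c (u x) (radial (pd i u x)) = 0"
    using pd_ip[OF d dr, where c = c and i = i] pd_radial[OF d] by simp
  moreover have "ip c (u x) (radial (pd i u x)) = ip c (pd i u x) (radial (u x))"
    using ip_commute[of c "u x" "pd i u x"] by (simp add: ip_radial_right mult.commute)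
  ultimately show ?thesis by simp
qed

text \<open>
  The derivatives of \<open>u\<close> are tangent to the ambient space already, so one projection of the flat
  Laplacian gives the tension field.
\<close>

lemma tension_coord_lap:
  assumes c: "c \<in> {1, -1}" and "open U" "smooth_on U u" "\<And>x. x \<in> U \<Longrightarrow> u x \<in> ambient c" and x: "x \<in> U"
  shows "tension_coord c G u x = tan_proj c (u x) (lap G u x)"
proof -
  have lin: "linear (tan_proj c (u x))" using bounded_linear_tan_proj by (rule bounded_linear.linear)
  have "tan_proj c (u x) (pd k u x) = pd k u x" for k
    using ip_pd_radial[OF assms] by (simp add: tan_proj_def)
  then show ?thesis
    by (simp add: tension_coord_def cov_deriv_def lap_def hess_def linear_sum[OF lin] linear_cmul[OF lin]
        linear_diff[OF lin])
qed

section \<open>Umbilical hypersurfaces in coordinates\<close>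

locale local_immersion = local_metric U G
  for U :: "(real^'n) set" and G :: "real^'n \<Rightarrow> real^'n^'n::finite" +
  fixes c :: real and u :: "real^'n \<Rightarrow> 'n amb"
  assumes c: "c \<in> {1, -1}" and smooth_u: "smooth_on U u"
    and u_ambient: "\<And>x. x \<in> U \<Longrightarrow> u x \<in> ambient c"
    and induced: "\<And>x i j. x \<in> U \<Longrightarrow> G x $ i $ j = ip c (pd i u x) (pd j u x)"
begin

lemmas diff_u = smooth_on_imp_differentiable[OF smooth_u]
lemmas diff_pd_u = smooth_on_imp_differentiable[OF smooth_on_pd[OF smooth_u]]
lemmas pd_u_commute = pd_commute[OF smooth_u open_U]
lemmas pd_u_radial = ip_pd_radial[OF c open_U smooth_u u_ambient]
lemmas radial_u_self = ip_radial_self[OF c u_ambient]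

text \<open>
  The Christoffel symbols of the induced metric are the tangential components of the second
  derivatives of \<open>u\<close>.
\<close>

lemma gauss_tangential:
  assumes x: "x \<in> U"
  shows "ip c (hess G u x i j) (pd l u x) = 0"
proof -
  have dG: "pd l (\<lambda>y. G y $ i $ j) x = ip c (pd l (pd i u) x) (pd j u x) + ip c (pd i u x) (pd l (pd j u) x)"
    for l i j
  proof -
    have "pd l (\<lambda>y. G y $ i $ j) x = pd l (\<lambda>y. ip c (pd i u y) (pd j u y)) x"
      by (rule pd_cong[OF open_U x induced])
    then show ?thesis by (simp only: pd_ip[OF diff_pd_u[OF x] diff_pd_u[OF x]])
  qed
  have low: "(pd i (\<lambda>y. G y $ j $ m) x + pd j (\<lambda>y. G y $ i $ m) x - pd m (\<lambda>y. G y $ i $ j) x) / 2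
      = ip c (pd i (pd j u) x) (pd m u x)" for m
    using pd_u_commute[OF x] by (simp add: dG ip_commute)
  have "(\<Sum>k\<in>UNIV. christoffel G x k i j * G x $ k $ l)
      = (\<Sum>k\<in>UNIV. \<Sum>m\<in>UNIV. gi x k m * ip c (pd i (pd j u) x) (pd m u x) * G x $ k $ l)"
    unfolding christoffel_def sum_divide_distrib times_divide_eq_right[symmetric] low
    by (simp add: sum_distrib_right)
  also have "\<dots> = (\<Sum>m\<in>UNIV. ip c (pd i (pd j u) x) (pd m u x) * (\<Sum>k\<in>UNIV. gi x m k * G x $ k $ l))"
    by (subst sum.swap) (simp add: sum_distrib_left gi_sym[OF x] mult_ac)
  also have "\<dots> = ip c (pd i (pd j u) x) (pd l u x)"
    by (simp add: gi_G[OF x] if_distrib cong: if_cong)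
  finally show ?thesis
    by (simp add: hess_def ip_simps induced[OF x, symmetric])
qed

end

locale local_umbilical = local_immersion U G c u
  for U :: "(real^'n) set" and G :: "real^'n \<Rightarrow> real^'n^'n::finite" and c u +
  fixes \<xi> :: "real^'n \<Rightarrow> 'n amb" and H :: "real^'n \<Rightarrow> real"
  assumes smooth_\<xi>: "smooth_on U \<xi>"
    and \<xi>_radial: "\<And>x. x \<in> U \<Longrightarrow> ip c (\<xi> x) (radial (u x)) = 0"
    and \<xi>_unit: "\<And>x. x \<in> U \<Longrightarrow> ip c (\<xi> x) (\<xi> x) = 1"
    and \<xi>_normal: "\<And>x i. x \<in> U \<Longrightarrow> ip c (\<xi> x) (pd i u x) = 0"
    and umbilical: "\<And>x i l. x \<in> U \<Longrightarrow> ip c (pd i \<xi> x) (pd l u x) = - H x * G x $ l $ i"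
begin

definition ht :: "real^'n \<Rightarrow> real" where "ht x = snd (u x)"
definition ang :: "real^'n \<Rightarrow> real" where "ang x = snd (\<xi> x)"

lemma smooth_ht: "smooth_on U ht"
  unfolding ht_def[abs_def] by (rule smooth_on_snd[OF open_U smooth_u])

lemma smooth_ang: "smooth_on U ang"
  unfolding ang_def[abs_def] by (rule smooth_on_snd[OF open_U smooth_\<xi>])

text \<open>
  Umbilicity expresses \<open>H\<close> as a quotient of smooth functions.
\<close>

lemma smooth_H: "smooth_on U H"
proof -
  fix i :: 'n
  have pos: "G x $ i $ i > 0" if "x \<in> U" for x using G_diag_pos[OF that] .
  have "smooth_on U (\<lambda>x. - ip c (pd i \<xi> x) (pd i u x) / G x $ i $ i)"
    using pos by (intro smooth_on_divide smooth_on_minus smooth_on_ip smooth_on_pd smooth_\<xi> smooth_u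
        smooth_G_entry open_U) (auto simp: less_imp_neq[symmetric])
  then show ?thesis
    by (subst smooth_on_cong[OF open_U, where k = "\<lambda>x. - ip c (pd i \<xi> x) (pd i u x) / G x $ i $ i"])
      (use umbilical pos in \<open>auto simp: less_imp_neq[symmetric]\<close>)
qed

lemmas diff_\<xi> = smooth_on_imp_differentiable[OF smooth_\<xi>]
  and diff_H = smooth_on_imp_differentiable[OF smooth_H]
  and diff_ang = smooth_on_imp_differentiable[OF smooth_ang]
  and diff_pd_ht = smooth_on_imp_differentiable[OF smooth_on_pd[OF smooth_ht]]

lemma pd_ht: "x \<in> U \<Longrightarrow> pd i ht x = snd (pd i u x)"
  unfolding ht_def[abs_def] by (rule pd_snd[OF diff_u])

lemma frame_zero:
  assumes x: "x \<in> U" and v: "\<And>i. ip c v (pd i u x) = 0" "ip c v (\<xi> x) = 0" "ip c v (radial (u x)) = 0"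
  shows "v = 0"
  by (rule adapted_frame_nondegenerate[where b = "\<lambda>i. pd i u x" and M = "G x" and \<xi> = "\<xi> x"
        and \<rho> = "radial (u x)" and c = c])
    (use x v c det_G_nz \<xi>_unit \<xi>_normal \<xi>_radial pd_u_radial radial_u_self induced
      in \<open>auto simp: ip_commute\<close>)

text \<open>
  Besides its tangential part \<open>- H \<partial>\<^sub>i u\<close>, the flat derivative of \<open>\<xi>\<close> has a component along the
  position vector, which is read off from the derivative of \<open>\<langle>\<xi>, radial u\<rangle> = 0\<close>.
\<close>

lemma weingarten:
  assumes x: "x \<in> U"
  shows "pd i \<xi> x = - H x *\<^sub>R pd i u x + (c * ang x * pd i ht x) *\<^sub>R radial (u x)"
proof -
  have "pd i (\<lambda>y. ip c (\<xi> y) (\<xi> y)) x = pd i (\<lambda>y. 1) x"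
    by (rule pd_cong[OF open_U x \<xi>_unit])
  then have 1: "ip c (pd i \<xi> x) (\<xi> x) = 0"
    using pd_ip[OF diff_\<xi>[OF x] diff_\<xi>[OF x], where c = c and i = i] by (simp add: ip_commute)
  have dr: "(\<lambda>y. radial (u y)) differentiable (at x)"
    by (rule smooth_on_imp_differentiable[OF smooth_on_radial[OF open_U smooth_u] x])
  have "pd i (\<lambda>y. ip c (\<xi> y) (radial (u y))) x = pd i (\<lambda>y. 0) x"
    by (rule pd_cong[OF open_U x \<xi>_radial])
  then have 2: "ip c (pd i \<xi> x) (radial (u x)) = ang x * pd i ht x"
    using pd_ip[OF diff_\<xi>[OF x] dr, where c = c and i = i] pd_radial[OF diff_u[OF x]]
    by (simp add: ip_radial_right[of c "\<xi> x"] \<xi>_normal[OF x] ang_def pd_ht[OF x])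
  let ?v = "pd i \<xi> x - (- H x *\<^sub>R pd i u x + (c * ang x * pd i ht x) *\<^sub>R radial (u x))"
  have "?v = 0"
  proof (rule frame_zero[OF x])
    show "ip c ?v (pd l u x) = 0" for l
      using umbilical[OF x, of i l] induced[OF x] G_sym[OF x, of l i] pd_u_radial[OF _ x]
      by (simp add: ip_simps ip_commute[of c "radial (u x)"] x)
    show "ip c ?v (\<xi> x) = 0"
      using 1 \<xi>_normal[OF x] \<xi>_radial[OF x]
      by (simp add: ip_simps ip_commute[of c "radial (u x)"] ip_commute[of c "pd i u x" "\<xi> x"])
    show "ip c ?v (radial (u x)) = 0"
      using 2 pd_u_radial[OF _ x] radial_u_self[OF x] c by (auto simp: ip_simps x)
  qed
  then show ?thesis by simp
qed

lemma pd_ang: "x \<in> U \<Longrightarrow> pd i ang x = - H x * pd i ht x"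
  unfolding ang_def[abs_def] by (subst pd_snd[OF diff_\<xi>]) (simp_all add: weingarten pd_ht)

text \<open>
  Here only the \<open>\<xi>\<close>-component carries geometric information; the component along the position vector
  is normal to the ambient space and is left as it stands.
\<close>

lemma gauss_formula:
  assumes x: "x \<in> U"
  shows "hess G u x i j = (H x * G x $ i $ j) *\<^sub>R \<xi> x + (c * ip c (hess G u x i j) (radial (u x))) *\<^sub>R radial (u x)"
proof -
  have "pd i (\<lambda>y. ip c (\<xi> y) (pd j u y)) x = pd i (\<lambda>y. 0) x"
    by (rule pd_cong[OF open_U x \<xi>_normal])
  then have "ip c (pd i (pd j u) x) (\<xi> x) = H x * G x $ i $ j"
    using pd_ip[OF diff_\<xi>[OF x] diff_pd_u[OF x, of j], where c = c and i = i] umbilical[OF x, of i j] G_sym[OF x, of i j]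
    by (simp add: ip_commute)
  then have 1: "ip c (hess G u x i j) (\<xi> x) = H x * G x $ i $ j"
    using \<xi>_normal[OF x] by (simp add: hess_def ip_simps ip_commute[of c _ "\<xi> x"])
  let ?v = "hess G u x i j - ((H x * G x $ i $ j) *\<^sub>R \<xi> x
      + (c * ip c (hess G u x i j) (radial (u x))) *\<^sub>R radial (u x))"
  have "?v = 0"
  proof (rule frame_zero[OF x])
    show "ip c ?v (pd l u x) = 0" for l
      using gauss_tangential[OF x] \<xi>_normal[OF x] pd_u_radial[OF _ x]
      by (simp add: ip_simps ip_commute[of c "radial (u x)"] x)
    show "ip c ?v (\<xi> x) = 0"
      using 1 \<xi>_unit[OF x] \<xi>_radial[OF x] by (simp add: ip_simps ip_commute[of c "radial (u x)"])
    show "ip c ?v (radial (u x)) = 0"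
      using \<xi>_radial[OF x] radial_u_self[OF x] c by (auto simp: ip_simps)
  qed
  then show ?thesis by simp
qed

lemma trace_G: "x \<in> U \<Longrightarrow> (\<Sum>i\<in>UNIV. \<Sum>j\<in>UNIV. gi x i j * G x $ i $ j) = real CARD('n)"
  using gi_G[of x] by (simp add: G_sym[of x])

lemma tan_proj_lap_u:
  assumes x: "x \<in> U"
  shows "tan_proj c (u x) (lap G u x) = (real CARD('n) * H x) *\<^sub>R \<xi> x"
proof -
  have lin: "linear (tan_proj c (u x))" using bounded_linear_tan_proj by (rule bounded_linear.linear)
  have r: "tan_proj c (u x) (radial (u x)) = 0"
    using radial_u_self[OF x] c by (auto simp: tan_proj_def)
  have \<xi>: "tan_proj c (u x) (\<xi> x) = \<xi> x"
    using \<xi>_radial[OF x] by (simp add: tan_proj_def)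
  have "tan_proj c (u x) (hess G u x i j) = (H x * G x $ i $ j) *\<^sub>R \<xi> x" for i j
    by (subst gauss_formula[OF x]) (simp add: linear_add[OF lin] linear_cmul[OF lin] r \<xi>)
  then have "tan_proj c (u x) (lap G u x) = (\<Sum>i\<in>UNIV. \<Sum>j\<in>UNIV. gi x i j *\<^sub>R (H x * G x $ i $ j) *\<^sub>R \<xi> x)"
    by (simp add: lap_def linear_sum[OF lin] linear_cmul[OF lin])
  also have "\<dots> = (\<Sum>i\<in>UNIV. \<Sum>j\<in>UNIV. gi x i j * G x $ i $ j) *\<^sub>R H x *\<^sub>R \<xi> x"
    by (simp add: scaleR_sum_left sum_distrib_left sum_distrib_right mult_ac)
  finally show ?thesis by (simp only: trace_G[OF x]) simp
qed

lemma hess_ht: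
  assumes x: "x \<in> U"
  shows "hess G ht x i j = H x * ang x * G x $ i $ j"
proof -
  have "hess G ht x i j = snd (hess G u x i j)"
    unfolding ht_def[abs_def] by (rule hess_linear[OF bounded_linear_snd smooth_u open_U x])
  then show ?thesis by (subst (asm) gauss_formula[OF x]) (simp add: ang_def)
qed

lemma lap_ht:
  assumes x: "x \<in> U"
  shows "lap G ht x = real CARD('n) * H x * ang x"
proof -
  have "lap G ht x = (\<Sum>i\<in>UNIV. \<Sum>j\<in>UNIV. gi x i j * G x $ i $ j) * (H x * ang x)"
    by (simp add: lap_def hess_ht[OF x] sum_distrib_left sum_distrib_right mult_ac)
  then show ?thesis by (simp add: trace_G[OF x])
qed

text \<open>
  The vertical unit vector is the sum of its tangential part, the gradient of the height, and
  \<open>\<nu> \<xi>\<close>.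
\<close>

lemma norm_grad_ht:
  assumes x: "x \<in> U"
  shows "(\<Sum>i\<in>UNIV. \<Sum>j\<in>UNIV. gi x i j * (pd i ht x * pd j ht x)) = 1 - (ang x)\<^sup>2"
proof -
  \<comment> \<open>the gradient of the height, as a vector of the surrounding space\<close>
  define T where "T = (\<Sum>i\<in>UNIV. (\<Sum>j\<in>UNIV. gi x i j * pd j ht x) *\<^sub>R pd i u x)"
  have T\<xi>: "ip c T (\<xi> x) = 0" and Tr: "ip c T (radial (u x)) = 0"
    using \<xi>_normal[OF x] pd_u_radial[OF _ x] x by (simp_all add: T_def ip_simps ip_commute[of c _ "\<xi> x"])
  have Tu: "ip c T (pd l u x) = pd l ht x" for l
  proof -
    have "ip c T (pd l u x) = (\<Sum>i\<in>UNIV. \<Sum>j\<in>UNIV. gi x i j * pd j ht x * G x $ i $ l)"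
      by (simp add: T_def ip_simps induced[OF x] sum_distrib_right)
    also have "\<dots> = (\<Sum>j\<in>UNIV. pd j ht x * (\<Sum>i\<in>UNIV. gi x j i * G x $ i $ l))"
      by (subst sum.swap) (simp add: sum_distrib_left gi_sym[OF x] mult_ac)
    also have "\<dots> = pd l ht x" by (simp add: gi_G[OF x] if_distrib cong: if_cong)
    finally show ?thesis .
  qed
  let ?v = "vert - (T + ang x *\<^sub>R \<xi> x)"
  have "?v = 0"
  proof (rule frame_zero[OF x])
    show "ip c ?v (pd i u x) = 0" for i
      by (simp add: ip_simps ip_vert Tu \<xi>_normal[OF x] pd_ht[OF x])
    show "ip c ?v (\<xi> x) = 0"
      by (simp add: ip_simps ip_vert T\<xi> \<xi>_unit[OF x] ang_def)
    show "ip c ?v (radial (u x)) = 0"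
      by (simp add: ip_simps ip_vert Tr \<xi>_radial[OF x])
  qed
  then have e: "vert = T + ang x *\<^sub>R \<xi> x" by simp
  have "1 = snd (vert :: 'n amb)" by simp
  also have "\<dots> = snd T + (ang x)\<^sup>2"
    by (subst e) (simp add: ang_def power2_eq_square)
  also have "snd T = (\<Sum>i\<in>UNIV. \<Sum>j\<in>UNIV. gi x i j * (pd i ht x * pd j ht x))"
    by (simp add: T_def snd_sum pd_ht[OF x] sum_distrib_right sum_distrib_left mult_ac)
  finally show ?thesis by simp
qed

end

section \<open>Umbilical hypersurfaces with biharmonic height\<close>

lemma open_nonzero_set:
  fixes q :: "'a::topological_space \<Rightarrow> real"
  assumes "open U" "continuous_on U q"
  shows "open {x \<in> U. q x \<noteq> 0}"
proof -
  have "open (q -` (- {0}) \<inter> U)"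
    by (rule continuous_on_open_vimage[THEN iffD1, rule_format, OF assms]) auto
  moreover have "q -` (- {0}) \<inter> U = {x \<in> U. q x \<noteq> 0}" by auto
  ultimately show ?thesis by simp
qed

context local_umbilical
begin

text \<open>
  The second derivatives of \<open>\<xi>\<close>, computed from the Weingarten formula, are symmetric. What remains
  of this is \<open>(H\<^sub>j + c \<nu> h\<^sub>j) \<partial>\<^sub>i u = (H\<^sub>i + c \<nu> h\<^sub>i) \<partial>\<^sub>j u\<close>, and the tangent vectors \<open>\<partial>\<^sub>i u\<close> and
  \<open>\<partial>\<^sub>j u\<close> are linearly independent for \<open>i \<noteq> j\<close>.
\<close>

lemma codazzi:
  assumes x: "x \<in> U" and "CARD('n) \<ge> 2"
  shows "pd j H x = - c * ang x * pd j ht x"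
proof -
  have "\<exists>i. i \<noteq> j"
  proof (rule ccontr)
    assume "\<not> (\<exists>i. i \<noteq> j)"
    then have "(UNIV :: 'n set) = {j}" by auto
    then have "CARD('n) = card {j}" by (rule arg_cong)
    then show False using assms(2) by simp
  qed
  then obtain i where ij: "i \<noteq> j" ..
  have D: "pd b (pd a \<xi>) x = - pd b H x *\<^sub>R pd a u x - H x *\<^sub>R pd b (pd a u) x
      + (c * (- H x * pd b ht x * pd a ht x + ang x * pd b (pd a ht) x)) *\<^sub>R radial (u x)
      + (c * ang x * pd a ht x) *\<^sub>R (pd b u x - pd b ht x *\<^sub>R vert)" for a b
  proof -
    have dr: "(\<lambda>y. radial (u y)) differentiable (at x)"
      by (rule smooth_on_imp_differentiable[OF smooth_on_radial[OF open_U smooth_u] x])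
    have q: "(\<lambda>y. c * ang y) differentiable (at x)" "(\<lambda>y. c * ang y * pd a ht y) differentiable (at x)"
      "(\<lambda>y. - H y) differentiable (at x)"
      using diff_ang[OF x] diff_pd_ht[OF x] diff_H[OF x] by (auto intro: differentiable_mult differentiable_minus)
    have "pd b (pd a \<xi>) x = pd b (\<lambda>y. - H y *\<^sub>R pd a u y + (c * ang y * pd a ht y) *\<^sub>R radial (u y)) x"
      by (rule pd_cong[OF open_U x weingarten])
    also have "\<dots> = pd b (\<lambda>y. - H y *\<^sub>R pd a u y) x + pd b (\<lambda>y. (c * ang y * pd a ht y) *\<^sub>R radial (u y)) x"
      by (rule pd_add) (intro differentiable_scaleR q diff_pd_u[OF x] dr)+
    also have "pd b (\<lambda>y. - H y *\<^sub>R pd a u y) x = - pd b H x *\<^sub>R pd a u x - H x *\<^sub>R pd b (pd a u) x"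
      using pd_scaleR[OF q(3) diff_pd_u[OF x, of a], of b] pd_minus[OF diff_H[OF x], of b] by simp
    also have "pd b (\<lambda>y. (c * ang y * pd a ht y) *\<^sub>R radial (u y)) x
        = pd b (\<lambda>y. c * ang y * pd a ht y) x *\<^sub>R radial (u x) + (c * ang x * pd a ht x) *\<^sub>R radial (pd b u x)"
      using pd_scaleR[OF q(2) dr, of b] pd_radial[OF diff_u[OF x], of b] by simp
    also have "pd b (\<lambda>y. c * ang y * pd a ht y) x = c * (- H x * pd b ht x * pd a ht x + ang x * pd b (pd a ht) x)"
      using pd_mult[OF q(1) diff_pd_ht[OF x], of b a] pd_cmult[OF diff_ang[OF x], of b c] pd_ang[OF x, of b]
      by (simp add: algebra_simps)
    finally show ?thesis by (simp add: radial_eq[of "pd b u x"] pd_ht[OF x] algebra_simps)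
  qed
  have comm: "pd j (pd i \<xi>) x = pd i (pd j \<xi>) x" "pd j (pd i u) x = pd i (pd j u) x"
      "pd j (pd i ht) x = pd i (pd j ht) x"
    by (rule pd_commute[OF _ open_U x], rule smooth_\<xi> smooth_u smooth_ht)+
  let ?p = "\<lambda>k. pd k H x + c * ang x * pd k ht x"
  have "?p j *\<^sub>R pd i u x - ?p i *\<^sub>R pd j u x
      = pd i (pd j \<xi>) x - pd j (pd i \<xi>) x"
    unfolding D[of i j] D[of j i] comm(2,3) by (simp add: algebra_simps)
  then have eq: "?p j *\<^sub>R pd i u x = ?p i *\<^sub>R pd j u x"
    by (simp add: comm(1))
  then have "?p j * G x $ i $ l = ?p i * G x $ j $ l" for l
  proof -
    have "ip c (?p j *\<^sub>R pd i u x) (pd l u x)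
        = ip c (?p i *\<^sub>R pd j u x) (pd l u x)"
      using eq by simp
    then show ?thesis by (simp only: ip_simps induced[OF x] real_scaleR_def)
  qed
  then have "(\<Sum>l\<in>UNIV. ?p j * G x $ i $ l * gi x l i)
      = (\<Sum>l\<in>UNIV. ?p i * G x $ j $ l * gi x l i)" by simp
  then have "?p j * (\<Sum>l\<in>UNIV. G x $ i $ l * gi x l i)
      = ?p i * (\<Sum>l\<in>UNIV. G x $ j $ l * gi x l i)"
    by (simp add: sum_distrib_left mult.assoc)
  then show ?thesis using ij by (simp add: G_gi[OF x])
qed

lemma umbilical_height_biharmonic_imp_minimal:
  assumes m: "CARD('n) \<ge> 2" and bi: "\<And>x. x \<in> U \<Longrightarrow> lap G (lap G ht) x = 0" and x: "x \<in> U"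
  shows "H x = 0"
proof -
  define m where "m = real CARD('n)"
  have mpos: "m > 0" using m by (simp add: m_def)
  have c2: "c * c = 1" and c0: "c \<noteq> 0" using c by auto
  \<comment> \<open>\<open>b\<close> is the Laplacian of the height, and \<open>\<nabla>b = - m \<sigma> \<nabla>h\<close>\<close>
  define b where "b y = m * (H y * ang y)" for y
  define \<sigma> where "\<sigma> y = c * (ang y)\<^sup>2 + (H y)\<^sup>2" for y
  have pdH: "pd i H y = - c * ang y * pd i ht y" if "y \<in> U" for i y using codazzi[OF that m] .
  have pdb: "pd j b y = - m * \<sigma> y * pd j ht y" if y: "y \<in> U" for j y
  proof -
    have "pd j (\<lambda>z. H z * ang z) y = - \<sigma> y * pd j ht y"
      unfolding \<sigma>_def using pd_mult[OF diff_H[OF y] diff_ang[OF y], of j] pdH[OF y] pd_ang[OF y]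
      by (simp add: algebra_simps power2_eq_square)
    then show ?thesis
      unfolding b_def[abs_def]
      using pd_cmult[OF differentiable_mult[OF diff_H[OF y] diff_ang[OF y]], of j m] by simp
  qed
  have pd\<sigma>: "pd i \<sigma> y = - 4 * c * ang y * H y * pd i ht y" if y: "y \<in> U" for i y
  proof -
    have q: "(\<lambda>y. (ang y)\<^sup>2) differentiable (at y)" "(\<lambda>y. (H y)\<^sup>2) differentiable (at y)"
      using diff_ang[OF y] diff_H[OF y] by (auto intro: differentiable_power)
    have "pd i \<sigma> y = pd i (\<lambda>y. c * (ang y)\<^sup>2) y + pd i (\<lambda>y. (H y)\<^sup>2) y"
      unfolding \<sigma>_def[abs_def] by (rule pd_add) (auto intro: q differentiable_mult)
    then show ?thesis
      using pd_cmult[OF q(1), of i c] pd_square[OF diff_ang[OF y], of i] pd_square[OF diff_H[OF y], of i]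
        pdH[OF y] pd_ang[OF y] by (simp add: algebra_simps)
  qed
  have diff_\<sigma>: "\<sigma> differentiable (at y)" if "y \<in> U" for y
    unfolding \<sigma>_def[abs_def] using diff_ang[OF that] diff_H[OF that]
    by (auto intro: differentiable_add differentiable_mult differentiable_power)
  have hb: "hess G b y i j = 4 * m * c * ang y * H y * (pd i ht y * pd j ht y) - m * \<sigma> y * hess G ht y i j"
    if y: "y \<in> U" for i j y
  proof -
    have "pd i (pd j b) y = pd i (\<lambda>y. - m * \<sigma> y * pd j ht y) y"
      by (rule pd_cong[OF open_U y pdb])
    also have "\<dots> = pd i (\<lambda>y. - m * \<sigma> y) y * pd j ht y + - m * \<sigma> y * pd i (pd j ht) y"
      by (rule pd_mult[OF differentiable_mult[OF differentiable_const diff_\<sigma>[OF y]] diff_pd_ht[OF y]])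
    also have "pd i (\<lambda>y. - m * \<sigma> y) y = - m * pd i \<sigma> y"
      by (rule pd_cmult[OF diff_\<sigma>[OF y]])
    finally show ?thesis
      by (simp add: hess_def pdb[OF y] pd\<sigma>[OF y] sum_distrib_left sum_negf algebra_simps)
  qed
  have key: "H y * ang y * (4 * c * (1 - (ang y)\<^sup>2) - m * \<sigma> y) = 0" if y: "y \<in> U" for y
  proof -
    have "lap G (lap G ht) y = lap G b y"
      by (rule lap_cong[OF open_U y]) (simp add: lap_ht b_def m_def)
    then have "lap G b y = 0" using bi[OF y] by simp
    moreover have L: "lap G b y = 4 * m * c * ang y * H y * (\<Sum>i\<in>UNIV. \<Sum>j\<in>UNIV. gi y i j * (pd i ht y * pd j ht y))
        - m * \<sigma> y * lap G ht y"
      by (simp add: lap_def hb[OF y] right_diff_distrib sum_subtractf sum_distrib_left mult_ac)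
    ultimately have "m * (H y * ang y * (4 * c * (1 - (ang y)\<^sup>2) - m * \<sigma> y)) = 0"
      unfolding L norm_grad_ht[OF y] lap_ht[OF y] m_def[symmetric] by (simp add: algebra_simps)
    then show ?thesis using mpos by simp
  qed
  have Hang: "H y * ang y = 0" if y: "y \<in> U" for y
  proof (rule ccontr)
    assume nz: "H y * ang y \<noteq> 0"
    define V where "V = {y \<in> U. H y * ang y \<noteq> 0}"
    have V: "open V" unfolding V_def
      by (intro open_nonzero_set open_U continuous_on_mult smooth_on_imp_continuous_on smooth_H smooth_ang)
    have yV: "y \<in> V" using y nz by (simp add: V_def)
    have grad0: "pd i ht z = 0" if z: "z \<in> V" for i z
    proof -
      have zU: "z \<in> U" using z by (simp add: V_def)
      have q: "(\<lambda>y. (ang y)\<^sup>2) differentiable (at z)" using diff_ang[OF zU] by (rule differentiable_power)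
      have "pd i (\<lambda>y. 4 * c * (ang y)\<^sup>2 + m * \<sigma> y) z = pd i (\<lambda>y. 4 * c) z"
      proof (rule pd_cong[OF V z])
        fix y assume "y \<in> V"
        then have "4 * c * (1 - (ang y)\<^sup>2) - m * \<sigma> y = 0" using key[of y] by (auto simp: V_def)
        then show "4 * c * (ang y)\<^sup>2 + m * \<sigma> y = 4 * c" unfolding right_diff_distrib by linarith
      qed
      moreover have "pd i (\<lambda>y. 4 * c * (ang y)\<^sup>2 + m * \<sigma> y) z = 4 * c * (2 * ang z * pd i ang z) + m * pd i \<sigma> z"
      proof -
        note ds = diff_\<sigma>[OF zU]
        have "pd i (\<lambda>y. 4 * c * (ang y)\<^sup>2 + m * \<sigma> y) z = pd i (\<lambda>y. 4 * c * (ang y)\<^sup>2) z + pd i (\<lambda>y. m * \<sigma> y) z"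
          by (rule pd_add) (auto intro: q ds differentiable_mult)
        then show ?thesis
          using pd_cmult[OF q, of i "4 * c"] pd_cmult[OF ds, of i m] pd_square[OF diff_ang[OF zU], of i] by simp
      qed
      ultimately have "c * ((8 + 4 * m) * (H z * ang z) * pd i ht z) = 0"
        by (simp add: pd_ang[OF zU] pd\<sigma>[OF zU] algebra_simps)
      then show ?thesis using c0 mpos z by (simp add: V_def)
    qed
    obtain i :: 'n where True by blast
    have "pd i (pd i ht) y = pd i (\<lambda>z. 0) y" by (rule pd_cong[OF V yV grad0])
    then have "hess G ht y i i = 0" by (simp add: hess_def grad0[OF yV])
    then show False using hess_ht[OF y, of i i] nz G_diag_pos[OF y, of i] by simp
  qed
  show "H x = 0"
  proof (rule ccontr)
    assume nz: "H x \<noteq> 0"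
    define V where "V = {y \<in> U. H y \<noteq> 0}"
    have V: "open V" unfolding V_def
      by (intro open_nonzero_set open_U smooth_on_imp_continuous_on smooth_H)
    have xV: "x \<in> V" using x nz by (simp add: V_def)
    have ang0: "ang y = 0" if "y \<in> V" for y using that Hang[of y] by (simp add: V_def)
    have "pd i ht x = 0" for i
    proof -
      have "pd i ang x = pd i (\<lambda>_. 0) x" by (rule pd_cong[OF V xV ang0])
      then show ?thesis using pd_ang[OF x, of i] nz by simp
    qed
    then have "(ang x)\<^sup>2 = 1" using norm_grad_ht[OF x] by simp
    then show False using ang0[OF xV] by simp
  qed
qed

end

section \<open>Curves\<close>

context local_metric
begin

text \<open>
  The functions \<open>\<alpha>\<close> and \<open>\<beta>\<close> are the velocity components of a curve with values in a flat surface, and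
  \<open>A\<close>, \<open>B\<close> are the components of its acceleration with respect to arc length \<open>s\<close>. With arc length as
  the coordinate the argument reads: \<open>\<alpha>A + \<beta>B = 0\<close> as the speed is \<open>1\<close>; its derivative is
  \<open>A\<^sup>2 + B\<^sup>2 + \<alpha>A' + \<beta>B' = 0\<close>; as \<open>A'' = B'' = 0\<close>, the next derivative is \<open>3 (AA' + BB') = 0\<close>, and
  one more gives \<open>A'\<^sup>2 + B'\<^sup>2 = 0\<close>. Then the second equation yields \<open>A\<^sup>2 + B\<^sup>2 = 0\<close>.
\<close>

lemma one_dimensional_biharmonic:
  fixes \<alpha> \<beta> :: "real^'n \<Rightarrow> real" and i :: 'n
  assumes i: "(UNIV :: 'n set) = {i}"
    and \<alpha>: "smooth_on U \<alpha>" and \<beta>: "smooth_on U \<beta>"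
    and unit: "\<And>x. x \<in> U \<Longrightarrow> G x $ i $ i = (\<alpha> x)\<^sup>2 + (\<beta> x)\<^sup>2"
    and A: "A = (\<lambda>x. gi x i i * (pd i \<alpha> x - christoffel G x i i i * \<alpha> x))"
    and B: "B = (\<lambda>x. gi x i i * (pd i \<beta> x - christoffel G x i i i * \<beta> x))"
    and harm: "\<And>x. x \<in> U \<Longrightarrow> lap G A x = 0" "\<And>x. x \<in> U \<Longrightarrow> lap G B x = 0"
    and x: "x \<in> U"
  shows "A x = 0 \<and> B x = 0"
proof -
  define E where "E y = G y $ i $ i" for y
  define \<Gamma> where "\<Gamma> y = christoffel G y i i i" for y
  have smA: "smooth_on U A" "smooth_on U B"
    unfolding A B by (intro smooth_on_mult smooth_on_diff smooth_gi smooth_on_pd smooth_christoffel \<alpha> \<beta> open_U)+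
  have smE: "smooth_on U E" unfolding E_def[abs_def] by (rule smooth_G_entry)
  note sm = \<alpha> \<beta> smA smE smA[THEN smooth_on_pd, of i]
  note d = sm[THEN smooth_on_imp_differentiable]
  have Epos: "E y > 0" if "y \<in> U" for y using G_diag_pos[OF that] by (simp add: E_def)
  have giE: "gi y i i * E y = 1" if "y \<in> U" for y
    using gi_G[OF that, of i i] by (simp add: i E_def)
  have \<Gamma>: "2 * E y * \<Gamma> y = pd i E y" if "y \<in> U" for y
  proof -
    have "\<Gamma> y = gi y i i * pd i E y / 2" by (simp add: \<Gamma>_def christoffel_def i E_def[abs_def])
    then show ?thesis using giE[OF that] by (simp add: mult_ac)
  qed
  have A': "pd i \<alpha> y = E y * A y + \<Gamma> y * \<alpha> y" "pd i \<beta> y = E y * B y + \<Gamma> y * \<beta> y" if "y \<in> U" for y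
    using giE[OF that] unfolding A B \<Gamma>_def[symmetric] by (simp_all add: mult.assoc[symmetric] mult.commute[of "E y"])
  have lap0: "pd i (pd i q) y = \<Gamma> y * pd i q y" if "lap G q y = 0" "y \<in> U" for q :: "real^'n \<Rightarrow> real" and y
  proof -
    have "gi y i i \<noteq> 0" using giE[OF that(2)] by auto
    then show ?thesis using that(1) by (simp add: lap_def hess_def i \<Gamma>_def)
  qed
  have A'': "pd i (pd i A) y = \<Gamma> y * pd i A y" "pd i (pd i B) y = \<Gamma> y * pd i B y" if "y \<in> U" for y
    using lap0[OF harm(1) that] lap0[OF harm(2) that] that by auto
  have E1: "\<alpha> y * A y + \<beta> y * B y = 0" if y: "y \<in> U" for y
  proof -
    have "pd i E y = pd i (\<lambda>z. (\<alpha> z)\<^sup>2 + (\<beta> z)\<^sup>2) y"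
      by (rule pd_cong[OF open_U y]) (simp add: E_def unit)
    then have "pd i E y = 2 * \<alpha> y * pd i \<alpha> y + 2 * \<beta> y * pd i \<beta> y"
      using d[OF y] by (simp add: pd_add pd_square differentiable_power)
    then have "2 * E y * \<Gamma> y = 2 * E y * (\<alpha> y * A y + \<beta> y * B y) + 2 * \<Gamma> y * ((\<alpha> y)\<^sup>2 + (\<beta> y)\<^sup>2)"
      unfolding A'[OF y] \<Gamma>[OF y, symmetric] by (simp add: algebra_simps power2_eq_square)
    then show ?thesis using Epos[OF y] unit[OF y] by (simp add: E_def mult_ac)
  qed
  have E2: "E y * ((A y)\<^sup>2 + (B y)\<^sup>2) + (\<alpha> y * pd i A y + \<beta> y * pd i B y) = 0" if y: "y \<in> U" for y
  proof -
    have "pd i (\<lambda>z. \<alpha> z * A z + \<beta> z * B z) y = pd i (\<lambda>z. 0) y"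
      by (rule pd_cong[OF open_U y E1])
    then have "pd i \<alpha> y * A y + \<alpha> y * pd i A y + (pd i \<beta> y * B y + \<beta> y * pd i B y) = 0"
      using d[OF y] by (simp add: pd_add pd_mult differentiable_mult)
    then have "E y * ((A y)\<^sup>2 + (B y)\<^sup>2) + (\<alpha> y * pd i A y + \<beta> y * pd i B y)
        + \<Gamma> y * (\<alpha> y * A y + \<beta> y * B y) = 0"
      unfolding A'[OF y] by (simp add: algebra_simps power2_eq_square)
    then show ?thesis by (simp add: E1[OF y])
  qed
  have E3: "A y * pd i A y + B y * pd i B y = 0" if y: "y \<in> U" for y
  proof -
    have "pd i (\<lambda>z. E z * ((A z)\<^sup>2 + (B z)\<^sup>2) + (\<alpha> z * pd i A z + \<beta> z * pd i B z)) y = pd i (\<lambda>z. 0) y"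
      by (rule pd_cong[OF open_U y E2])
    then have "pd i E y * ((A y)\<^sup>2 + (B y)\<^sup>2) + E y * (2 * A y * pd i A y + 2 * B y * pd i B y)
       + (pd i \<alpha> y * pd i A y + \<alpha> y * pd i (pd i A) y + (pd i \<beta> y * pd i B y + \<beta> y * pd i (pd i B) y)) = 0"
      using d[OF y] by (simp add: pd_add pd_mult pd_square differentiable_mult differentiable_add differentiable_power)
    then have "3 * E y * (A y * pd i A y + B y * pd i B y)
        + 2 * \<Gamma> y * (E y * ((A y)\<^sup>2 + (B y)\<^sup>2) + (\<alpha> y * pd i A y + \<beta> y * pd i B y)) = 0"
      unfolding A'[OF y] A''[OF y] \<Gamma>[OF y, symmetric] by (simp add: algebra_simps)
    then show ?thesis using Epos[OF y] by (simp add: E2[OF y])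
  qed
  have "pd i (\<lambda>z. A z * pd i A z + B z * pd i B z) x = pd i (\<lambda>z. 0) x"
    by (rule pd_cong[OF open_U x E3])
  then have "pd i A x * pd i A x + A x * pd i (pd i A) x + (pd i B x * pd i B x + B x * pd i (pd i B) x) = 0"
    using d[OF x] by (simp add: pd_add pd_mult differentiable_mult)
  then have "(pd i A x)\<^sup>2 + (pd i B x)\<^sup>2 + \<Gamma> x * (A x * pd i A x + B x * pd i B x) = 0"
    unfolding A''[OF x] by (simp add: algebra_simps power2_eq_square)
  then have "pd i A x = 0" "pd i B x = 0" by (simp_all add: E3[OF x] sum_power2_eq_zero_iff)
  then have "(A x)\<^sup>2 + (B x)\<^sup>2 = 0" using E2[OF x] Epos[OF x] by simp
  then show ?thesis by (simp add: sum_power2_eq_zero_iff)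
qed

end

text \<open>
  For a one-element index type this is the unit Killing field of \<open>L\<^sup>1(c)\<close>: the infinitesimal rotation
  of the circle, or the infinitesimal boost of the hyperbola. The sums over the index type pick the
  only coordinate.
\<close>

definition rot :: "real \<Rightarrow> 'n::finite amb \<Rightarrow> 'n amb" where
  "rot c p = (((\<chi> k. - c * snd (fst p)), (\<Sum>k\<in>UNIV. fst (fst p) $ k)), 0)"

lemma bounded_linear_rot: "bounded_linear (rot c :: 'n::finite amb \<Rightarrow> 'n amb)"
  by (rule linear_conv_bounded_linear[THEN iffD1], rule linearI)
    (simp_all add: rot_def vec_eq_iff sum.distrib sum_distrib_left algebra_simps)

lemmas pd_rot = pd_linear[OF bounded_linear_rot]
lemmas smooth_on_rot = smooth_on_linear[OF bounded_linear_rot]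

lemma snd_rot [simp]: "snd (rot c p) = 0"
  by (simp add: rot_def)

lemma rot_vert [simp]: "rot c vert = 0"
  by (simp add: rot_def vert_def zero_prod_def vec_eq_iff)

lemma rot_radial [simp]: "rot c (radial p) = rot c p"
  by (simp add: rot_def radial_def)

context
  fixes c :: real and i :: "'n::finite" and p :: "'n amb"
  assumes c: "c \<in> {1, -1}" and i: "(UNIV :: 'n set) = {i}"
begin

lemma rot_rot: "rot c (rot c p) = - c *\<^sub>R radial p"
proof -
  have k: "k = i" for k :: 'n using i by auto
  have "fst (fst p) $ i = fst (fst p) $ k" for k using k[of k] by simp
  then show ?thesis by (simp add: rot_def radial_def prod_eq_iff vec_eq_iff i)
qed

lemma ip_rot_radial: "ip c (rot c p) (radial p) = 0"
  by (simp add: ip_def rot_def radial_def inner_vec_def i)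

lemma ip_rot_rot: "p \<in> ambient c \<Longrightarrow> ip c (rot c p) (rot c p) = 1"
  using ip_radial_self[OF c, of p] c by (auto simp: ip_def rot_def radial_def inner_vec_def i)

text \<open>
  The tangent plane of \<open>L\<^sup>1(c) \<times> \<real>\<close> is spanned by the orthonormal vectors \<open>rot c p\<close> and \<open>vert\<close>.
\<close>

lemma tangent_rot:
  assumes "p \<in> ambient c" "ip c v (radial p) = 0"
  shows "v = ip c v (rot c p) *\<^sub>R rot c p + snd v *\<^sub>R vert"
proof -
  obtain a s t b r h where p: "p = ((a, s), t)" and v: "v = ((b, r), h)" by (metis surj_pair)
  have k: "k = i" for k :: 'n using i by auto
  have 1: "a $ i * a $ i + c * s * s = c"
    using ip_radial_self[OF c assms(1)] by (simp add: ip_def radial_def inner_vec_def i p)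
  have 2: "b $ i * a $ i + c * r * s = 0"
    using assms(2) by (simp add: ip_def radial_def inner_vec_def i p v)
  have c2: "c * c = 1" using c by auto
  have 3: "b $ i = (- c * s * b $ i + c * r * a $ i) * (- c * s)"
  proof -
    have "(- c * s * b $ i + c * r * a $ i) * (- c * s) = (c * c) * (s * s * b $ i - r * s * a $ i)"
      by (simp add: algebra_simps)
    also have "\<dots> = (c * c) * (s * s) * b $ i - c * (c * r * s) * a $ i"
      using c2 by (simp add: algebra_simps)
    also have "(c * c) * (s * s) = c * (c - a $ i * a $ i)"
      unfolding mult.assoc using 1 by (simp add: mult.assoc)
    also have "c * r * s = - (b $ i * a $ i)" using 2 by simp
    also have "c * (c - a $ i * a $ i) * b $ i - c * - (b $ i * a $ i) * a $ i = (c * c) * b $ i"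
      by (simp add: algebra_simps)
    finally show ?thesis by (simp only: c2)
  qed
  have 4: "r = (- c * s * b $ i + c * r * a $ i) * a $ i"
  proof -
    have "(- c * s * b $ i + c * r * a $ i) * a $ i = c * r * (a $ i * a $ i) - c * s * (b $ i * a $ i)"
      by (simp add: algebra_simps)
    also have "a $ i * a $ i = c - c * s * s" using 1 by simp
    also have "b $ i * a $ i = - (c * r * s)" using 2 by simp
    also have "c * r * (c - c * s * s) - c * s * - (c * r * s) = (c * c) * r"
      by (simp add: algebra_simps)
    finally show ?thesis by (simp only: c2)
  qed
  have *: "ip c v (rot c p) = - c * s * b $ i + c * r * a $ i"
    by (simp add: ip_def rot_def inner_vec_def i p v)
  define q where "q = - c * s * b $ i + c * r * a $ i"
  have b: "b $ k = q * (- c * s)" for k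
    using 3 k[of k] by (simp only: q_def)
  have r: "r = q * a $ i" using 4 by (simp only: q_def)
  show ?thesis
    unfolding * q_def[symmetric] using b r by (simp add: p v rot_def vert_def vec_eq_iff i)
qed

end

text \<open>
  The Killing field and the vertical field are parallel along the surface, so the tension field has
  the traced covariant derivatives of the two velocity components as its components.
\<close>

lemma tension_of_curve:
  fixes w :: "real^'n \<Rightarrow> 'n::finite amb" and a b :: "real^'n \<Rightarrow> real"
  assumes c: "c \<in> {1, -1}" and i: "(UNIV :: 'n set) = {i}" and U: "open U" and w: "smooth_on U w"
    and amb: "\<And>y. y \<in> U \<Longrightarrow> w y \<in> ambient c"
    and a: "smooth_on U a" and b: "smooth_on U b"
    and vel: "\<And>y. y \<in> U \<Longrightarrow> pd i w y = a y *\<^sub>R rot c (w y) + b y *\<^sub>R vert"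
    and x: "x \<in> U"
  shows "tan_proj c (w x) (lap G w x)
    = (matrix_inv (G x) $ i $ i * (pd i a x - christoffel G x i i i * a x)) *\<^sub>R rot c (w x)
      + (matrix_inv (G x) $ i $ i * (pd i b x - christoffel G x i i i * b x)) *\<^sub>R vert"
proof -
  note d = smooth_on_imp_differentiable[OF w x] smooth_on_imp_differentiable[OF a x]
    smooth_on_imp_differentiable[OF b x] smooth_on_imp_differentiable[OF smooth_on_rot[OF U w] x]
  have dv: "(\<lambda>y. vert) differentiable (at x)" by simp
  have "pd i (pd i w) x = pd i (\<lambda>y. a y *\<^sub>R rot c (w y) + b y *\<^sub>R vert) x"
    by (rule pd_cong[OF U x vel])
  also have "\<dots> = pd i (\<lambda>y. a y *\<^sub>R rot c (w y)) x + pd i (\<lambda>y. b y *\<^sub>R vert) x"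
    by (rule pd_add) (intro differentiable_scaleR d dv)+
  also have "pd i (\<lambda>y. a y *\<^sub>R rot c (w y)) x = pd i a x *\<^sub>R rot c (w x) + a x *\<^sub>R rot c (pd i w x)"
    using pd_scaleR[OF d(2,4), of i] pd_rot[OF d(1), of i c] by simp
  also have "rot c (pd i w x) = (- c * a x) *\<^sub>R radial (w x)"
  proof -
    have lr: "linear (rot c :: 'n amb \<Rightarrow> 'n amb)" by (rule bounded_linear.linear[OF bounded_linear_rot])
    show ?thesis by (simp add: vel[OF x] linear_add[OF lr] linear_cmul[OF lr] rot_rot[OF c i])
  qed
  also have "pd i (\<lambda>y. b y *\<^sub>R vert) x = pd i b x *\<^sub>R vert"
    using pd_scaleR[OF d(3) dv, of i] by simp
  finally have 2: "pd i (pd i w) x = pd i a x *\<^sub>R rot c (w x) + a x *\<^sub>R (- c * a x) *\<^sub>R radial (w x) + pd i b x *\<^sub>R vert" .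
  have lin: "linear (tan_proj c (w x))" using bounded_linear_tan_proj by (rule bounded_linear.linear)
  have t: "tan_proj c (w x) (radial (w x)) = 0" "tan_proj c (w x) (rot c (w x)) = rot c (w x)"
      "tan_proj c (w x) vert = vert"
    using ip_radial_self[OF c amb[OF x]] ip_rot_radial[OF c i, of "w x"] c
    by (auto simp: tan_proj_def ip_vert)
  have "lap G w x = matrix_inv (G x) $ i $ i *\<^sub>R (pd i (pd i w) x - christoffel G x i i i *\<^sub>R pd i w x)"
    by (simp add: lap_def hess_def i)
  then have "tan_proj c (w x) (lap G w x) = matrix_inv (G x) $ i $ i *\<^sub>R
    (tan_proj c (w x) (pd i (pd i w) x) - christoffel G x i i i *\<^sub>R tan_proj c (w x) (pd i w x))"
    by (simp only: linear_cmul[OF lin] linear_diff[OF lin])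
  moreover have "tan_proj c (w x) (pd i (pd i w) x) = pd i a x *\<^sub>R rot c (w x) + pd i b x *\<^sub>R vert"
    unfolding 2 linear_cmul[OF lin] linear_add[OF lin] t by simp
  moreover have "tan_proj c (w x) (pd i w x) = a x *\<^sub>R rot c (w x) + b x *\<^sub>R vert"
    unfolding vel[OF x] linear_cmul[OF lin] linear_add[OF lin] t by simp
  ultimately show ?thesis by (simp add: algebra_simps)
qed

section \<open>Variations along Killing fields\<close>

lemma hess_add:
  assumes "open U" "smooth_on U u" "smooth_on U v" "x \<in> U"
  shows "hess G (\<lambda>y. u y + v y) x i j = hess G u x i j + hess G v x i j"
proof -
  note d = smooth_on_imp_differentiable[OF assms(2)] smooth_on_imp_differentiable[OF assms(3)]
    smooth_on_imp_differentiable[OF smooth_on_pd[OF assms(2)]] smooth_on_imp_differentiable[OF smooth_on_pd[OF assms(3)]]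
  have 1: "pd k (\<lambda>y. u y + v y) y = pd k u y + pd k v y" if "y \<in> U" for k y
    by (rule pd_add[OF d(1,2)[OF that]])
  have "pd i (pd j (\<lambda>y. u y + v y)) x = pd i (\<lambda>y. pd j u y + pd j v y) x"
    by (rule pd_cong[OF assms(1,4) 1])
  also have "\<dots> = pd i (pd j u) x + pd i (pd j v) x"
    by (rule pd_add[OF d(3,4)[OF assms(4)]])
  finally show ?thesis by (simp add: hess_def 1[OF assms(4)] sum.distrib scaleR_add_right)
qed

lemma lap_add:
  assumes "open U" "smooth_on U u" "smooth_on U v" "x \<in> U"
  shows "lap G (\<lambda>y. u y + v y) x = lap G u x + lap G v x"
  by (simp add: lap_def hess_add[OF assms] sum.distrib scaleR_add_right)

text \<open>
  The pair \<open>gcos\<close>, \<open>gsin\<close> treats the circle (\<open>c = 1\<close>) and the hyperbola (\<open>c = -1\<close>) uniformly.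
\<close>

definition gcos :: "real \<Rightarrow> real \<Rightarrow> real" where "gcos c \<theta> = (if c = 1 then cos \<theta> else cosh \<theta>)"
definition gsin :: "real \<Rightarrow> real \<Rightarrow> real" where "gsin c \<theta> = (if c = 1 then sin \<theta> else sinh \<theta>)"

lemma gcos_0 [simp]: "gcos c 0 = 1" and gsin_0 [simp]: "gsin c 0 = 0"
  by (simp_all add: gcos_def gsin_def)

lemma gcos_deriv: "c \<in> {1, -1} \<Longrightarrow> (gcos c has_real_derivative - c * gsin c \<theta>) (at \<theta>)"
  and gsin_deriv: "(gsin c has_real_derivative gcos c \<theta>) (at \<theta>)"
  by (cases "c = 1"; auto simp: gcos_def[abs_def] gsin_def[abs_def] intro!: derivative_eq_intros)+

lemma gcos_gsin: "c \<in> {1, -1} \<Longrightarrow> (gcos c \<theta>)\<^sup>2 + c * (gsin c \<theta>)\<^sup>2 = 1"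
  by (cases "c = 1") (auto simp: gcos_def gsin_def cosh_square_eq)

lemma smooth_gcos: "c \<in> {1, -1} \<Longrightarrow> smooth_on UNIV (gcos c)"
  and smooth_gsin: "c \<in> {1, -1} \<Longrightarrow> smooth_on UNIV (gsin c)"
proof -
  assume c: "c \<in> {1, -1}"
  let ?F = "range (\<lambda>(a, b) \<theta>. a * gcos c \<theta> + b * gsin c \<theta>)"
  have "\<exists>q'\<in>?F. \<forall>x. (q has_real_derivative q' x) (at x)" if "q \<in> ?F" for q
  proof -
    obtain a b where q: "q = (\<lambda>\<theta>. a * gcos c \<theta> + b * gsin c \<theta>)" using \<open>q \<in> ?F\<close> by auto
    have "(q has_real_derivative b * gcos c x + (- a * c) * gsin c x) (at x)" for x
      unfolding q using DERIV_add[OF DERIV_cmult[OF gcos_deriv[OF c]] DERIV_cmult[OF gsin_deriv[of c]], of a b x]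
      by (simp add: algebra_simps)
    moreover have "(\<lambda>x. b * gcos c x + (- a * c) * gsin c x) \<in> ?F"
      by (rule range_eqI[of _ _ "(b, - a * c)"]) simp
    ultimately show ?thesis
      by (intro bexI[of _ "\<lambda>x. b * gcos c x + (- a * c) * gsin c x"] allI)
  qed
  note * = smooth_on_real_family[of ?F, OF this]
  have "(\<lambda>\<theta>. 1 * gcos c \<theta> + 0 * gsin c \<theta>) \<in> ?F" "(\<lambda>\<theta>. 0 * gcos c \<theta> + 1 * gsin c \<theta>) \<in> ?F"
    by (rule range_eqI[of _ _ "(1, 0)"], simp, rule range_eqI[of _ _ "(0, 1)"], simp)
  then show "smooth_on UNIV (gcos c)" "smooth_on UNIV (gsin c)"
    using *[of "\<lambda>\<theta>. 1 * gcos c \<theta> + 0 * gsin c \<theta>"] *[of "\<lambda>\<theta>. 0 * gcos c \<theta> + 1 * gsin c \<theta>"] by simp_all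
qed

lemma pd_compose_real:
  fixes q :: "real^'n \<Rightarrow> real"
  assumes "(F has_real_derivative d) (at (q x))" "q differentiable (at x)"
  shows "pd i (\<lambda>y. F (q y)) x = d * pd i q x"
  using has_derivative_pd[OF has_derivative_compose[OF frechet_derivativeD[OF assms(2)]
        assms(1)[unfolded has_field_derivative_def]]] by (simp add: pd_def)

text \<open>
  For a one-element index type, the flow of the Killing field \<open>rot c\<close>.
\<close>

definition turn :: "real \<Rightarrow> real \<Rightarrow> 'n::finite amb \<Rightarrow> 'n amb" where
  "turn c \<theta> p = gcos c \<theta> *\<^sub>R radial p + gsin c \<theta> *\<^sub>R rot c p + snd p *\<^sub>R vert"

lemma turn_0 [simp]: "turn c 0 p = p"
  by (simp add: turn_def radial_eq)

lemma snd_turn: "snd (turn c \<theta> p) = snd p"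
  by (simp add: turn_def)

lemma radial_turn: "radial (turn c \<theta> p) = gcos c \<theta> *\<^sub>R radial p + gsin c \<theta> *\<^sub>R rot c p"
  by (simp add: radial_eq[of "turn c \<theta> p"] snd_turn) (simp add: turn_def)

lemma turn_ambient:
  fixes p :: "'n::finite amb" and i :: 'n
  assumes c: "c \<in> {1, -1}" and i: "(UNIV :: 'n set) = {i}" and p: "p \<in> ambient c"
  shows "turn c \<theta> p \<in> ambient c"
proof -
  let ?q = "turn c \<theta> p"
  have "ip c (radial ?q) (radial ?q) = (gcos c \<theta>)\<^sup>2 * c + (gsin c \<theta>)\<^sup>2"
    using ip_radial_self[OF c p] ip_rot_radial[OF c i, of p] ip_rot_rot[OF c i p]
    by (simp add: radial_turn ip_simps ip_commute[of c "radial p" "rot c p"] power2_eq_square)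
  also have "\<dots> = c * ((gcos c \<theta>)\<^sup>2 + c * (gsin c \<theta>)\<^sup>2)" using c by (auto simp: algebra_simps)
  finally have q: "ip c (radial ?q) (radial ?q) = c" by (simp add: gcos_gsin[OF c])
  show ?thesis
  proof (cases "c = 1")
    case True
    then have "fst ?q \<bullet> fst ?q = 1"
      using q by (cases ?q, cases "fst ?q") (auto simp: ip_def radial_def)
    then show ?thesis using True
      by (cases ?q) (auto simp: ambient_def space_form_def norm_eq_1)
  next
    case False
    then have c1: "c = -1" using c by auto
    obtain a s t where pa: "p = ((a, s), t)" by (metis surj_pair)
    have s: "s\<^sup>2 = a $ i * a $ i + 1" "s > 0"
      using p c1 by (auto simp: pa ambient_def space_form_def inner_vec_def i)
    \<comment> \<open>the flow preserves the upper sheet: \<open>s cosh \<theta>\<close> dominates \<open>a sinh \<theta>\<close>\<close>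
    have "\<bar>a $ i\<bar> < s"
      by (rule power2_less_imp_less) (use s in \<open>auto simp: power2_eq_square\<close>)
    moreover have "\<bar>sinh \<theta>\<bar> < cosh \<theta>"
      by (rule power2_less_imp_less) (use cosh_square_eq[of \<theta>] in \<open>auto\<close>)
    ultimately have "\<bar>sinh \<theta>\<bar> * \<bar>a $ i\<bar> < cosh \<theta> * s"
      by (intro mult_strict_mono') auto
    then have "cosh \<theta> * s + sinh \<theta> * a $ i > 0"
      unfolding abs_mult[symmetric] by linarith
    moreover have "snd (fst ?q) = cosh \<theta> * s + sinh \<theta> * a $ i"
      by (simp add: turn_def pa radial_def rot_def vert_def gcos_def gsin_def c1 i)
    ultimately have "snd (fst ?q) > 0" by simp
    moreover have "fst (fst ?q) \<bullet> fst (fst ?q) - (snd (fst ?q))\<^sup>2 = -1"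
      using q by (simp add: c1 ip_def radial_def power2_eq_square)
    ultimately have "fst ?q \<in> space_form c" using c1 by (simp add: space_form_def case_prod_beta)
    then show ?thesis by (simp add: ambient_def mem_Times_iff)
  qed
qed

lemma smooth_on_turn:
  assumes "c \<in> {1, -1}" "open S" "smooth_on S \<theta>" "smooth_on S u"
  shows "smooth_on S (\<lambda>x. turn c (\<theta> x) (u x))"
  unfolding turn_def
  by (intro smooth_on_add smooth_on_scaleR smooth_on_radial smooth_on_rot smooth_on_snd smooth_on_const
      smooth_on_compose[OF assms(2) _ assms(3) smooth_gcos] smooth_on_compose[OF assms(2) _ assms(3) smooth_gsin]
      assms) simp_all

context local_immersion
begin

lemma pd_snd_u: "x \<in> U \<Longrightarrow> pd i (\<lambda>y. snd (u y)) x = snd (pd i u x)"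
  by (rule pd_snd[OF diff_u])

lemma smooth_tension: "smooth_on U (\<lambda>x. tan_proj c (u x) (lap G u x))"
  unfolding tan_proj_def
  by (intro smooth_on_diff smooth_on_scaleR smooth_on_mult smooth_on_const smooth_on_ip smooth_lap
      smooth_on_radial smooth_u open_U)

lemma vertical_tension:
  assumes x: "x \<in> U" and \<phi>: "smooth_on U \<phi>"
  shows "tan_proj c (u x + (t * \<phi> x) *\<^sub>R vert) (lap G (\<lambda>y. u y + (t * \<phi> y) *\<^sub>R vert) x)
    = tan_proj c (u x) (lap G u x) + (t * lap G \<phi> x) *\<^sub>R vert"
proof -
  have L: "bounded_linear (\<lambda>r. (t * r) *\<^sub>R (vert :: 'n amb))"
    by (intro bounded_linear_scaleR_const bounded_linear_const_mult bounded_linear_ident)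
  have "lap G (\<lambda>y. u y + (t * \<phi> y) *\<^sub>R vert) x = lap G u x + (t * lap G \<phi> x) *\<^sub>R vert"
    using lap_add[OF open_U smooth_u smooth_on_linear[OF L open_U \<phi>] x] lap_linear[OF L \<phi> open_U x] by simp
  moreover have "radial (u x + (t * \<phi> x) *\<^sub>R vert) = radial (u x)"
    by (simp add: radial_eq algebra_simps)
  ultimately show ?thesis
    by (simp add: tan_proj_def ip_simps ip_vert)
qed

text \<open>
  Exactness in \<open>t\<close> makes the bienergy of the variation a polynomial in \<open>t\<close>.
\<close>

lemma vertical_energy_density:
  fixes t :: real
  assumes x: "x \<in> U" and \<phi>: "smooth_on U \<phi>"
  defines "\<tau> \<equiv> tan_proj c (u x) (lap G u x)"
    and "\<tau>' \<equiv> tan_proj c (u x + (t * \<phi> x) *\<^sub>R vert) (lap G (\<lambda>y. u y + (t * \<phi> y) *\<^sub>R vert) x)"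
  shows "ip c \<tau>' \<tau>' = ip c \<tau> \<tau> + 2 * t * (lap G (\<lambda>y. snd (u y)) x * lap G \<phi> x) + t\<^sup>2 * (lap G \<phi> x)\<^sup>2"
proof -
  have "snd \<tau> = lap G (\<lambda>y. snd (u y)) x"
    unfolding \<tau>_def by (simp add: tan_proj_def lap_linear[OF bounded_linear_snd smooth_u open_U x])
  then show ?thesis
    unfolding \<tau>'_def vertical_tension[OF x \<phi>] \<tau>_def[symmetric]
    by (simp add: ip_simps ip_vert power2_eq_square algebra_simps)
qed

context
  fixes i :: 'n
  assumes i: "(UNIV :: 'n set) = {i}"
begin

definition ang_vel :: "real^'n \<Rightarrow> real" where "ang_vel x = ip c (pd i u x) (rot c (u x))"

definition ang_acc :: "real^'n \<Rightarrow> real" where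
  "ang_acc x = gi x i i * (pd i ang_vel x - christoffel G x i i i * ang_vel x)"

lemma smooth_ang_vel: "smooth_on U ang_vel"
  unfolding ang_vel_def[abs_def] by (intro smooth_on_ip smooth_on_pd smooth_on_rot smooth_u open_U)

lemma smooth_ang_acc: "smooth_on U ang_acc"
  unfolding ang_acc_def[abs_def]
  by (intro smooth_on_mult smooth_on_diff smooth_gi smooth_on_pd smooth_ang_vel smooth_christoffel open_U)

lemma velocity:
  assumes x: "x \<in> U"
  shows "pd i u x = ang_vel x *\<^sub>R rot c (u x) + pd i (\<lambda>y. snd (u y)) x *\<^sub>R vert"
  using tangent_rot[OF c i u_ambient[OF x] pd_u_radial[OF _ x]] x by (simp add: ang_vel_def pd_snd_u)

lemma lap_curve: "lap G q x = gi x i i *\<^sub>R (pd i (pd i q) x - christoffel G x i i i *\<^sub>R pd i q x)"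
  by (simp add: lap_def hess_def i)

text \<open>
  The flow rotates the curve and its Killing field simultaneously. In the rotating frame it only
  adds \<open>t \<phi>'\<close> to the angular velocity, hence \<open>t \<Delta>\<phi>\<close> to the angular acceleration.
\<close>

lemma turned_tension:
  fixes t :: real
  assumes x: "x \<in> U" and \<phi>: "smooth_on U \<phi>"
  defines "w \<equiv> \<lambda>y. turn c (t * \<phi> y) (u y)"
  shows "tan_proj c (w x) (lap G w x) = (ang_acc x + t * lap G \<phi> x) *\<^sub>R rot c (w x)
    + lap G (\<lambda>y. snd (u y)) x *\<^sub>R vert"
proof -
  have s\<phi>: "smooth_on U (\<lambda>y. t * \<phi> y)" by (intro smooth_on_mult smooth_on_const \<phi> open_U)
  have w: "smooth_on U w" unfolding w_def by (rule smooth_on_turn[OF c open_U s\<phi> smooth_u])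
  have amb: "w y \<in> ambient c" if "y \<in> U" for y
    unfolding w_def by (rule turn_ambient[OF c i u_ambient[OF that]])
  have sa: "smooth_on U (\<lambda>y. ang_vel y + t * pd i \<phi> y)"
    by (intro smooth_on_add smooth_ang_vel smooth_on_mult smooth_on_const smooth_on_pd \<phi> open_U)
  have ssn: "smooth_on U (\<lambda>y. snd (u y))" by (rule smooth_on_snd[OF open_U smooth_u])
  have vel: "pd i w y = (ang_vel y + t * pd i \<phi> y) *\<^sub>R rot c (w y) + pd i (\<lambda>y. snd (u y)) y *\<^sub>R vert"
    if y: "y \<in> U" for y
  proof -
    note d = smooth_on_imp_differentiable[OF s\<phi> y]
      smooth_on_imp_differentiable[OF smooth_on_compose[OF open_U _ s\<phi> smooth_gcos[OF c]] y]
      smooth_on_imp_differentiable[OF smooth_on_compose[OF open_U _ s\<phi> smooth_gsin[OF c]] y]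
      smooth_on_imp_differentiable[OF smooth_on_radial[OF open_U smooth_u] y]
      smooth_on_imp_differentiable[OF smooth_on_rot[OF open_U smooth_u] y]
      smooth_on_imp_differentiable[OF ssn y]
    let ?\<theta> = "t * \<phi> y"
    have dt: "pd i (\<lambda>y. t * \<phi> y) y = t * pd i \<phi> y"
      by (rule pd_cmult[OF smooth_on_imp_differentiable[OF \<phi> y]])
    have lr: "linear (rot c :: 'n amb \<Rightarrow> 'n amb)" by (rule bounded_linear.linear[OF bounded_linear_rot])
    have dv: "(\<lambda>y. vert) differentiable (at y)" by simp
    have 1: "pd i (\<lambda>y. gcos c (t * \<phi> y) *\<^sub>R radial (u y)) y
        = (- c * gsin c ?\<theta> * (t * pd i \<phi> y)) *\<^sub>R radial (u y) + gcos c ?\<theta> *\<^sub>R radial (pd i u y)"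
      using pd_scaleR[OF d(2)[OF subset_UNIV] d(4), of i]
        pd_compose_real[OF gcos_deriv[OF c] d(1), of i] dt pd_radial[OF diff_u[OF y]] by simp
    have 2: "pd i (\<lambda>y. gsin c (t * \<phi> y) *\<^sub>R rot c (u y)) y
        = (gcos c ?\<theta> * (t * pd i \<phi> y)) *\<^sub>R rot c (u y) + gsin c ?\<theta> *\<^sub>R rot c (pd i u y)"
      using pd_scaleR[OF d(3)[OF subset_UNIV] d(5), of i]
        pd_compose_real[OF gsin_deriv d(1), of i c] dt pd_rot[OF diff_u[OF y]] by simp
    have 3: "pd i (\<lambda>y. snd (u y) *\<^sub>R vert) y = pd i (\<lambda>y. snd (u y)) y *\<^sub>R vert"
      using pd_scaleR[OF d(6) dv, of i] by simp
    have "pd i w y = pd i (\<lambda>y. gcos c (t * \<phi> y) *\<^sub>R radial (u y)) y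
        + pd i (\<lambda>y. gsin c (t * \<phi> y) *\<^sub>R rot c (u y)) y + pd i (\<lambda>y. snd (u y) *\<^sub>R vert) y"
    proof -
      have e: "(\<lambda>y. gcos c (t * \<phi> y) *\<^sub>R radial (u y)) differentiable (at y)"
        "(\<lambda>y. gsin c (t * \<phi> y) *\<^sub>R rot c (u y)) differentiable (at y)"
        "(\<lambda>y. snd (u y) *\<^sub>R (vert :: 'n amb)) differentiable (at y)"
        by (intro differentiable_scaleR d subset_UNIV dv)+
      show ?thesis
        unfolding w_def turn_def
        using pd_add[OF differentiable_add[OF e(1,2)] e(3), of i] pd_add[OF e(1,2), of i] by simp
    qed
    also have "\<dots> = (- c * gsin c ?\<theta> * (t * pd i \<phi> y)) *\<^sub>R radial (u y) + gcos c ?\<theta> *\<^sub>R ang_vel y *\<^sub>R rot c (u y)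
       + ((gcos c ?\<theta> * (t * pd i \<phi> y)) *\<^sub>R rot c (u y) + gsin c ?\<theta> *\<^sub>R (ang_vel y *\<^sub>R (- c *\<^sub>R radial (u y))))
       + pd i (\<lambda>y. snd (u y)) y *\<^sub>R vert"
      unfolding 1 2 3 by (simp add: velocity[OF y] radial_eq[of "_ + _"] linear_add[OF lr] linear_cmul[OF lr]
          rot_rot[OF c i])
    finally have 4: "pd i w y = \<dots>" .
    have 5: "rot c (w y) = gcos c ?\<theta> *\<^sub>R rot c (u y) + gsin c ?\<theta> *\<^sub>R (- c *\<^sub>R radial (u y))"
      by (simp add: w_def turn_def linear_add[OF lr] linear_cmul[OF lr] rot_rot[OF c i])
    show ?thesis unfolding 4 5 by (simp add: algebra_simps)
  qed
  have A: "gi x i i * (pd i (\<lambda>y. ang_vel y + t * pd i \<phi> y) x - christoffel G x i i i * (ang_vel x + t * pd i \<phi> x))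
      = ang_acc x + t * lap G \<phi> x"
  proof -
    note d = smooth_on_imp_differentiable[OF smooth_ang_vel x]
      smooth_on_imp_differentiable[OF smooth_on_pd[OF \<phi>] x]
    have "pd i (\<lambda>y. ang_vel y + t * pd i \<phi> y) x = pd i ang_vel x + t * pd i (pd i \<phi>) x"
      using pd_add[OF d(1) differentiable_mult[OF differentiable_const d(2)]] pd_cmult[OF d(2)] by simp
    then show ?thesis by (simp add: ang_acc_def lap_curve algebra_simps)
  qed
  have B: "gi x i i * (pd i (pd i (\<lambda>y. snd (u y))) x - christoffel G x i i i * pd i (\<lambda>y. snd (u y)) x)
      = lap G (\<lambda>y. snd (u y)) x"
    by (simp add: lap_curve)
  show ?thesis
    using tension_of_curve[OF c i open_U w amb sa smooth_on_pd[OF ssn] vel x, where G = G] unfolding A B .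
qed

lemma turned_energy_density:
  fixes t :: real
  assumes x: "x \<in> U" and \<phi>: "smooth_on U \<phi>"
  defines "w \<equiv> \<lambda>y. turn c (t * \<phi> y) (u y)"
  shows "ip c (tan_proj c (w x) (lap G w x)) (tan_proj c (w x) (lap G w x))
    = ((ang_acc x)\<^sup>2 + (lap G (\<lambda>y. snd (u y)) x)\<^sup>2) + 2 * t * (ang_acc x * lap G \<phi> x) + t\<^sup>2 * (lap G \<phi> x)\<^sup>2"
proof -
  have "ip c (rot c (w x)) (rot c (w x)) = 1"
    unfolding w_def by (rule ip_rot_rot[OF c i turn_ambient[OF c i u_ambient[OF x]]])
  then show ?thesis
    unfolding w_def turned_tension[OF x \<phi>]
    by (simp add: ip_simps ip_vert power2_eq_square algebra_simps)
qed

lemma curve_biharmonic_imp_tension_eq_0: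
  assumes harm: "\<And>x. x \<in> U \<Longrightarrow> lap G ang_acc x = 0" "\<And>x. x \<in> U \<Longrightarrow> lap G (lap G (\<lambda>y. snd (u y))) x = 0"
    and x: "x \<in> U"
  shows "tan_proj c (u x) (lap G u x) = 0"
proof -
  have ssn: "smooth_on U (\<lambda>y. snd (u y))" by (rule smooth_on_snd[OF open_U smooth_u])
  have A: "ang_acc = (\<lambda>x. gi x i i * (pd i ang_vel x - christoffel G x i i i * ang_vel x))"
    by (simp add: ang_acc_def fun_eq_iff)
  have B: "lap G (\<lambda>y. snd (u y)) = (\<lambda>x. gi x i i * (pd i (pd i (\<lambda>y. snd (u y))) x
      - christoffel G x i i i * pd i (\<lambda>y. snd (u y)) x))"
    by (simp add: lap_curve fun_eq_iff)
  have unit: "G y $ i $ i = (ang_vel y)\<^sup>2 + (pd i (\<lambda>y. snd (u y)) y)\<^sup>2" if y: "y \<in> U" for y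
    unfolding induced[OF y] 
    by (subst (1 2) velocity[OF y]) (simp add: ip_simps ip_vert ip_rot_rot[OF c i u_ambient[OF y]] power2_eq_square)
  have "ang_acc x = 0 \<and> lap G (\<lambda>y. snd (u y)) x = 0"
    by (rule one_dimensional_biharmonic[OF i smooth_ang_vel smooth_on_pd[OF ssn] unit
          A B harm x])
  then show ?thesis
    using turned_tension[OF x smooth_on_const[of U 0], of 0] by simp
qed

end

end

section \<open>Biharmonic hypersurfaces\<close>

locale isometric_hypersurface = riemannian_manifold \<A> g vol
  for \<A> :: "('a::{t2_space, second_countable_topology}, 'n::finite) chart set"
    and g :: "('a, 'n) metric" and vol :: "'a measure" +
  fixes c :: real and f :: "'a \<Rightarrow> 'n amb"
  assumes c: "c \<in> {1, -1}" and immersion: "isometric_immersion \<A> g c f"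
begin

lemma smooth_f: "smooth_map \<A> f" and f_ambient: "f p \<in> ambient c"
  using immersion by (auto simp: isometric_immersion_def)

lemma smooth_in_chart: "smooth_map \<A> u \<Longrightarrow> \<kappa> \<in> \<A> \<Longrightarrow> smooth_on (cod \<kappa>) (u \<circ> param \<kappa>)"
  by (simp add: smooth_map_def)

lemma chart_immersion:
  assumes "\<kappa> \<in> \<A>" shows "local_immersion (cod \<kappa>) (g \<kappa>) c (f \<circ> param \<kappa>)"
proof -
  interpret local_metric "cod \<kappa>" "g \<kappa>" by (rule chart_metric[OF assms])
  show ?thesis
    by unfold_locales
      (use c smooth_in_chart[OF smooth_f assms] f_ambient immersion assms in \<open>auto simp: isometric_immersion_def\<close>)
qed

text \<open>
  Under a change of coordinates, the Hessian of any map \<open>v\<close> transforms as a tensor up to a first-order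
  term \<open>\<Sum>\<^sub>a C\<^sub>i\<^sub>j\<^sub>a \<partial>\<^sub>a v\<close>, whose coefficients \<open>C\<close> do not depend on \<open>v\<close>. For \<open>v = f\<close> all terms but
  this one are normal to the hypersurface by \<open>gauss_tangential\<close>, so it vanishes; as the \<open>\<partial>\<^sub>a f\<close> are
  independent, \<open>C = 0\<close>, which is the transformation law of the Christoffel symbols.
\<close>

lemma lap_chart_independent:
  fixes u :: "'a \<Rightarrow> 'b::real_normed_vector"
  assumes u: "smooth_map \<A> u" and \<kappa>: "\<kappa> \<in> \<A>" "\<kappa>' \<in> \<A>" and p: "p \<in> dom \<kappa>" "p \<in> dom \<kappa>'"
  shows "lap (g \<kappa>) (u \<circ> param \<kappa>) (coord \<kappa> p) = lap (g \<kappa>') (u \<circ> param \<kappa>') (coord \<kappa>' p)"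
proof -
  interpret I: local_immersion "cod \<kappa>" "g \<kappa>" c "f \<circ> param \<kappa>" by (rule chart_immersion[OF \<kappa>(1)])
  interpret I': local_immersion "cod \<kappa>'" "g \<kappa>'" c "f \<circ> param \<kappa>'" by (rule chart_immersion[OF \<kappa>(2)])
  define N where "N = coord \<kappa> ` (dom \<kappa> \<inter> dom \<kappa>')"
  define \<psi> where "\<psi> = coord \<kappa>' \<circ> param \<kappa>"
  define x where "x = coord \<kappa> p"
  define y where "y = coord \<kappa>' p"
  have N: "open N" unfolding N_def by (rule open_overlap[OF \<kappa>])
  have xN: "x \<in> N" using p by (simp add: N_def x_def)
  have NU: "N \<subseteq> cod \<kappa>" using coord_in_cod[OF \<kappa>(1)] by (auto simp: N_def)
  have xU: "x \<in> cod \<kappa>" and yU: "y \<in> cod \<kappa>'"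
    using p coord_in_cod \<kappa> by (auto simp: x_def y_def)
  have \<psi>x: "\<psi> x = y" by (simp add: \<psi>_def x_def y_def param_coord[OF \<kappa>(1) p(1)])
  have \<psi>N: "\<psi> z \<in> cod \<kappa>'" "param \<kappa>' (\<psi> z) = param \<kappa> z" if "z \<in> N" for z
    using that coord_in_cod[OF \<kappa>(2)] param_coord[OF \<kappa>(1)] param_coord[OF \<kappa>(2)]
    by (auto simp: N_def \<psi>_def)
  have sm\<psi>: "smooth_on N \<psi>" unfolding N_def \<psi>_def by (rule smooth_transition[OF \<kappa>])
  define J where "J z i a = pd i \<psi> z $ a" for z i a
  define C where "C i j a = pd i (\<lambda>z. J z j a) x
      + (\<Sum>d\<in>UNIV. \<Sum>b\<in>UNIV. J x j d * J x i b * christoffel (g \<kappa>') y a b d)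
      - (\<Sum>k\<in>UNIV. christoffel (g \<kappa>) x k i j * J x k a)" for i j a
  have smJ: "smooth_on N (\<lambda>z. J z i a)" for i a
    unfolding J_def by (intro smooth_on_vec_nth N smooth_on_pd sm\<psi>)
  have hess_transform: "hess (g \<kappa>) (v \<circ> param \<kappa>) x i j
      = (\<Sum>a\<in>UNIV. C i j a *\<^sub>R pd a (v \<circ> param \<kappa>') y)
        + (\<Sum>a\<in>UNIV. \<Sum>b\<in>UNIV. (J x j a * J x i b) *\<^sub>R hess (g \<kappa>') (v \<circ> param \<kappa>') y b a)"
    if v: "smooth_map \<A> v" for v :: "'a \<Rightarrow> 'd::real_normed_vector" and i j
  proof -
    let ?v = "v \<circ> param \<kappa>" and ?v' = "v \<circ> param \<kappa>'"
    have sv': "smooth_on (cod \<kappa>') ?v'" by (rule smooth_in_chart[OF v \<kappa>(2)])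
    have dv': "?v' differentiable (at (\<psi> z))" "pd a ?v' differentiable (at (\<psi> z))" if "z \<in> N" for z a
      using smooth_on_imp_differentiable[OF sv'] smooth_on_imp_differentiable[OF smooth_on_pd[OF sv']] \<psi>N that
      by auto
    have d\<psi>: "\<psi> differentiable (at z)" if "z \<in> N" for z
      by (rule smooth_on_imp_differentiable[OF sm\<psi> that])
    have 1: "pd k ?v z = (\<Sum>a\<in>UNIV. J z k a *\<^sub>R pd a ?v' (\<psi> z))" if z: "z \<in> N" for z k
    proof -
      have "pd k ?v z = pd k (\<lambda>z. ?v' (\<psi> z)) z"
        by (rule pd_cong[OF N z]) (simp add: \<psi>N)
      then show ?thesis by (simp only: pd_chain[OF d\<psi>[OF z] dv'(1)[OF z]] J_def)
    qed
    have dJ: "(\<lambda>z. J z k a) differentiable (at x)" for k a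
      by (rule smooth_on_imp_differentiable[OF smJ xN])
    have dc: "(\<lambda>z. pd a ?v' (\<psi> z)) differentiable (at x)" for a
      using differentiable_compose[of "pd a ?v'" \<psi> x UNIV] dv'(2)[OF xN] d\<psi>[OF xN] by simp
    have "pd i (pd j ?v) x = pd i (\<lambda>z. \<Sum>a\<in>UNIV. J z j a *\<^sub>R pd a ?v' (\<psi> z)) x"
      by (rule pd_cong[OF N xN 1])
    also have "\<dots> = (\<Sum>a\<in>UNIV. pd i (\<lambda>z. J z j a *\<^sub>R pd a ?v' (\<psi> z)) x)"
      by (rule pd_sum) (rule differentiable_scaleR[OF dJ dc])
    also have "\<dots> = (\<Sum>a\<in>UNIV. pd i (\<lambda>z. J z j a) x *\<^sub>R pd a ?v' y
        + J x j a *\<^sub>R (\<Sum>b\<in>UNIV. J x i b *\<^sub>R pd b (pd a ?v') y))"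
      by (simp only: pd_scaleR[OF dJ dc] pd_chain[OF d\<psi>[OF xN] dv'(2)[OF xN]] J_def[symmetric] \<psi>x)
    finally have 2: "pd i (pd j ?v) x = (\<Sum>a\<in>UNIV. pd i (\<lambda>z. J z j a) x *\<^sub>R pd a ?v' y)
        + (\<Sum>a\<in>UNIV. \<Sum>b\<in>UNIV. (J x j a * J x i b) *\<^sub>R pd b (pd a ?v') y)"
      by (simp add: sum.distrib scaleR_sum_right)
    have 3: "(\<Sum>k\<in>UNIV. christoffel (g \<kappa>) x k i j *\<^sub>R pd k ?v x)
        = (\<Sum>a\<in>UNIV. (\<Sum>k\<in>UNIV. christoffel (g \<kappa>) x k i j * J x k a) *\<^sub>R pd a ?v' y)"
      by (subst 1[OF xN], simp add: scaleR_sum_right scaleR_sum_left \<psi>x) (rule sum.swap)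
    let ?L = "(\<Sum>d\<in>UNIV. \<Sum>b\<in>UNIV. (J x j d * J x i b) *\<^sub>R (\<Sum>a\<in>UNIV. christoffel (g \<kappa>') y a b d *\<^sub>R pd a ?v' y))"
    let ?D = "\<lambda>d b a. (J x j d * J x i b * christoffel (g \<kappa>') y a b d) *\<^sub>R pd a ?v' y"
    have "?L
        = (\<Sum>d\<in>UNIV. \<Sum>b\<in>UNIV. \<Sum>a\<in>UNIV. ?D d b a)"
      by (simp add: scaleR_sum_right)
    also have "\<dots> = (\<Sum>d\<in>UNIV. \<Sum>a\<in>UNIV. \<Sum>b\<in>UNIV. ?D d b a)"
      by (rule sum.cong[OF refl], rule sum.swap)
    also have "\<dots> = (\<Sum>a\<in>UNIV. \<Sum>d\<in>UNIV. \<Sum>b\<in>UNIV. ?D d b a)"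
      by (rule sum.swap)
    finally have 4: "?L
        = (\<Sum>a\<in>UNIV. (\<Sum>d\<in>UNIV. \<Sum>b\<in>UNIV. J x j d * J x i b * christoffel (g \<kappa>') y a b d) *\<^sub>R pd a ?v' y)"
      by (simp add: scaleR_sum_left)
    show ?thesis
      unfolding hess_def 2 3 C_def
      by (simp add: scaleR_diff_right sum_subtractf 4 scaleR_add_left scaleR_diff_left sum.distrib)
  qed
  have C0: "C i j a = 0" for i j a
  proof -
    have h: "(\<Sum>a\<in>UNIV. C i j a * g \<kappa>' y $ a $ l) = 0" for l
    proof -
      have t: "ip c (hess (g \<kappa>) (f \<circ> param \<kappa>) x i j) (pd k (f \<circ> param \<kappa>) x) = 0" for k
        by (rule I.gauss_tangential[OF xU])
      have "pd l (f \<circ> param \<kappa>') y = (\<Sum>k\<in>UNIV. pd l (coord \<kappa> \<circ> param \<kappa>') y $ k *\<^sub>R pd k (f \<circ> param \<kappa>) x)"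
      proof -
        let ?N' = "coord \<kappa>' ` (dom \<kappa>' \<inter> dom \<kappa>)"
        have N': "open ?N'" "y \<in> ?N'" using open_overlap[OF \<kappa>(2,1)] p by (auto simp: y_def)
        have "pd l (f \<circ> param \<kappa>') y = pd l (\<lambda>z. (f \<circ> param \<kappa>) ((coord \<kappa> \<circ> param \<kappa>') z)) y"
          by (rule pd_cong[OF N']) (auto simp: param_coord[OF \<kappa>(1)] param_coord[OF \<kappa>(2)])
        moreover have e: "(coord \<kappa> \<circ> param \<kappa>') y = x"
          by (simp add: x_def y_def param_coord[OF \<kappa>(2) p(2)])
        ultimately show ?thesis
          using pd_chain[OF smooth_on_imp_differentiable[OF smooth_transition[OF \<kappa>(2,1)] N'(2)],
              of "f \<circ> param \<kappa>" l] I.diff_u[OF xU] by (simp only: e)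
      qed
      then have "ip c (hess (g \<kappa>) (f \<circ> param \<kappa>) x i j) (pd l (f \<circ> param \<kappa>') y) = 0"
        by (simp add: ip_simps t)
      then show ?thesis
        by (simp add: hess_transform[OF smooth_f] ip_simps I'.gauss_tangential[OF yU] I'.induced[OF yU])
    qed
    have "C i j a = (\<Sum>b\<in>UNIV. C i j b * (\<Sum>l\<in>UNIV. g \<kappa>' y $ b $ l * I'.gi y l a))"
      by (simp add: I'.G_gi[OF yU] if_distrib cong: if_cong)
    also have "\<dots> = (\<Sum>l\<in>UNIV. (\<Sum>b\<in>UNIV. C i j b * g \<kappa>' y $ b $ l) * I'.gi y l a)"
      by (simp add: sum_distrib_left sum_distrib_right mult.assoc) (rule sum.swap)
    finally show ?thesis by (simp add: h)
  qed
  define M where "M = jacobian \<psi> (at x)"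
  have M: "M $ a $ i = J x i a" for a i
    by (simp add: M_def jacobian_def matrix_def J_def pd_def)
  have "g \<kappa> x = transpose M ** g \<kappa>' y ** M"
    using metric[unfolded riemannian_metric_def, THEN conjunct2, rule_format, OF \<kappa>, of p] p
    by (simp only: Let_def M_def \<psi>_def x_def y_def Int_iff)
  then have eq: "transpose M ** (g \<kappa>' y ** M) = g \<kappa> x" by (simp add: matrix_mul_assoc)

  have inv': "M ** matrix_inv (g \<kappa> x) ** transpose M = matrix_inv (g \<kappa>' y)"
  proof -

    have "transpose M ** (g \<kappa>' y ** (M ** matrix_inv (g \<kappa> x))) = mat 1"
      using matrix_inv_right[OF I.det_G_nz[OF xU]] eq by (simp add: matrix_mul_assoc)
    then have "(g \<kappa>' y ** (M ** matrix_inv (g \<kappa> x))) ** transpose M = mat 1"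
      by (simp only: matrix_left_right_inverse)
    then have "matrix_inv (g \<kappa>' y) ** (g \<kappa>' y ** (M ** matrix_inv (g \<kappa> x) ** transpose M)) = matrix_inv (g \<kappa>' y)"
      by (simp add: matrix_mul_assoc)
    then show ?thesis
      using matrix_inv_left[OF I'.det_G_nz[OF yU]] by (simp add: matrix_mul_assoc)
  qed
  have contract: "(\<Sum>i\<in>UNIV. \<Sum>j\<in>UNIV. I.gi x i j * (J x j a * J x i b)) = I'.gi y b a" for a b
  proof -
    have "I'.gi y b a = (\<Sum>j\<in>UNIV. (\<Sum>i\<in>UNIV. J x i b * I.gi x i j) * J x j a)"
      unfolding inv'[symmetric] by (simp add: matrix_matrix_mult_def transpose_def M)
    also have "\<dots> = (\<Sum>i\<in>UNIV. \<Sum>j\<in>UNIV. I.gi x i j * (J x j a * J x i b))"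
      by (subst sum.swap) (simp add: sum_distrib_left sum_distrib_right mult_ac)
    finally show ?thesis by simp
  qed
  let ?T = "\<lambda>i j a b. (I.gi x i j * (J x j a * J x i b)) *\<^sub>R hess (g \<kappa>') (u \<circ> param \<kappa>') y b a"
  have "lap (g \<kappa>) (u \<circ> param \<kappa>) x = (\<Sum>i\<in>UNIV. \<Sum>j\<in>UNIV. \<Sum>a\<in>UNIV. \<Sum>b\<in>UNIV. ?T i j a b)"
    by (simp add: lap_def hess_transform[OF u] C0 scaleR_sum_right)
  also have "\<dots> = (\<Sum>i\<in>UNIV. \<Sum>a\<in>UNIV. \<Sum>j\<in>UNIV. \<Sum>b\<in>UNIV. ?T i j a b)"
    by (rule sum.cong[OF refl], rule sum.swap)
  also have "\<dots> = (\<Sum>a\<in>UNIV. \<Sum>i\<in>UNIV. \<Sum>b\<in>UNIV. \<Sum>j\<in>UNIV. ?T i j a b)"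
    by (subst sum.swap) (rule sum.cong[OF refl], rule sum.cong[OF refl], rule sum.swap)
  also have "\<dots> = (\<Sum>a\<in>UNIV. \<Sum>b\<in>UNIV. \<Sum>i\<in>UNIV. \<Sum>j\<in>UNIV. ?T i j a b)"
    by (rule sum.cong[OF refl], rule sum.swap)
  also have "\<dots> = (\<Sum>a\<in>UNIV. \<Sum>b\<in>UNIV. I'.gi y b a *\<^sub>R hess (g \<kappa>') (u \<circ> param \<kappa>') y b a)"
    by (simp add: contract[symmetric] scaleR_sum_left)
  also have "\<dots> = lap (g \<kappa>') (u \<circ> param \<kappa>') y"
    unfolding lap_def by (rule sum.swap)
  finally show ?thesis by (simp add: x_def y_def)
qed

lemma tension_in_chart:
  assumes u: "smooth_map \<A> u" "\<And>p. u p \<in> ambient c" and \<kappa>: "\<kappa> \<in> \<A>" and p: "p \<in> dom \<kappa>"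
  shows "tension \<A> g c u p = tan_proj c (u p) (lap (g \<kappa>) (u \<circ> param \<kappa>) (coord \<kappa> p))"
proof -
  let ?\<kappa> = "chart_at \<A> p"
  have "tension \<A> g c u p = tan_proj c ((u \<circ> param ?\<kappa>) (coord ?\<kappa> p)) (lap (g ?\<kappa>) (u \<circ> param ?\<kappa>) (coord ?\<kappa> p))"
    unfolding tension_def Let_def
    by (rule tension_coord_lap[OF c open_cod[OF chart_at(1)] smooth_in_chart[OF u(1) chart_at(1)]])
      (use u(2) coord_in_cod[OF chart_at] in auto)
  then show ?thesis
    using lap_chart_independent[OF u(1) \<kappa> chart_at(1) p chart_at(2)]
    by (simp add: param_coord[OF chart_at])
qed

text \<open>
  The bienergy of the varied map is a quadratic polynomial in \<open>t\<close>; the integral in question is its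
  linear coefficient.
\<close>

lemma first_variation:
  assumes bih: "biharmonic \<A> g vol c f" and \<kappa>: "\<kappa> \<in> \<A>" and r: "cball x0 r \<subseteq> cod \<kappa>"
    and var: "smooth_variation \<A> c f (param \<kappa> ` cball x0 r) \<epsilon> F"
    and cont: "continuous_on (cball x0 r) N" "continuous_on (cball x0 r) b" "continuous_on (cball x0 r) L"
    and density: "\<And>t x. \<bar>t\<bar> < \<epsilon> \<Longrightarrow> x \<in> cball x0 r \<Longrightarrow>
      ip c (tan_proj c (F t (param \<kappa> x)) (lap (g \<kappa>) (F t \<circ> param \<kappa>) x))
           (tan_proj c (F t (param \<kappa> x)) (lap (g \<kappa>) (F t \<circ> param \<kappa>) x))
        = N x + 2 * t * (b x * L x) + t\<^sup>2 * (L x)\<^sup>2"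
  shows "(LINT x:cball x0 r|lborel. local_metric.dens (g \<kappa>) x * (b x * L x)) = 0"
proof -
  interpret local_metric "cod \<kappa>" "g \<kappa>" by (rule chart_metric[OF \<kappa>])
  let ?B = "cball x0 r"
  let ?K = "param \<kappa> ` ?B"
  have eps: "\<epsilon> > 0" using var by (simp add: smooth_variation_def)
  have amb: "F t p \<in> ambient c" if "\<bar>t\<bar> < \<epsilon>" for t p
  proof -
    have "t \<in> {-\<epsilon><..<\<epsilon>}" using that by auto
    then show ?thesis using var unfolding smooth_variation_def by blast
  qed
  have smF: "smooth_map \<A> (F t)" if t: "\<bar>t\<bar> < \<epsilon>" for t
    unfolding smooth_map_def
  proof
    fix \<kappa>' assume \<kappa>': "\<kappa>' \<in> \<A>"
    have "smooth_on (cod \<kappa>') (\<lambda>x. (\<lambda>(t, x). F t (param \<kappa>' x)) (t, x))"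
    proof (rule smooth_on_compose[OF open_cod[OF \<kappa>'], where \<psi> = "Pair t"
          and \<phi> = "\<lambda>(t, x). F t (param \<kappa>' x)"])
      show "smooth_on ({-\<epsilon><..<\<epsilon>} \<times> cod \<kappa>') (\<lambda>(t, x). F t (param \<kappa>' x))"
        using var \<kappa>' by (simp add: smooth_variation_def)
      show "smooth_on (cod \<kappa>') (Pair t)"
        by (intro smooth_on_Pair open_cod \<kappa>' smooth_on_const smooth_on_bounded_linear bounded_linear_ident)
    qed (use t in auto)
    then show "smooth_on (cod \<kappa>') (F t \<circ> param \<kappa>')" by (simp add: comp_def)
  qed
  have cd: "continuous_on ?B dens"
    by (rule continuous_on_subset[OF smooth_on_imp_continuous_on[OF smooth_dens] r])
  have int: "set_integrable lborel ?B q" if "continuous_on ?B q" for q :: "real^'n \<Rightarrow> real"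
    unfolding set_integrable_def by (rule borel_integrable_compact[OF compact_cball that])
  define I0 where "I0 = (LINT x:?B|lborel. dens x * N x)"
  define I1 where "I1 = (LINT x:?B|lborel. dens x * (b x * L x))"
  define I2 where "I2 = (LINT x:?B|lborel. dens x * (L x)\<^sup>2)"
  have en: "bienergy \<A> g vol c ?K (F t) = 1/2 * (I0 + (2 * t) * I1 + t\<^sup>2 * I2)" if t: "\<bar>t\<bar> < \<epsilon>" for t
  proof -
    define e where "e p = ip c (tension \<A> g c (F t) p) (tension \<A> g c (F t) p)" for p
    have e: "e (param \<kappa> x) = N x + 2 * t * (b x * L x) + t\<^sup>2 * (L x)\<^sup>2" if x: "x \<in> ?B" for x
    proof -
      have xU: "x \<in> cod \<kappa>" using x r by auto
      show ?thesis
        using tension_in_chart[OF smF[OF t] amb[OF t] \<kappa> param_in_dom[OF \<kappa> xU]] density[OF t x]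
        by (simp add: e_def coord_param[OF \<kappa> xU])
    qed
    have ce: "continuous_on ?B (\<lambda>x. N x + 2 * t * (b x * L x) + t\<^sup>2 * (L x)\<^sup>2)"
      by (intro continuous_intros cont)
    have "(LINT p:?K|vol. e p) = (LINT x:?B|lborel. dens x * e (param \<kappa> x))"
      by (rule set_integral_in_chart[OF \<kappa> compact_cball r]) (rule continuous_on_eq[OF ce], simp add: e)
    also have "\<dots> = (LINT x:?B|lborel. dens x * N x + ((2 * t) * (dens x * (b x * L x)) + t\<^sup>2 * (dens x * (L x)\<^sup>2)))"
      by (rule set_lebesgue_integral_cong) (auto simp: e algebra_simps)
    also have "\<dots> = I0 + ((2 * t) * I1 + t\<^sup>2 * I2)"
    proof -
      have i0: "set_integrable lborel ?B (\<lambda>x. dens x * N x)"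
        and i1: "set_integrable lborel ?B (\<lambda>x. (2 * t) * (dens x * (b x * L x)))"
        and i2: "set_integrable lborel ?B (\<lambda>x. t\<^sup>2 * (dens x * (L x)\<^sup>2))"
        by (intro int continuous_intros cd cont)+
      show ?thesis
        using set_integral_add(2)[OF i0 set_integral_add(1)[OF i1 i2]] set_integral_add(2)[OF i1 i2]
        by (simp add: I0_def I1_def I2_def)
    qed
    finally show ?thesis unfolding bienergy_def e_def by simp
  qed
  have "compact ?K"
    by (rule compact_continuous_image[OF continuous_on_subset[OF continuous_param[OF \<kappa>] r] compact_cball])
  then have D: "((\<lambda>t. bienergy \<A> g vol c ?K (F t)) has_real_derivative 0) (at 0)"
    using bih var by (auto simp: biharmonic_def)
  have "((\<lambda>t. 1/2 * (I0 + (2 * t) * I1 + t\<^sup>2 * I2)) has_real_derivative I1) (at 0)"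
    by (auto intro!: derivative_eq_intros)
  then have "((\<lambda>t. bienergy \<A> g vol c ?K (F t)) has_real_derivative I1) (at 0)"
    by (rule has_field_derivative_transform_within_open[where S = "{-\<epsilon><..<\<epsilon>}"])
      (use eps in \<open>auto simp: en\<close>)
  then have "I1 = 0" using D DERIV_unique by blast
  then show ?thesis by (simp add: I1_def)
qed

lemma smooth_on_joint:
  fixes \<epsilon> :: real
  assumes u: "smooth_map \<A> u" and \<kappa>: "\<kappa> \<in> \<A>"
  shows "smooth_on ({-\<epsilon><..<\<epsilon>} \<times> cod \<kappa>) (\<lambda>z. u (param \<kappa> (snd z)))"
proof -
  have S: "open ({-\<epsilon><..<\<epsilon>::real} \<times> cod \<kappa>)" by (intro open_Times open_greaterThanLessThan open_cod \<kappa>)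
  have "smooth_on ({-\<epsilon><..<\<epsilon>} \<times> cod \<kappa>) (\<lambda>z. (u \<circ> param \<kappa>) (snd z))"
    by (rule smooth_on_compose[OF S _ smooth_on_bounded_linear[OF bounded_linear_snd] smooth_in_chart[OF u \<kappa>]])
      auto
  then show ?thesis by simp
qed

text \<open>
  The two variations used are of this form: the points of \<open>f\<close> are moved for the time \<open>t \<phi>\<close> along a
  flow \<open>\<Phi>\<close> of isometries of the ambient space. Then \<open>b\<close> is the component of the tension field along
  the corresponding Killing field.
\<close>

lemma flow_variation_harmonic:
  fixes \<Phi> :: "real \<Rightarrow> 'n amb \<Rightarrow> 'n amb"
  assumes bih: "biharmonic \<A> g vol c f" and \<kappa>: "\<kappa> \<in> \<A>" and x0: "x0 \<in> cod \<kappa>"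
    and \<Phi>_0: "\<And>p. \<Phi> 0 p = p" and \<Phi>_ambient: "\<And>s p. p \<in> ambient c \<Longrightarrow> \<Phi> s p \<in> ambient c"
    and smooth_\<Phi>: "\<And>S \<theta> (u :: real \<times> (real^'n) \<Rightarrow> 'n amb). open S \<Longrightarrow> smooth_on S \<theta> \<Longrightarrow> smooth_on S u
      \<Longrightarrow> smooth_on S (\<lambda>z. \<Phi> (\<theta> z) (u z))"
    and N: "continuous_on (cod \<kappa>) N" and b: "smooth_on (cod \<kappa>) b"
    and density: "\<And>t x \<phi>. x \<in> cod \<kappa> \<Longrightarrow> smooth_on (cod \<kappa>) \<phi> \<Longrightarrow>
      (let w = \<lambda>y. \<Phi> (t * \<phi> y) ((f \<circ> param \<kappa>) y); \<tau> = tan_proj c (w x) (lap (g \<kappa>) w x)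
       in ip c \<tau> \<tau> = N x + 2 * t * (b x * lap (g \<kappa>) \<phi> x) + t\<^sup>2 * (lap (g \<kappa>) \<phi> x)\<^sup>2)"
  shows "lap (g \<kappa>) b x0 = 0"
proof -
  interpret local_metric "cod \<kappa>" "g \<kappa>" by (rule chart_metric[OF \<kappa>])
  show ?thesis
  proof (rule weakly_harmonic_imp_harmonic[OF b x0])
    fix r and \<phi> :: "real^'n \<Rightarrow> real"
    assume r: "r > 0" "cball x0 r \<subseteq> cod \<kappa>" and \<phi>: "smooth_on UNIV \<phi>"
      and out: "\<And>x. x \<notin> cball x0 r \<Longrightarrow> \<phi> x = 0"
    have \<phi>U: "smooth_on (cod \<kappa>) \<phi>" by (rule smooth_on_subset[OF \<phi>]) simp
    define F where "F t p = \<Phi> (t * push \<kappa> \<phi> p) (f p)" for t p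
    have smP: "smooth_map \<A> (push \<kappa> \<phi>)" by (rule smooth_push[OF \<kappa> \<phi> compact_cball r(2) out])
    have var: "smooth_variation \<A> c f (param \<kappa> ` cball x0 r) 1 F"
      unfolding smooth_variation_def
    proof (intro conjI ballI allI impI)
      show "F 0 = f" by (simp add: F_def fun_eq_iff \<Phi>_0)
      show "F t p \<in> ambient c" for t p
        unfolding F_def by (rule \<Phi>_ambient[OF f_ambient])
      show "F t p = f p" if "p \<notin> param \<kappa> ` cball x0 r" for t p
        using push_outside[OF \<kappa> out that] by (simp add: F_def \<Phi>_0)
      fix \<kappa>' assume \<kappa>': "\<kappa>' \<in> \<A>"
      show "smooth_on ({-1<..<1} \<times> cod \<kappa>') (\<lambda>(t, x). F t (param \<kappa>' x))"
        unfolding F_def case_prod_beta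
        by (intro smooth_\<Phi> smooth_on_mult smooth_on_joint[OF smP \<kappa>']
            smooth_on_joint[OF smooth_f \<kappa>'] smooth_on_bounded_linear bounded_linear_fst
            open_Times open_greaterThanLessThan open_cod \<kappa>')
    qed simp
    show "(LINT x:cball x0 r|lborel. dens x * (b x * lap (g \<kappa>) \<phi> x)) = 0"
    proof (rule first_variation[OF bih \<kappa> r(2) var])
      show "continuous_on (cball x0 r) N" "continuous_on (cball x0 r) b"
          "continuous_on (cball x0 r) (lap (g \<kappa>) \<phi>)"
        by (rule continuous_on_subset[OF _ r(2)],
            rule N smooth_on_imp_continuous_on[OF b] smooth_on_imp_continuous_on[OF smooth_lap[OF \<phi>U]])+
      fix t x assume "x \<in> cball x0 r"
      then have x: "x \<in> cod \<kappa>" using r(2) by auto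
      have w: "(F t \<circ> param \<kappa>) y = \<Phi> (t * \<phi> y) ((f \<circ> param \<kappa>) y)" if "y \<in> cod \<kappa>" for y
        by (simp add: F_def push_param[OF \<kappa> that])
      have lw: "lap (g \<kappa>) (F t \<circ> param \<kappa>) x = lap (g \<kappa>) (\<lambda>y. \<Phi> (t * \<phi> y) ((f \<circ> param \<kappa>) y)) x"
        by (rule lap_cong[OF open_U x w])
      have wx: "F t (param \<kappa> x) = \<Phi> (t * \<phi> x) ((f \<circ> param \<kappa>) x)" using w[OF x] by simp
      show "ip c (tan_proj c (F t (param \<kappa> x)) (lap (g \<kappa>) (F t \<circ> param \<kappa>) x))
           (tan_proj c (F t (param \<kappa> x)) (lap (g \<kappa>) (F t \<circ> param \<kappa>) x))
        = N x + 2 * t * (b x * lap (g \<kappa>) \<phi> x) + t\<^sup>2 * (lap (g \<kappa>) \<phi> x)\<^sup>2"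
        unfolding lw wx using density[OF x \<phi>U] unfolding Let_def .
    qed
  qed
qed

lemma height_biharmonic:
  assumes bih: "biharmonic \<A> g vol c f" and \<kappa>: "\<kappa> \<in> \<A>" and x0: "x0 \<in> cod \<kappa>"
  shows "lap (g \<kappa>) (lap (g \<kappa>) (\<lambda>y. snd ((f \<circ> param \<kappa>) y))) x0 = 0"
proof -
  interpret local_immersion "cod \<kappa>" "g \<kappa>" c "f \<circ> param \<kappa>" by (rule chart_immersion[OF \<kappa>])
  show ?thesis
  proof (rule flow_variation_harmonic[OF bih \<kappa> x0, where \<Phi> = "\<lambda>s p. p + s *\<^sub>R vert"])
    show "p + s *\<^sub>R vert \<in> ambient c" if "p \<in> ambient c" for s and p :: "'n amb"
      using that by (auto simp: ambient_def vert_def)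
    show "smooth_on S (\<lambda>z. u z + \<theta> z *\<^sub>R vert)" if "open S" "smooth_on S \<theta>" "smooth_on S u"
      for S \<theta> and u :: "real \<times> (real^'n) \<Rightarrow> 'n amb"
      using that by (intro smooth_on_add smooth_on_scaleR smooth_on_const)
    show "smooth_on (cod \<kappa>) (lap (g \<kappa>) (\<lambda>y. snd ((f \<circ> param \<kappa>) y)))"
      by (rule smooth_lap[OF smooth_on_snd[OF open_U smooth_u]])
    show "continuous_on (cod \<kappa>) (\<lambda>x. ip c (tan_proj c ((f \<circ> param \<kappa>) x) (lap (g \<kappa>) (f \<circ> param \<kappa>) x))
        (tan_proj c ((f \<circ> param \<kappa>) x) (lap (g \<kappa>) (f \<circ> param \<kappa>) x)))"
      by (rule smooth_on_imp_continuous_on[OF smooth_on_ip[OF open_U smooth_tension smooth_tension]])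
  qed (simp, unfold Let_def, rule vertical_energy_density)
qed

lemma angular_acceleration_harmonic:
  assumes bih: "biharmonic \<A> g vol c f" and i: "(UNIV :: 'n set) = {i}" and \<kappa>: "\<kappa> \<in> \<A>" and x0: "x0 \<in> cod \<kappa>"
  shows "lap (g \<kappa>) (local_immersion.ang_acc (g \<kappa>) c (f \<circ> param \<kappa>) i) x0 = 0"
proof -
  interpret local_immersion "cod \<kappa>" "g \<kappa>" c "f \<circ> param \<kappa>" by (rule chart_immersion[OF \<kappa>])
  note sA = smooth_ang_acc[OF i]
  have sh: "smooth_on (cod \<kappa>) (lap (g \<kappa>) (\<lambda>y. snd ((f \<circ> param \<kappa>) y)))"
    by (rule smooth_lap[OF smooth_on_snd[OF open_U smooth_u]])
  show ?thesis
  proof (rule flow_variation_harmonic[OF bih \<kappa> x0, where \<Phi> = "turn c"])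
    show "turn c s p \<in> ambient c" if "p \<in> ambient c" for s and p :: "'n amb"
      by (rule turn_ambient[OF c i that])
    show "smooth_on S (\<lambda>z. turn c (\<theta> z) (u z))" if "open S" "smooth_on S \<theta>" "smooth_on S u"
      for S \<theta> and u :: "real \<times> (real^'n) \<Rightarrow> 'n amb"
      using that by (rule smooth_on_turn[OF c])
    show "smooth_on (cod \<kappa>) (ang_acc i)" by (rule sA)
    show "continuous_on (cod \<kappa>) (\<lambda>x. (ang_acc i x)\<^sup>2 + (lap (g \<kappa>) (\<lambda>y. snd ((f \<circ> param \<kappa>) y)) x)\<^sup>2)"
      by (intro continuous_intros smooth_on_imp_continuous_on[OF sA] smooth_on_imp_continuous_on[OF sh])
  qed (simp, unfold Let_def, rule turned_energy_density[OF i])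
qed

text \<open>
  The definition of the shape operator contains the inverse metric; here it is multiplied away.
\<close>

lemma chart_umbilical:
  assumes \<xi>: "unit_normal_field \<A> c f \<xi>" and umb: "totally_umbilical \<A> g c f \<xi>" and \<kappa>: "\<kappa> \<in> \<A>"
  shows "local_umbilical (cod \<kappa>) (g \<kappa>) c (f \<circ> param \<kappa>) (\<xi> \<circ> param \<kappa>) (mean_curvature g c f \<xi> \<kappa>)"
proof -
  interpret local_immersion "cod \<kappa>" "g \<kappa>" c "f \<circ> param \<kappa>" by (rule chart_immersion[OF \<kappa>])
  let ?H = "mean_curvature g c f \<xi> \<kappa>"
  have "ip c (pd i (\<xi> \<circ> param \<kappa>) x) (pd l (f \<circ> param \<kappa>) x) = - ?H x * g \<kappa> x $ l $ i" if x: "x \<in> cod \<kappa>" for x i l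
  proof -
    define B where "B = (\<chi> l i. ip c (cov_deriv c (f \<circ> param \<kappa>) i (\<xi> \<circ> param \<kappa>) x) (pd l (f \<circ> param \<kappa>) x))"
    have "- (matrix_inv (g \<kappa> x) ** B) = mat (?H x)"
      using umb \<kappa> x by (simp add: totally_umbilical_def shape_op_def B_def)
    then have "matrix_inv (g \<kappa> x) ** B = - mat (?H x)" by (metis minus_minus)
    then have "B = g \<kappa> x ** (- mat (?H x))"
      by (metis matrix_inv_right[OF det_G_nz[OF x]] matrix_mul_assoc matrix_mul_lid)
    then have "B $ l $ i = - ?H x * g \<kappa> x $ l $ i"
      by (simp add: matrix_matrix_mult_def mat_def if_distrib sum_negf cong: if_cong)
    moreover have "ip c (radial (f (param \<kappa> x))) (pd l (f \<circ> param \<kappa>) x) = 0"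
      using pd_u_radial[OF _ x, of l] x ip_commute[of c "radial (f (param \<kappa> x))" "pd l (f \<circ> param \<kappa>) x"]
      by (simp add: comp_def)
    ultimately show ?thesis
      by (simp add: B_def cov_deriv_def tan_proj_def ip_simps)
  qed
  then show ?thesis
    by unfold_locales (use \<xi> \<kappa> in \<open>auto simp: unit_normal_field_def smooth_map_def ambient_tangent_def\<close>)
qed

end

theorem theorem4p1:
  fixes c :: real
    and \<A> :: "('a::{t2_space, second_countable_topology}, 'n::finite) chart set"
    and g :: "('a, 'n) metric"
    and vol :: "'a measure"
    and f \<xi> :: "'a \<Rightarrow> 'n amb"
  assumes "c \<in> {1, -1}"
    and "smooth_atlas \<A>"
    and "riemannian_metric \<A> g"
    and "riemannian_volume \<A> g vol"
    and "isometric_immersion \<A> g c f"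
    and "unit_normal_field \<A> c f \<xi>"
    and "totally_umbilical \<A> g c f \<xi>"
    and "biharmonic \<A> g vol c f"
  shows "minimal_hypersurface \<A> g c f \<xi>"
  unfolding minimal_hypersurface_def
proof (intro ballI)
  fix \<kappa> x assume \<kappa>: "\<kappa> \<in> \<A>" and x: "x \<in> cod \<kappa>"
  interpret isometric_hypersurface \<A> g vol c f
    using assms by unfold_locales auto
  interpret local_umbilical "cod \<kappa>" "g \<kappa>" c "f \<circ> param \<kappa>" "\<xi> \<circ> param \<kappa>" "mean_curvature g c f \<xi> \<kappa>"
    by (rule chart_umbilical[OF assms(6,7) \<kappa>])
  note bih = height_biharmonic[OF assms(8) \<kappa>]
  show "mean_curvature g c f \<xi> \<kappa> x = 0"
  proof (cases "CARD('n) \<ge> 2")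
    case True
    show ?thesis
      by (rule umbilical_height_biharmonic_imp_minimal[OF True _ x]) (simp only: ht_def[abs_def] bih)
  next
    case False
    then have "CARD('n) = 1" using zero_less_card_finite[where 'a = 'n] by linarith
    then obtain i where i: "(UNIV :: 'n set) = {i}" by (metis card_1_singletonE)
    have "tan_proj c ((f \<circ> param \<kappa>) x) (lap (g \<kappa>) (f \<circ> param \<kappa>) x) = 0"
      by (rule curve_biharmonic_imp_tension_eq_0[OF i angular_acceleration_harmonic[OF assms(8) i \<kappa>] bih x])
    then have "(real CARD('n) * mean_curvature g c f \<xi> \<kappa> x) *\<^sub>R (\<xi> \<circ> param \<kappa>) x = 0"
      by (simp only: tan_proj_lap_u[OF x])
    moreover have "(\<xi> \<circ> param \<kappa>) x \<noteq> 0" using \<xi>_unit[OF x] by (auto simp: ip_simps)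
    ultimately show ?thesis by simp
  qed
qed

end
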